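(* Let $\mathbf{p}=(p_i)_{i\ge 0}$ be a probability distribution on $\mathbb{N}_0$ such that $p_0>0$ and $p_i>0$ for at least one $i\ge 2$. Let $\mathcal{T}_{\mathbf{p},n}$ be a Galton--Watson tree with offspring distribution $\mathbf{p}$ conditioned to have size $n\in\mathbb{N}$ (only $n$ for which this conditioning is well defined are considered). Suppose that the mean $\sum_{i\ge 0}ip_i=1$ and that $\mathbf{p}$ satisfies one of the following conditions: (a) $\sigma_{\mathbf{p}}^2:=\sum_{i\ge 0}(i-1)^2p_i\in(0,\infty)$. (b) $\sigma_{\mathbf{p}}^2=\infty$ and $\mathbf{p}$ belongs to the domain of attraction of a stable law of index $\alpha\in(1,2]$; equivalently, there exists a slowly varying function $L:\mathbb{R}_+\to\mathbb{R}_+$ such that $\sum_{i=0}^k i^2p_i=k^{2-\alpha}L(k)$ as $k\to\infty$. Let $T_n\in\mathbb{T}$ be such that $|T_n|\to\infty$ as $n\to\infty$. Then, as $n\to\infty$: (i) If $n\pi_{\mathbf{p}}(T_n)\to\lambda$ for some $\lambda\in[0,\infty)$, then $N_{T_n}(\mathcal{T}_{\mathbf{p},n})$ converges in distribution to $\mathrm{Po}(\lambda)$, with convergence of all moments. (ii) If $n\pi_{\mathbf{p}}(T_n)\to\infty$, then $$\frac{N_{T_n}(\mathcal{T}_{\mathbf{p},n})-n\pi_{\mathbf{p}}(T_n)}{\sqrt{n\pi_{\mathbf{p}}(T_n)}}$$ converges in distribution to $\mathrm{N}(0,1)$.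
   Context: $\mathbb{N}_0=\{0,1,2,\dots\}$. $\mathbb{T}$ is the set of all finite rooted plane (ordered) trees (up to isomorphism of plane rooted trees); $|T|$ is the number of vertices of $T$, and $n_T(i)$ is the number of vertices of $T$ with exactly $i$ children. The Galton--Watson tree $\mathcal{T}_{\mathbf{p}}$ with offspring distribution $\mathbf{p}$ is the random plane rooted tree in which the numbers of children of the individuals are independent with distribution $\mathbf{p}$; thus for $T\in\mathbb{T}$, $\mathbb{P}(\mathcal{T}_{\mathbf{p}}=T)=\pi_{\mathbf{p}}(T):=\prod_{i\ge 0}p_i^{n_T(i)}$ (with $0^0=1$). $\mathcal{T}_{\mathbf{p},n}$ has the distribution of $\mathcal{T}_{\mathbf{p}}$ conditioned on $|\mathcal{T}_{\mathbf{p}}|=n$, and is well defined when $\mathbb{P}(|\mathcal{T}_{\mathbf{p}}|=n)>0$; limits as $n\to\infty$ are along such $n$. For $v\in T$, the fringe tree $T_v$ is the subtree of $T$ consisting of $v$ and all its descendants, rooted at $v$. For $T,T'\in\mathbb{T}$, $N_{T'}(T)=\#\{v\in T: T_v=T'\}$, where equality means isomorphism as plane rooted trees. $\mathrm{Po}(\lambda)$ is the Poisson distribution with mean $\lambda$ ($\mathrm{Po}(0)$ is the point mass at $0$); $\mathrm{N}(0,1)$ is the standard normal distribution. "Convergence of all moments" means that for every $r\in\mathbb{N}$ the $r$-th moment converges to the $r$-th moment of the limit. *)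

theory Defs
  imports "HOL-Probability.Probability"
begin

section \<open>Finite rooted plane trees\<close>

datatype plane_tree = Node (children: "plane_tree list")

text \<open>
  Vertices are addressed by Ulam--Harris words: the root is the empty word, and \<open>v @ [i]\<close> is the
  child number \<open>i\<close> (counted from 0) of \<open>v\<close>.  The datatype has exactly one element for each
  isomorphism class of finite rooted plane trees, so isomorphism is equality.
\<close>

primrec is_vertex :: "nat list \<Rightarrow> plane_tree \<Rightarrow> bool" where
  "is_vertex [] T \<longleftrightarrow> True"
| "is_vertex (i # v) T \<longleftrightarrow> i < length (children T) \<and> is_vertex v (children T ! i)"

definition vertices :: "plane_tree \<Rightarrow> nat list set" where
  "vertices T = {v. is_vertex v T}"

text \<open>The fringe tree \<open>T\<^sub>v\<close>; only meaningful for \<open>v \<in> vertices T\<close>.\<close>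

primrec fringe_tree :: "nat list \<Rightarrow> plane_tree \<Rightarrow> plane_tree" where
  "fringe_tree [] T = T"
| "fringe_tree (i # v) T = fringe_tree v (children T ! i)"

definition tree_size :: "plane_tree \<Rightarrow> nat" where
  "tree_size T = card (vertices T)"

definition degree_count :: "plane_tree \<Rightarrow> nat \<Rightarrow> nat" where
  "degree_count T i = card {v \<in> vertices T. length (children (fringe_tree v T)) = i}"

definition fringe_count :: "plane_tree \<Rightarrow> plane_tree \<Rightarrow> nat" where
  "fringe_count T' T = card {v \<in> vertices T. fringe_tree v T = T'}"

text \<open>
  The product over all \<open>i\<close> of \<open>p\<^sub>i\<close> to the power \<open>n\<^sub>T(i)\<close>, restricted to the finitely many \<open>i\<close>
  whose factor does not have exponent 0.
\<close>

definition tree_weight :: "nat pmf \<Rightarrow> plane_tree \<Rightarrow> real" where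
  "tree_weight p T = (\<Prod>i | degree_count T i \<noteq> 0. pmf p i ^ degree_count T i)"


section \<open>Galton--Watson trees\<close>

text \<open>
  Every Ulam--Harris word \<open>v\<close> carries an independent number \<open>\<xi> v\<close> of children with law \<open>p\<close>; the
  Galton--Watson tree, which may be infinite, consists of the words that are reached from the root.
\<close>

definition gw_space :: "nat pmf \<Rightarrow> (nat list \<Rightarrow> nat) measure" where
  "gw_space p = Pi\<^sub>M UNIV (\<lambda>_. measure_pmf p)"

definition gw_vertices :: "(nat list \<Rightarrow> nat) \<Rightarrow> nat list set" where
  "gw_vertices \<xi> = {v. \<forall>k<length v. v ! k < \<xi> (take k v)}"

text \<open>The Galton--Watson tree as a plane tree; only meaningful where it is finite.\<close>

definition gw_tree :: "(nat list \<Rightarrow> nat) \<Rightarrow> plane_tree" where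
  "gw_tree \<xi> = (THE T. vertices T = gw_vertices \<xi>)"

definition gw_size_event :: "nat pmf \<Rightarrow> nat \<Rightarrow> (nat list \<Rightarrow> nat) set" where
  "gw_size_event p n =
     {\<xi> \<in> space (gw_space p). finite (gw_vertices \<xi>) \<and> card (gw_vertices \<xi>) = n}"

text \<open>The law of the Galton--Watson tree conditioned to have \<open>n\<close> vertices.\<close>

definition conditioned_gw :: "nat pmf \<Rightarrow> nat \<Rightarrow> plane_tree measure" where
  "conditioned_gw p n =
     distr (uniform_measure (gw_space p) (gw_size_event p n)) (count_space UNIV) gw_tree"

text \<open>
  The filter of \<open>n \<rightarrow> \<infinity>\<close> along those \<open>n\<close> for which the conditioning is well defined.
\<close>

definition gw_sizes :: "nat pmf \<Rightarrow> nat filter" where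
  "gw_sizes p = inf sequentially (principal {n. measure (gw_space p) (gw_size_event p n) > 0})"

lemma vertices_Node:
  "vertices (Node ts) = insert [] {i # v | i v. i < length ts \<and> v \<in> vertices (ts ! i)}"
proof -
  have "is_vertex w (Node ts) \<longleftrightarrow>
      w \<in> insert [] {i # v | i v. i < length ts \<and> v \<in> vertices (ts ! i)}" for w
    by (cases w) (auto simp: vertices_def)
  thus ?thesis by (auto simp: vertices_def)
qed

lemma vertices_inject: "vertices T = vertices T' \<Longrightarrow> T = T'"
proof (induction T arbitrary: T')
  case (Node ts)
  obtain ts' where T': "T' = Node ts'" by (cases T')
  have eq: "i # v \<in> vertices (Node ts) \<longleftrightarrow> i # v \<in> vertices (Node ts')" for i v
    using Node.prems T' by simp
  have root: "[] \<in> vertices S" for S by (simp add: vertices_def)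
  have "i < length ts \<longleftrightarrow> i < length ts'" for i
    using eq[of i "[]"] root by (auto simp: vertices_Node)
  hence len: "length ts = length ts'" by (metis linorder_neqE_nat less_irrefl)
  have "ts ! i = ts' ! i" if "i < length ts" for i
  proof (rule Node.IH)
    show "ts ! i \<in> set ts" using that by simp
    show "vertices (ts ! i) = vertices (ts' ! i)"
      using eq[of i] that len by (auto simp: vertices_Node)
  qed
  thus ?case using len T' by (auto intro: nth_equalityI)
qed

lemma gw_tree_eq: "gw_vertices \<xi> = vertices T \<Longrightarrow> gw_tree \<xi> = T"
  unfolding gw_tree_def by (auto intro: vertices_inject)


section \<open>The conditions on the offspring distribution\<close>

definition offspring_variance :: "nat pmf \<Rightarrow> ennreal" where
  "offspring_variance p = (\<Sum>i. ennreal ((real i - 1)\<^sup>2 * pmf p i))"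

definition slowly_varying :: "(real \<Rightarrow> real) \<Rightarrow> bool" where
  "slowly_varying L \<longleftrightarrow>
     (\<forall>x>0. L x > 0) \<and> (\<forall>c>0. ((\<lambda>x. L (c * x) / L x) \<longlongrightarrow> 1) at_top)"

text \<open>
  The form, in terms of truncated second moments, of membership in the domain of attraction of a
  stable law of index \<open>\<alpha>\<close>, for distributions on the natural numbers with infinite variance.
\<close>

definition truncated_moments_regular :: "nat pmf \<Rightarrow> real \<Rightarrow> bool" where
  "truncated_moments_regular p \<alpha> \<longleftrightarrow>
     (\<exists>L. slowly_varying L \<and>
       (\<forall>\<^sub>F k in sequentially.
         (\<Sum>i\<le>k. (real i)\<^sup>2 * pmf p i) = real k powr (2 - \<alpha>) * L (real k)))"


section \<open>Limit laws\<close>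

definition poisson_law :: "real \<Rightarrow> real measure" where
  "poisson_law \<mu> =
     distr (measure_pmf (if \<mu> = 0 then return_pmf 0 else poisson_pmf \<mu>)) borel real"

definition conv_in_distribution ::
    "(nat \<Rightarrow> real measure) \<Rightarrow> real measure \<Rightarrow> nat filter \<Rightarrow> bool" where
  "conv_in_distribution M_seq M F \<longleftrightarrow>
     (\<forall>x. isCont (cdf M) x \<longrightarrow> ((\<lambda>n. cdf (M_seq n) x) \<longlongrightarrow> cdf M x) F)"

lemma conv_in_distribution_sequentially:
  "conv_in_distribution M_seq M sequentially \<longleftrightarrow> weak_conv_m M_seq M"
  by (simp add: conv_in_distribution_def weak_conv_m_def weak_conv_def)

definition conv_of_moments ::
    "(nat \<Rightarrow> real measure) \<Rightarrow> real measure \<Rightarrow> nat filter \<Rightarrow> bool" where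
  "conv_of_moments M_seq M F \<longleftrightarrow>
     (\<forall>r::nat. ((\<lambda>n. \<integral>x. x ^ r \<partial>M_seq n) \<longlongrightarrow> (\<integral>x. x ^ r \<partial>M)) F)"

end

theory Submission
  imports Defs "HOL-Real_Asymp.Real_Asymp"
begin

text \<open>
  The proof rests on an exact formula. Exploring a tree of size \<open>n\<close> depth-first turns the offspring numbers into a walk, and a
  fringe tree of size \<open>k\<close> into a block of \<open>k\<close> consecutive steps with total displacement \<open>-1\<close>. Contracting \<open>q\<close> marked blocks
  to single steps and applying the ballot theorem gives the \<open>q\<close>-th binomial moment of the number of fringe trees equal to \<open>T\<close>
  as \<open>tree_weight p T ^ q\<close> times a combinatorial factor of order \<open>n ^ q / fact q\<close> times a ratio of two probabilities of the
  walk, one with \<open>n - q * k\<close> and one with \<open>n\<close> steps (\<open>expectation_fringe_number_choose\<close>). The proof is an induction along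
  the exploration (\<open>forest_moment_eq\<close>).

  To see that the ratio is close to 1, the probabilities are written as Fourier integrals of powers of the characteristic
  function \<open>phi\<close> of the offspring number minus 1. Both conditions on the offspring law say that truncated second moments vary
  regularly with an index \<open>\<beta> < 1\<close> (\<open>exists_regularly_varying_sum\<close>); therefore \<open>1 - phi t\<close> is asymptotically
  \<open>\<kappa> * t\<^sup>2 * W (1 / t)\<close> with \<open>Re \<kappa> > 0\<close> (\<open>psi_asymptotics\<close>). The integrals are then dominated by the scale \<open>scale n\<close>
  on which \<open>n * (1 - phi t)\<close> is of order 1, and differences of probabilities are smaller than this scale by a factor of order
  \<open>k / sqrt n\<close>, or \<open>k\<^sup>2 / n\<close> for second differences. The probabilities themselves are not smaller than a multiple of
  \<open>scale n\<close> (\<open>walk_prob_lower_bound\<close>), because the density at 0 of the limiting stable law is positive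
  (\<open>stable_density_pos\<close>).

  In the first case of the theorem all binomial moments converge to \<open>\<mu> ^ q / fact q\<close> (\<open>binomial_moment_limit\<close>), and these
  determine the Poisson law. Trees that are too large for the estimates have exponentially small weight and contribute nothing.

  In the second case moments of growing order would be needed. They are avoided by a mixture. The formula depends on \<open>T\<close> only
  through its weight and its size \<open>k\<close>, so the number of copies of \<open>T\<close> is binomial given the number \<open>M\<close> of all fringe trees of
  size \<open>k\<close> (\<open>fringe_count_binomial_mixture\<close>). The success probability tends to 0, hence the binomial law is close to a Poisson
  law whose mean is a small multiple of \<open>M\<close>; and \<open>M\<close> is so concentrated (\<open>same_size_count_variance\<close>) that the fluctuations
  of this mean are negligible. Only the first two moments of \<open>M\<close> enter.
\<close>

section \<open>Vertices, sizes and weights of plane trees\<close>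

lemma vertices_Node_UN:
  "vertices (Node ts) = insert [] (\<Union>i<length ts. (#) i ` vertices (ts ! i))"
  by (auto simp: vertices_Node)

lemma finite_vertices [simp, intro]: "finite (vertices t)"
proof (induction t)
  case (Node ts)
  then show ?case by (auto simp: vertices_Node_UN)
qed

lemma root_in_vertices [simp]: "[] \<in> vertices t"
  by (simp add: vertices_def)

lemma sum_vertices_Node:
  "(\<Sum>v\<in>vertices (Node ts). g v) =
     g [] + (\<Sum>i<length ts. \<Sum>v\<in>vertices (ts ! i). g (i # v) :: 'a :: comm_monoid_add)"
proof -
  have "(\<Sum>v\<in>vertices (Node ts). g v) = g [] + (\<Sum>v\<in>(\<Union>i<length ts. (#) i ` vertices (ts ! i)). g v)"
    unfolding vertices_Node_UN by (subst sum.insert) auto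
  also have "(\<Sum>v\<in>(\<Union>i<length ts. (#) i ` vertices (ts ! i)). g v) =
     (\<Sum>i<length ts. \<Sum>v\<in>(#) i ` vertices (ts ! i). g v)"
    by (subst sum.UNION_disjoint) auto
  also have "\<dots> = (\<Sum>i<length ts. \<Sum>v\<in>vertices (ts ! i). g (i # v))"
    by (simp add: sum.reindex)
  finally show ?thesis .
qed

lemma prod_vertices_Node:
  "(\<Prod>v\<in>vertices (Node ts). g v) =
     g [] * (\<Prod>i<length ts. \<Prod>v\<in>vertices (ts ! i). g (i # v) :: 'a :: comm_monoid_mult)"
proof -
  have "(\<Prod>v\<in>vertices (Node ts). g v) = g [] * (\<Prod>v\<in>(\<Union>i<length ts. (#) i ` vertices (ts ! i)). g v)"
    unfolding vertices_Node_UN by (subst prod.insert) auto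
  also have "(\<Prod>v\<in>(\<Union>i<length ts. (#) i ` vertices (ts ! i)). g v) =
     (\<Prod>i<length ts. \<Prod>v\<in>(#) i ` vertices (ts ! i). g v)"
    by (subst prod.UNION_disjoint) auto
  also have "\<dots> = (\<Prod>i<length ts. \<Prod>v\<in>vertices (ts ! i). g (i # v))"
    by (simp add: prod.reindex)
  finally show ?thesis .
qed

text \<open>A set of trees is counted rather than a single tree, because the normal limit compares the copies of one
  tree with all fringe trees of the same size.\<close>

definition fringe_number :: "plane_tree set \<Rightarrow> plane_tree \<Rightarrow> nat" where
  "fringe_number Q t = card {v \<in> vertices t. fringe_tree v t \<in> Q}"

lemma fringe_number_conv_sum:
  "fringe_number Q t = (\<Sum>v\<in>vertices t. if fringe_tree v t \<in> Q then 1 else 0)"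
  unfolding fringe_number_def by (subst card_eq_sum, subst sum.inter_filter) auto

lemma fringe_number_Node:
  "fringe_number Q (Node ts) =
     (if Node ts \<in> Q then 1 else 0) + sum_list (map (fringe_number Q) ts)"
  unfolding fringe_number_conv_sum sum_vertices_Node
  by (simp add: sum_list_sum_nth atLeast0LessThan)

lemma fringe_count_eq: "fringe_count T t = fringe_number {T} t"
  by (simp add: fringe_count_def fringe_number_def)

lemma tree_size_Node: "tree_size (Node ts) = Suc (sum_list (map tree_size ts))"
proof -
  have "tree_size = fringe_number UNIV"
    by (intro ext) (simp add: tree_size_def fringe_number_def)
  thus ?thesis using fringe_number_Node[of UNIV ts] by simp
qed

lemma tree_size_pos: "tree_size t > 0"
  by (cases t) (simp add: tree_size_Node)

lemma fringe_number_le_size: "fringe_number Q t \<le> tree_size t"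
  unfolding fringe_number_def tree_size_def by (intro card_mono) auto

lemma fringe_number_eq_0:
  assumes "\<And>T. T \<in> Q \<Longrightarrow> tree_size T = k" "tree_size t < k"
  shows "fringe_number Q t = 0"
  using assms(2)
proof (induction t)
  case (Node ts)
  have "fringe_number Q t = 0" if "t \<in> set ts" for t
  proof (rule Node.IH[OF that])
    have "tree_size t \<le> sum_list (map tree_size ts)"
      using that by (intro member_le_sum_list) auto
    thus "tree_size t < k" using Node.prems by (simp add: tree_size_Node)
  qed
  moreover have "Node ts \<notin> Q" using assms(1)[of "Node ts"] Node.prems by auto
  ultimately show ?case by (simp add: fringe_number_Node)
qed

text \<open>Grouping the vertices by their degree, as the definition does, hides that the weight factorises over the
  subtrees of the root.\<close>

lemma tree_weight_conv_prod:
  "tree_weight p t = (\<Prod>v\<in>vertices t. pmf p (length (children (fringe_tree v t))))"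
proof -
  define deg where "deg = (\<lambda>v. length (children (fringe_tree v t)))"
  have "(\<Prod>v\<in>vertices t. pmf p (deg v)) =
      (\<Prod>i\<in>deg ` vertices t. \<Prod>v\<in>{v \<in> vertices t. deg v = i}. pmf p (deg v))"
    by (rule prod.image_gen[OF finite_vertices])
  also have "\<dots> = (\<Prod>i\<in>deg ` vertices t. pmf p i ^ degree_count t i)"
    by (intro prod.cong refl) (simp add: degree_count_def deg_def)
  also have "deg ` vertices t = {i. degree_count t i \<noteq> 0}"
    by (auto simp: degree_count_def deg_def card_eq_0_iff)
  finally show ?thesis by (simp add: tree_weight_def deg_def)
qed

lemma tree_weight_Node:
  "tree_weight p (Node ts) = pmf p (length ts) * prod_list (map (tree_weight p) ts)"
  unfolding tree_weight_conv_prod prod_vertices_Node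
  by (simp add: prod.list_conv_set_nth atLeast0LessThan)

lemma tree_weight_nonneg: "tree_weight p t \<ge> 0"
  by (auto simp: tree_weight_conv_prod intro: prod_nonneg)

lemma tree_weight_le_power:
  assumes "\<And>i. pmf p i \<le> \<rho>"
  shows "tree_weight p t \<le> \<rho> ^ tree_size t"
proof -
  have "tree_weight p t \<le> (\<Prod>v\<in>vertices t. \<rho>)"
    unfolding tree_weight_conv_prod by (intro prod_mono) (auto simp: assms)
  thus ?thesis by (simp add: tree_size_def)
qed

text \<open>Every vertex except the root is a child of exactly one vertex.\<close>

lemma tree_size_minus_1_eq_sum_degrees:
  "tree_size t = Suc (\<Sum>v\<in>vertices t. length (children (fringe_tree v t)))"
proof (induction t)
  case (Node ts)
  have "(\<Sum>i<length ts. tree_size (ts ! i)) =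
     (\<Sum>i<length ts. Suc (\<Sum>v\<in>vertices (ts ! i). length (children (fringe_tree v (ts ! i)))))"
    by (intro sum.cong refl Node.IH) auto
  also have "\<dots> = length ts + (\<Sum>i<length ts. \<Sum>v\<in>vertices (ts ! i). length (children (fringe_tree v (ts ! i))))"
    by (simp add: sum_Suc)
  finally show ?case
    by (simp add: tree_size_Node sum_list_sum_nth atLeast0LessThan sum_vertices_Node)
qed

text \<open>All periodicity conditions below come from here: a tree of positive weight has degrees in the support
  of the offspring law.\<close>

lemma dvd_tree_size_minus_1:
  assumes "\<And>i. pmf p i > 0 \<Longrightarrow> d dvd i" "tree_weight p t > 0"
  shows "d dvd tree_size t - 1"
proof -
  have "d dvd length (children (fringe_tree v t))" if "v \<in> vertices t" for v
  proof (rule assms(1))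
    have "pmf p (length (children (fringe_tree v t))) \<noteq> 0"
      using assms(2) that prod_zero[OF finite_vertices, of t "\<lambda>v. pmf p (length (children (fringe_tree v t)))"]
      unfolding tree_weight_conv_prod by (metis less_irrefl)
    thus "pmf p (length (children (fringe_tree v t))) > 0" by (simp add: order_less_le)
  qed
  thus ?thesis by (subst tree_size_minus_1_eq_sum_degrees) (auto intro: dvd_sum)
qed

lemma finite_trees_of_size: "finite {t. tree_size t \<le> n}"
proof (induction n)
  case 0
  have "\<not> tree_size t \<le> 0" for t using tree_size_pos[of t] by linarith
  hence "{t. tree_size t \<le> 0} = {}" by blast
  thus ?case by (simp only: finite.emptyI)
next
  case (Suc n)
  have "{t. tree_size t \<le> Suc n} \<subseteq>
      Node ` {ts. set ts \<subseteq> {t. tree_size t \<le> n} \<and> length ts \<le> n}"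
  proof
    fix t assume t: "t \<in> {t. tree_size t \<le> Suc n}"
    obtain ts where ts: "t = Node ts" by (cases t)
    have *: "sum_list (map tree_size ts) \<le> n" using t ts by (simp add: tree_size_Node)
    have "length ts \<le> sum_list (map tree_size ts)"
      proof (induction ts)
      case (Cons t ts)
      thus ?case using tree_size_pos[of t] by simp
    qed simp
    moreover have "tree_size u \<le> n" if "u \<in> set ts" for u
      using member_le_sum_list[of "tree_size u" "map tree_size ts"] that * by auto
    ultimately show "t \<in> Node ` {ts. set ts \<subseteq> {t. tree_size t \<le> n} \<and> length ts \<le> n}"
      using ts * by auto
  qed
  moreover have "finite \<dots>" by (intro finite_imageI finite_lists_length_le Suc.IH)
  ultimately show ?case by (rule finite_subset)
qed

lemma countable_trees: "countable (UNIV :: plane_tree set)"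
proof -
  have "(UNIV :: plane_tree set) = (\<Union>n. {t. tree_size t \<le> n})" by auto
  moreover have "countable \<dots>" by (intro countable_UN[OF countableI_type] countable_finite finite_trees_of_size)
  ultimately show ?thesis by simp
qed

section \<open>The law of the conditioned Galton--Watson tree\<close>

lemma gw_vertices_Nil [simp]: "[] \<in> gw_vertices \<xi>"
  by (simp add: gw_vertices_def)

lemma gw_vertices_Cons:
  "i # v \<in> gw_vertices \<xi> \<longleftrightarrow> i < \<xi> [] \<and> v \<in> gw_vertices (\<lambda>u. \<xi> (i # u))"
proof -
  have "(\<forall>k<length (i # v). (i # v) ! k < \<xi> (take k (i # v))) \<longleftrightarrow>
        i < \<xi> [] \<and> (\<forall>k<length v. v ! k < \<xi> (i # take k v))"
    by (subst length_Cons, subst All_less_Suc2) auto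
  thus ?thesis by (simp add: gw_vertices_def)
qed

lemma gw_vertices_eq_vertices_Node_iff:
  "gw_vertices \<xi> = vertices (Node ts) \<longleftrightarrow>
     \<xi> [] = length ts \<and> (\<forall>i<length ts. gw_vertices (\<lambda>u. \<xi> (i # u)) = vertices (ts ! i))"
proof
  assume eq: "gw_vertices \<xi> = vertices (Node ts)"
  have *: "i < \<xi> [] \<and> v \<in> gw_vertices (\<lambda>u. \<xi> (i # u)) \<longleftrightarrow>
        i < length ts \<and> v \<in> vertices (ts ! i)" for i v
    using eq gw_vertices_Cons[of i v \<xi>] by (auto simp: vertices_Node)
  have "i < \<xi> [] \<longleftrightarrow> i < length ts" for i using *[of i "[]"] by simp
  hence len: "\<xi> [] = length ts" by (metis linorder_neqE_nat less_irrefl)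
  show "\<xi> [] = length ts \<and> (\<forall>i<length ts. gw_vertices (\<lambda>u. \<xi> (i # u)) = vertices (ts ! i))"
    using len * by auto
next
  assume *: "\<xi> [] = length ts \<and> (\<forall>i<length ts. gw_vertices (\<lambda>u. \<xi> (i # u)) = vertices (ts ! i))"
  show "gw_vertices \<xi> = vertices (Node ts)"
  proof (rule set_eqI)
    fix w show "w \<in> gw_vertices \<xi> \<longleftrightarrow> w \<in> vertices (Node ts)"
      using * by (cases w) (auto simp: gw_vertices_Cons vertices_Node)
  qed
qed

text \<open>Whether the genealogy is a given finite tree is decided by the degrees at the vertices of that tree, so
  this event is a cylinder set over finitely many coordinates.\<close>

lemma gw_vertices_eq_vertices_iff:
  "gw_vertices \<xi> = vertices t \<longleftrightarrow> (\<forall>v\<in>vertices t. \<xi> v = length (children (fringe_tree v t)))"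
proof (induction t arbitrary: \<xi>)
  case (Node ts)
  have "gw_vertices \<xi> = vertices (Node ts) \<longleftrightarrow> \<xi> [] = length ts \<and>
      (\<forall>i<length ts. \<forall>v\<in>vertices (ts ! i). \<xi> (i # v) = length (children (fringe_tree v (ts ! i))))"
    unfolding gw_vertices_eq_vertices_Node_iff using Node.IH by auto
  also have "\<dots> \<longleftrightarrow> (\<forall>v\<in>vertices (Node ts). \<xi> v = length (children (fringe_tree v (Node ts))))"
    unfolding vertices_Node_UN by auto
  finally show ?case .
qed

lemma finite_gw_vertices_imp_tree:
  assumes "finite (gw_vertices \<xi>)"
  shows "\<exists>t. gw_vertices \<xi> = vertices t"
  using assms
proof (induction "card (gw_vertices \<xi>)" arbitrary: \<xi> rule: less_induct)
  case less
  have "\<exists>t. gw_vertices (\<lambda>u. \<xi> (i # u)) = vertices t" if "i < \<xi> []" for i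
  proof (rule less.hyps)
    have sub: "(#) i ` gw_vertices (\<lambda>u. \<xi> (i # u)) \<subset> gw_vertices \<xi>"
      using that by (auto simp: gw_vertices_Cons)
    have inj: "inj_on ((#) i) A" for A by (auto simp: inj_on_def)
    show "card (gw_vertices (\<lambda>u. \<xi> (i # u))) < card (gw_vertices \<xi>)"
      using psubset_card_mono[OF less.prems sub] by (simp add: card_image inj)
    show "finite (gw_vertices (\<lambda>u. \<xi> (i # u)))"
      using finite_subset[OF psubset_imp_subset[OF sub] less.prems] inj by (simp add: finite_image_iff)
  qed
  then obtain t where t: "\<And>i. i < \<xi> [] \<Longrightarrow> gw_vertices (\<lambda>u. \<xi> (i # u)) = vertices (t i)"
    by metis
  have "gw_vertices \<xi> = vertices (Node (map t [0..<\<xi> []]))"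
    unfolding gw_vertices_eq_vertices_Node_iff using t by simp
  thus ?case by blast
qed

definition tree_event :: "plane_tree \<Rightarrow> (nat list \<Rightarrow> nat) set" where
  "tree_event t = {\<xi>. gw_vertices \<xi> = vertices t}"

lemma disjoint_tree_events: "\<xi> \<in> tree_event t \<Longrightarrow> \<xi> \<in> tree_event t' \<Longrightarrow> t = t'"
  by (auto simp: tree_event_def intro: vertices_inject)

lemma space_gw_space [simp]: "space (gw_space p) = UNIV"
  by (auto simp: gw_space_def space_PiM PiE_UNIV_domain)

lemma
  shows tree_event_measurable [measurable]: "tree_event t \<in> sets (gw_space p)"
    and emeasure_tree_event: "emeasure (gw_space p) (tree_event t) = ennreal (tree_weight p t)"
proof -
  interpret product_prob_space "\<lambda>_ :: nat list. measure_pmf p" UNIV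
    by unfold_locales
  define X where "X = (\<lambda>v. {length (children (fringe_tree v t))})"
  have eq: "tree_event t = prod_emb UNIV (\<lambda>_. measure_pmf p) (vertices t) (Pi\<^sub>E (vertices t) X)"
    by (auto simp: tree_event_def gw_vertices_eq_vertices_iff prod_emb_def X_def PiE_def Pi_def
        extensional_def restrict_def)
  show "tree_event t \<in> sets (gw_space p)"
    unfolding eq gw_space_def by (intro sets_PiM_I) auto
  have "emeasure (gw_space p) (tree_event t) = (\<Prod>v\<in>vertices t. emeasure (measure_pmf p) (X v))"
    unfolding eq gw_space_def by (rule emeasure_PiM_emb) auto
  also have "\<dots> = (\<Prod>v\<in>vertices t. ennreal (pmf p (length (children (fringe_tree v t)))))"
    by (simp add: X_def emeasure_pmf_single)
  also have "\<dots> = ennreal (tree_weight p t)"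
    by (simp add: tree_weight_conv_prod prod_ennreal)
  finally show "emeasure (gw_space p) (tree_event t) = ennreal (tree_weight p t)" .
qed

definition trees_of_size :: "nat \<Rightarrow> plane_tree set" where
  "trees_of_size n = {t. tree_size t = n}"

lemma finite_trees_of_size' [simp, intro]: "finite (trees_of_size n)"
  by (rule finite_subset[OF _ finite_trees_of_size[of n]]) (auto simp: trees_of_size_def)

definition size_prob :: "nat pmf \<Rightarrow> nat \<Rightarrow> real" where
  "size_prob p n = (\<Sum>t\<in>trees_of_size n. tree_weight p t)"

lemma size_prob_nonneg: "size_prob p n \<ge> 0"
  by (auto simp: size_prob_def intro: sum_nonneg tree_weight_nonneg)

lemma gw_size_event_eq: "gw_size_event p n = (\<Union>t\<in>trees_of_size n. tree_event t)"
  by (auto simp: gw_size_event_def trees_of_size_def tree_event_def tree_size_def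
      dest!: finite_gw_vertices_imp_tree)

lemma
  shows gw_size_event_measurable [measurable]: "gw_size_event p n \<in> sets (gw_space p)"
    and emeasure_gw_size_event: "emeasure (gw_space p) (gw_size_event p n) = ennreal (size_prob p n)"
proof -
  show "gw_size_event p n \<in> sets (gw_space p)"
    unfolding gw_size_event_eq by (intro sets.finite_UN) auto
  have "emeasure (gw_space p) (gw_size_event p n) = (\<Sum>t\<in>trees_of_size n. emeasure (gw_space p) (tree_event t))"
    unfolding gw_size_event_eq
    by (rule sum_emeasure[symmetric])
       (auto simp: disjoint_family_on_def dest: disjoint_tree_events)
  also have "\<dots> = ennreal (size_prob p n)"
    by (simp add: emeasure_tree_event size_prob_def sum_ennreal tree_weight_nonneg)
  finally show "emeasure (gw_space p) (gw_size_event p n) = ennreal (size_prob p n)" .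
qed

lemma measure_gw_size_event: "measure (gw_space p) (gw_size_event p n) = size_prob p n"
  by (simp add: measure_def emeasure_gw_size_event size_prob_nonneg)

text \<open>Off the countably many events \<open>tree_event t\<close> the genealogy is infinite, and there \<open>gw_tree\<close> is the
  fixed arbitrary value \<open>THE t. False\<close>.\<close>

lemma gw_tree_measurable: "gw_tree \<in> measurable (gw_space p) (count_space UNIV)"
proof -
  have "gw_tree -` {t} \<inter> space (gw_space p) \<in> sets (gw_space p)" for t
  proof -
    have dflt: "gw_tree \<xi> = (THE t. False)" if "\<xi> \<notin> (\<Union>s. tree_event s)" for \<xi>
    proof -
      have "(\<lambda>T. vertices T = gw_vertices \<xi>) = (\<lambda>T. False)"
        using that by (auto simp: tree_event_def fun_eq_iff)
      thus ?thesis by (simp add: gw_tree_def)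
    qed
    have tree: "gw_tree \<xi> = s" if "\<xi> \<in> tree_event s" for \<xi> s
      using that by (auto simp: tree_event_def intro: gw_tree_eq)
    have "gw_tree -` {t} = tree_event t \<union> (if t = (THE t. False) then - (\<Union>s. tree_event s) else {})"
      using dflt tree by (auto split: if_splits)
    also have "\<dots> = tree_event t \<union> (if t = (THE t. False) then space (gw_space p) - (\<Union>s. tree_event s) else {})"
      by auto
    also have "\<dots> \<in> sets (gw_space p)"
      using sets.compl_sets[OF sets.countable_UN''[OF countable_trees, of tree_event "gw_space p"]]
      by (auto simp del: space_gw_space)
    finally show ?thesis by simp
  qed
  thus ?thesis
    by (subst measurable_count_space_eq_countable[OF countable_trees]) auto
qed

text \<open>As a mass function with finite support, the conditioned law makes every function of trees integrable
  and every expectation a finite sum.\<close>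

definition conditioned_gw_pmf :: "nat pmf \<Rightarrow> nat \<Rightarrow> plane_tree pmf" where
  "conditioned_gw_pmf p n =
     embed_pmf (\<lambda>t. if t \<in> trees_of_size n then tree_weight p t / size_prob p n else 0)"

lemma pmf_conditioned_gw_pmf:
  assumes "size_prob p n > 0"
  shows "pmf (conditioned_gw_pmf p n) t =
    (if t \<in> trees_of_size n then tree_weight p t / size_prob p n else 0)"
  unfolding conditioned_gw_pmf_def
proof (rule pmf_embed_pmf)
  let ?f = "\<lambda>t. if t \<in> trees_of_size n then tree_weight p t / size_prob p n else 0"
  have "(\<integral>\<^sup>+t. ennreal (?f t) \<partial>count_space UNIV) = (\<Sum>t\<in>trees_of_size n. ennreal (?f t))"
    by (rule nn_integral_count_space') auto
  also have "\<dots> = ennreal (\<Sum>t\<in>trees_of_size n. ?f t)"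
    using assms by (intro sum_ennreal) (auto intro!: divide_nonneg_pos tree_weight_nonneg)
  also have "(\<Sum>t\<in>trees_of_size n. ?f t) = 1"
    using assms by (simp flip: sum_divide_distrib size_prob_def)
  finally show "(\<integral>\<^sup>+t. ennreal (?f t) \<partial>count_space UNIV) = 1" by simp
qed (use assms in \<open>auto intro!: divide_nonneg_pos tree_weight_nonneg\<close>)

lemma conditioned_gw_eq:
  assumes pos: "size_prob p n > 0"
  shows "conditioned_gw p n = measure_pmf (conditioned_gw_pmf p n)"
proof (rule measure_eqI_countable[where A = UNIV])
  fix t :: plane_tree
  have "emeasure (conditioned_gw p n) {t} =
      emeasure (uniform_measure (gw_space p) (gw_size_event p n)) (gw_tree -` {t})"
    unfolding conditioned_gw_def using gw_tree_measurable[of p]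
    by (subst emeasure_distr) (auto simp: measurable_def)
  also have "\<dots> = emeasure (gw_space p) (gw_size_event p n \<inter> gw_tree -` {t}) /
      emeasure (gw_space p) (gw_size_event p n)"
    using measurable_sets[OF gw_tree_measurable, of "{t}" p]
    by (intro emeasure_uniform_measure) auto
  also have "gw_size_event p n \<inter> gw_tree -` {t} = (if t \<in> trees_of_size n then tree_event t else {})"
    using gw_tree_eq unfolding gw_size_event_eq tree_event_def by (auto split: if_splits)
  also have "emeasure (gw_space p) \<dots> / emeasure (gw_space p) (gw_size_event p n) =
      ennreal (pmf (conditioned_gw_pmf p n) t)"
    using pos by (auto simp: emeasure_tree_event emeasure_gw_size_event pmf_conditioned_gw_pmf
        divide_ennreal tree_weight_nonneg)
  finally show "emeasure (conditioned_gw p n) {t} = emeasure (measure_pmf (conditioned_gw_pmf p n)) {t}"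
    by (simp add: emeasure_pmf_single)
qed (auto simp: conditioned_gw_def countable_trees)

lemma set_conditioned_gw_pmf:
  assumes "size_prob p n > 0"
  shows "set_pmf (conditioned_gw_pmf p n) \<subseteq> trees_of_size n"
  by (auto simp: set_pmf_eq pmf_conditioned_gw_pmf[OF assms] split: if_splits)

lemma expectation_conditioned_gw_pmf:
  fixes g :: "plane_tree \<Rightarrow> 'a :: {banach, second_countable_topology}"
  assumes "size_prob p n > 0"
  shows "measure_pmf.expectation (conditioned_gw_pmf p n) g =
     (\<Sum>t\<in>trees_of_size n. tree_weight p t *\<^sub>R g t) /\<^sub>R size_prob p n"
  by (subst integral_measure_pmf[of "trees_of_size n"])
     (use set_conditioned_gw_pmf[OF assms] in
       \<open>auto simp: pmf_conditioned_gw_pmf assms scaleR_sum_right divide_inverse mult.commute\<close>)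

section \<open>Forests with marked fringe trees\<close>

definition forests :: "nat \<Rightarrow> nat \<Rightarrow> plane_tree list set" where
  "forests m n = {ts. length ts = m \<and> sum_list (map tree_size ts) = n}"

text \<open>The total weight of the forests of \<open>m\<close> trees and \<open>n\<close> vertices in which \<open>q\<close> fringe trees from \<open>Q\<close>
  are marked.\<close>

definition forest_moment :: "nat pmf \<Rightarrow> plane_tree set \<Rightarrow> nat \<Rightarrow> nat \<Rightarrow> nat \<Rightarrow> real" where
  "forest_moment p Q m n q =
     (\<Sum>ts\<in>forests m n. prod_list (map (tree_weight p) ts) *
        real (sum_list (map (fringe_number Q) ts) choose q))"

lemma length_le_forest_size: "length ts \<le> sum_list (map tree_size ts)"
proof (induction ts)
  case (Cons t ts)
  thus ?case using tree_size_pos[of t] by simp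
qed simp

lemma finite_forests [simp, intro]: "finite (forests m n)"
proof (rule finite_subset)
  show "forests m n \<subseteq> {ts. set ts \<subseteq> {t. tree_size t \<le> n} \<and> length ts = m}"
    using member_le_sum_list[of _ "map tree_size _"] by (fastforce simp: forests_def)
  show "finite {ts. set ts \<subseteq> {t. tree_size t \<le> n} \<and> length ts = m}"
    by (intro finite_lists_length_eq finite_trees_of_size)
qed

lemma forests_0_left: "forests 0 n = (if n = 0 then {[]} else {})"
  by (auto simp: forests_def)

lemma forests_Suc_0: "forests (Suc m) 0 = {}"
proof -
  have "ts \<notin> forests (Suc m) 0" for ts
    using length_le_forest_size[of ts] by (auto simp: forests_def simp del: sum_list_eq_0_iff)
  thus ?thesis by blast
qed

text \<open>One step of the depth-first exploration: the first tree gives way to the \<open>i\<close> subtrees of its root.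
  Since every tree has a vertex, \<open>i\<close> cannot exceed the number \<open>n\<close> of remaining vertices.\<close>

lemma bij_betw_remove_root:
  "bij_betw (\<lambda>(i, us). Node (take i us) # drop i us)
     (SIGMA i:{..n}. forests (m + i) n) (forests (Suc m) (Suc n))"
proof -
  have size: "sum_list (map tree_size (take i us)) + sum_list (map tree_size (drop i us)) =
      sum_list (map tree_size us)" for i us
    by (subst sum_list_append[symmetric], subst map_append[symmetric]) simp
  have root: "\<exists>cs us. ts = Node cs # us \<and> length us = m \<and>
      sum_list (map tree_size cs) + sum_list (map tree_size us) = n"
    if ts: "ts \<in> forests (Suc m) (Suc n)" for ts
  proof -
    obtain t us where tus: "ts = t # us" using ts by (auto simp: forests_def length_Suc_conv)
    obtain cs where "t = Node cs" by (cases t)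
    thus ?thesis using ts tus by (auto simp: forests_def tree_size_Node)
  qed
  show ?thesis
  proof (rule bij_betw_byWitness[where f' = "\<lambda>ts. (length (children (hd ts)), children (hd ts) @ tl ts)"],
      goal_cases)
    case 1
    show ?case by (auto simp: forests_def)
  next
    case 2
    show ?case using root by fastforce
  next
    case 3
    show ?case by (auto simp: forests_def tree_size_Node size)
  next
    case 4
    show ?case
    proof (rule image_subsetI)
      fix ts assume "ts \<in> forests (Suc m) (Suc n)"
      then obtain cs us where ts: "ts = Node cs # us" and len: "length us = m"
        and sz: "sum_list (map tree_size cs) + sum_list (map tree_size us) = n"
        using root by blast
      show "(length (children (hd ts)), children (hd ts) @ tl ts) \<in> (SIGMA i:{..n}. forests (m + i) n)"
        using ts len sz length_le_forest_size[of cs] by (auto simp: forests_def)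
    qed
  qed
qed

lemma sum_forests_Suc_Suc:
  fixes g :: "plane_tree list \<Rightarrow> 'a :: comm_monoid_add"
  shows "(\<Sum>ts\<in>forests (Suc m) (Suc n). g ts) =
      (\<Sum>i\<le>n. \<Sum>us\<in>forests (m + i) n. g (Node (take i us) # drop i us))"
proof -
  have "(\<Sum>ts\<in>forests (Suc m) (Suc n). g ts) =
      (\<Sum>x\<in>(SIGMA i:{..n}. forests (m + i) n). g (case x of (i, us) \<Rightarrow> Node (take i us) # drop i us))"
    by (rule sum.reindex_bij_betw[OF bij_betw_remove_root, symmetric])
  thus ?thesis by (simp add: sum.Sigma split_def)
qed

lemma bij_betw_Cons_forest:
  assumes "\<And>T. T \<in> Q \<Longrightarrow> tree_size T = k" "k \<le> n"
  shows "bij_betw (\<lambda>(T, us). T # us) (Q \<times> forests m (n - k)) {ts \<in> forests (Suc m) n. hd ts \<in> Q}"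
  by (rule bij_betw_byWitness[where f' = "\<lambda>ts. (hd ts, tl ts)"])
     (use assms in \<open>auto simp: forests_def length_Suc_conv\<close>)

text \<open>The root of the first tree is either unmarked, and is then replaced by its subtrees, or marked, and then
  the whole tree is cut off. In the second case nothing inside that tree can be marked as well: all trees in \<open>Q\<close>
  have the same size, so a proper fringe tree of one of them is too small to belong to \<open>Q\<close>.\<close>

lemma forest_moment_recursion:
  assumes Q: "\<And>T. T \<in> Q \<Longrightarrow> tree_size T = k"
  shows "forest_moment p Q (Suc m) (Suc n) q =
     (\<Sum>i\<le>n. pmf p i * forest_moment p Q (m + i) n q) +
     (if q > 0 \<and> k \<le> Suc n then (\<Sum>T\<in>Q. tree_weight p T) * forest_moment p Q m (Suc n - k) (q - 1) else 0)"
proof -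
  define w where "w = (\<lambda>ts. prod_list (map (tree_weight p) ts))"
  define N where "N = (\<lambda>ts. sum_list (map (fringe_number Q) ts))"
  have fm: "forest_moment p Q m n q = (\<Sum>ts\<in>forests m n. w ts * real (N ts choose q))" for m n q
    by (simp add: forest_moment_def w_def N_def)
  have w_append: "w (xs @ ys) = w xs * w ys" for xs ys by (simp add: w_def)
  have N_append: "N (xs @ ys) = N xs + N ys" for xs ys by (simp add: N_def)
  define g where "g = (\<lambda>ts. if q > 0 \<and> hd ts \<in> Q then w ts * real (N (tl ts) choose (q - 1)) else 0)"
  have root: "w (Node (take i us) # drop i us) * real (N (Node (take i us) # drop i us) choose q) =
      pmf p i * (w us * real (N us choose q)) + g (Node (take i us) # drop i us)"
    if "us \<in> forests (m + i) n" for i us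
  proof -
    have len: "length (take i us) = i" using that by (auto simp: forests_def)
    have w: "w (Node (take i us) # drop i us) = pmf p i * w us"
      using w_append[of "take i us" "drop i us"] len by (simp add: w_def tree_weight_Node)
    have N0: "N (take i us) = 0" if "Node (take i us) \<in> Q"
    proof -
      have "fringe_number Q t = 0" if "t \<in> set (take i us)" for t
      proof (rule fringe_number_eq_0[OF Q])
        have "tree_size t \<le> sum_list (map tree_size (take i us))"
          using that by (intro member_le_sum_list) auto
        thus "tree_size t < k" using Q[OF \<open>Node (take i us) \<in> Q\<close>] by (simp add: tree_size_Node)
      qed
      thus ?thesis by (simp add: N_def)
    qed
    have N: "N (Node (take i us) # drop i us) = (if Node (take i us) \<in> Q then 1 else 0) + N us"
      using N_append[of "take i us" "drop i us"] by (simp add: N_def fringe_number_Node)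
    show ?thesis
    proof (cases "q > 0 \<and> Node (take i us) \<in> Q")
      case True
      then obtain q' where q': "q = Suc q'" by (cases q) auto
      have "N us = N (drop i us)" using N_append[of "take i us" "drop i us"] N0 True by simp
      thus ?thesis using True N w by (simp add: g_def q' algebra_simps)
    next
      case False
      thus ?thesis using N w by (cases "q = 0") (auto simp: g_def)
    qed
  qed
  have "forest_moment p Q (Suc m) (Suc n) q =
      (\<Sum>i\<le>n. \<Sum>us\<in>forests (m + i) n.
         pmf p i * (w us * real (N us choose q)) + g (Node (take i us) # drop i us))"
    unfolding fm sum_forests_Suc_Suc
    by (intro sum.cong refl root)
  also have "\<dots> = (\<Sum>i\<le>n. pmf p i * forest_moment p Q (m + i) n q) +
      (\<Sum>ts\<in>forests (Suc m) (Suc n). g ts)"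
    unfolding sum_forests_Suc_Suc
    by (simp add: sum.distrib sum_distrib_left fm)
  also have "(\<Sum>ts\<in>forests (Suc m) (Suc n). g ts) = 
     (if q > 0 \<and> k \<le> Suc n then (\<Sum>T\<in>Q. tree_weight p T) * forest_moment p Q m (Suc n - k) (q - 1) else 0)"
  proof (cases "q > 0 \<and> k \<le> Suc n")
    case True
    have "(\<Sum>ts\<in>forests (Suc m) (Suc n). g ts) =
        (\<Sum>ts\<in>{ts \<in> forests (Suc m) (Suc n). hd ts \<in> Q}. w ts * real (N (tl ts) choose (q - 1)))"
      using True unfolding g_def by (subst sum.inter_filter) auto
    also have "\<dots> = (\<Sum>x\<in>Q \<times> forests m (Suc n - k). 
        w (case x of (T, us) \<Rightarrow> T # us) * real (N (tl (case x of (T, us) \<Rightarrow> T # us)) choose (q - 1)))"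
      using True by (intro sum.reindex_bij_betw[OF bij_betw_Cons_forest, symmetric] Q) auto
    also have "\<dots> = (\<Sum>T\<in>Q. tree_weight p T) * forest_moment p Q m (Suc n - k) (q - 1)"
      by (simp add: sum_product sum.cartesian_product split_def fm mult_ac w_def)
    finally show ?thesis using True by simp
  next
    case False
    have "g ts = 0" if ts: "ts \<in> forests (Suc m) (Suc n)" for ts
    proof -
      have "k \<le> Suc n" if "hd ts \<in> Q"
        using ts Q[OF that] by (auto simp: forests_def length_Suc_conv)
      thus ?thesis using False by (auto simp: g_def)
    qed
    thus ?thesis using False by auto
  qed
  finally show ?thesis .
qed

section \<open>Binomial moments of fringe tree counts\<close>

text \<open>The probability that \<open>l\<close> independent offspring numbers add up to \<open>y\<close>. As a coefficient of a power of
  the generating function it inherits convolution and size-biasing identities from formal power series.\<close>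

definition walk_prob :: "nat pmf \<Rightarrow> nat \<Rightarrow> nat \<Rightarrow> real" where
  "walk_prob p l y = fps_nth (Abs_fps (pmf p) ^ l) y"

lemma walk_prob_0: "walk_prob p 0 y = (if y = 0 then 1 else 0)"
  by (simp add: walk_prob_def)

lemma walk_prob_Suc: "walk_prob p (Suc l) y = (\<Sum>i\<le>y. pmf p i * walk_prob p l (y - i))"
  by (simp add: walk_prob_def fps_mult_nth atLeast0AtMost)

text \<open>By exchangeability each of the \<open>l + 1\<close> summands has the same share of the total \<open>y\<close>; algebraically
  this is the derivative of a power.\<close>

lemma walk_prob_size_biased:
  "real (Suc l) * (\<Sum>i\<le>y. real i * pmf p i * walk_prob p l (y - i)) = real y * walk_prob p (Suc l) y"
proof -
  define F where "F = Abs_fps (pmf p)"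
  have "fps_X * fps_deriv (F ^ Suc l) = of_nat (Suc l) * ((fps_X * fps_deriv F) * F ^ l)"
    by (simp add: fps_deriv_power' mult_ac del: of_nat_Suc power_Suc)
  hence "fps_nth (fps_X * fps_deriv (F ^ Suc l)) y = fps_nth (of_nat (Suc l) * ((fps_X * fps_deriv F) * F ^ l)) y"
    by (rule arg_cong)
  also have "\<dots> = real (Suc l) * fps_nth ((fps_X * fps_deriv F) * F ^ l) y"
    by (simp add: fps_of_nat[symmetric] del: of_nat_Suc)
  also have "fps_nth ((fps_X * fps_deriv F) * F ^ l) y = (\<Sum>i\<le>y. real i * pmf p i * walk_prob p l (y - i))"
    unfolding fps_mult_nth[of "fps_X * fps_deriv F"] walk_prob_def F_def[symmetric]
    by (intro sum.cong) (auto simp: F_def of_nat_diff split: if_splits)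
  also have "fps_nth (fps_X * fps_deriv (F ^ Suc l)) y = real y * walk_prob p (Suc l) y"
    by (cases y) (simp_all add: walk_prob_def F_def del: power_Suc)
  finally show ?thesis ..
qed

text \<open>The probability factor in the ballot theorem: \<open>l\<close> ordinary exploration steps and \<open>q\<close> steps that only remove
  a tree exhaust a forest of \<open>m\<close> trees for the first time at the end. The case without steps is separate because
  \<open>m / 0 = 0\<close>, whereas the empty forest needs the value 1.\<close>

definition ballot :: "nat pmf \<Rightarrow> nat \<Rightarrow> nat \<Rightarrow> nat \<Rightarrow> real" where
  "ballot p m l q =
     (if l + q = 0 then (if m = 0 then 1 else 0)
      else if m \<le> l + q then real m / real (l + q) * real (l + q choose q) * walk_prob p l (l + q - m)
      else 0)"

text \<open>Decompose by the first step. If it is an ordinary step with \<open>i\<close> children, the factor \<open>m + i\<close> splits the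
  sum over \<open>i\<close> into a convolution and a size-biased convolution, both of which are known; Pascal's rule accounts for the
  steps that remove a tree.\<close>

lemma ballot_step:
  assumes "l + q \<noteq> 0" "l + q \<le> Suc n"
  shows "ballot p (Suc m) l q =
    (if l > 0 then (\<Sum>i\<le>n. pmf p i * ballot p (m + i) (l - 1) q) else 0) +
    (if q > 0 then ballot p m l (q - 1) else 0)"
proof -
  consider "l + q = 1" | "l + q \<ge> 2" "m \<ge> l + q" | "l + q \<ge> 2" "m < l + q" "l = 0"
    | "l + q \<ge> 2" "m < l + q" "l > 0"
    using assms by linarith
  thus ?thesis
  proof cases
    case 1
    then consider "l = 1" "q = 0" | "l = 0" "q = 1" by (cases l) auto
    thus ?thesis
    proof cases
      case 1
      have "(\<Sum>i\<le>n. pmf p i * ballot p (m + i) (l - 1) q) =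
          (\<Sum>i\<le>n. if i = 0 then if m = 0 then pmf p 0 else 0 else 0)"
        using 1 by (intro sum.cong) (auto simp: ballot_def)
      thus ?thesis using 1 by (simp add: ballot_def walk_prob_Suc walk_prob_0)
    next
      case 2
      thus ?thesis by (auto simp: ballot_def walk_prob_0)
    qed
  next
    case 2
    have "(\<Sum>i\<le>n. pmf p i * ballot p (m + i) (l - 1) q) = 0" if "l > 0"
      using 2 that by (intro sum.neutral) (auto simp: ballot_def)
    thus ?thesis using 2 by (auto simp: ballot_def)
  next
    case 3
    show ?thesis
    proof (cases "q = Suc m")
      case True
      thus ?thesis using 3 by (simp add: ballot_def walk_prob_0)
    next
      case False
      hence "q - Suc m > 0" "q - Suc 0 - m > 0" using 3 by linarith+
      thus ?thesis using 3 by (simp add: ballot_def walk_prob_0)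
    qed
  next
    case 4
    define L where "L = l + q"
    define y where "y = L - 1 - m"
    define W where "W = walk_prob p l y"
    obtain l' where l': "l = Suc l'" using 4 by (cases l) auto
    have yn: "y \<le> n" using assms by (simp add: y_def L_def)
    define c where "c = real (L - 1 choose q) / real (L - 1)"
    have "(\<Sum>i\<le>n. pmf p i * ballot p (m + i) (l - 1) q) =
        (\<Sum>i\<le>y. c * ((real m + real i) * pmf p i * walk_prob p l' (y - i)))"
    proof (intro sum.mono_neutral_cong_right ballI)
      fix i assume i: "i \<in> {..n} - {..y}"
      hence "\<not> m + i \<le> l' + q" using 4 by (auto simp: y_def L_def l')
      thus "pmf p i * ballot p (m + i) (l - 1) q = 0" using 4 by (simp add: ballot_def l')
    next
      fix i assume i: "i \<in> {..y}"
      hence "m + i \<le> l' + q" "l' + q - (m + i) = y - i" "l' + q = L - 1" "l' + q \<noteq> 0"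
        using 4 by (auto simp: y_def L_def l')
      thus "pmf p i * ballot p (m + i) (l - 1) q = c * ((real m + real i) * pmf p i * walk_prob p l' (y - i))"
        by (simp add: ballot_def l' c_def)
    qed (use yn in auto)
    also have "\<dots> = c * (real m * (\<Sum>i\<le>y. pmf p i * walk_prob p l' (y - i)) +
        (\<Sum>i\<le>y. real i * pmf p i * walk_prob p l' (y - i)))"
      by (simp add: sum_distrib_left[symmetric] algebra_simps sum.distrib)
    also have "(\<Sum>i\<le>y. pmf p i * walk_prob p l' (y - i)) = W"
      by (simp add: W_def l' walk_prob_Suc)
    also have "(\<Sum>i\<le>y. real i * pmf p i * walk_prob p l' (y - i)) = real y / real l * W"
      using walk_prob_size_biased[of l' p y] by (simp add: W_def l' field_simps)
    finally have sum1: "(\<Sum>i\<le>n. pmf p i * ballot p (m + i) (l - 1) q) = c * (real m + real y / real l) * W"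
      by (simp add: algebra_simps)
    have b2: "(if q > 0 then ballot p m l (q - 1) else 0) =
        (real (L choose q) - real (L - 1 choose q)) / real (L - 1) * real m * W"
    proof (cases q)
      case 0
      thus ?thesis by simp
    next
      case (Suc q')
      have "real (L choose q) = real (L - 1 choose q') + real (L - 1 choose q)"
        by (simp add: L_def Suc l')
      thus ?thesis using 4 Suc by (simp add: ballot_def L_def W_def y_def l')
    qed
    have LHS: "ballot p (Suc m) l q = real (Suc m) / real L * real (L choose q) * W"
      using 4 by (simp add: ballot_def L_def W_def y_def)
    have binom: "real (L - 1 choose q) * real L = real l * real (L choose q)"
    proof -
      have "Suc (l' + q) * (l' + q choose q) = (Suc (l' + q) choose q) * (Suc (l' + q) - q)"
        using Suc_times_binomial_eq[of "l' + q" l'] binomial_symmetric[of q "l' + q"]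
          binomial_symmetric[of q "Suc (l' + q)"] by (simp add: Suc_diff_le mult_ac)
      hence "real (Suc (l' + q) * (l' + q choose q)) = real ((Suc (l' + q) choose q) * (Suc (l' + q) - q))"
        by (simp only:)
      thus ?thesis by (simp add: L_def l' Suc_diff_le algebra_simps)
    qed
    have y: "real y = real L - 1 - real m" using 4 by (simp add: y_def L_def of_nat_diff)
    have L: "real (L - 1) = real L - 1" "real L \<ge> 2" using 4 by (auto simp: L_def of_nat_diff)
    have lpos: "real l > 0" using 4 by simp
    have c: "c = real l * real (L choose q) / (real L * (real L - 1))"
      using binom L by (simp add: c_def field_simps)
    have bb: "real (L - 1 choose q) = real l * real (L choose q) / real L"
      using binom L by (simp add: field_simps)
    have "c * (real m + real y / real l) * W +
        (real (L choose q) - real (L - 1 choose q)) / real (L - 1) * real m * W =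
        real (Suc m) / real L * real (L choose q) * W"
    proof -
      define C x a d where "C = real (L choose q)" and "x = real L" and "a = real m" and "d = real l"
      have "d * C / (x * (x - 1)) * (a + (x - 1 - a) / d) * W + (C - d * C / x) / (x - 1) * a * W =
         (1 + a) / x * C * W"
        using L lpos unfolding x_def[symmetric] d_def[symmetric] by (simp add: divide_simps) (simp add: algebra_simps)
      thus ?thesis unfolding c bb y L(1) C_def x_def a_def d_def by simp
    qed
    thus ?thesis using sum1 b2 LHS 4 by simp
  qed
qed

text \<open>Both sides obey the recursion of the depth-first exploration. Contracting every marked tree to a single step
  leaves \<open>n - q * k\<close> ordinary steps. For \<open>q = 0\<close> this is the formula of Otter and Dwass for total progeny.\<close>

theorem forest_moment_eq:
  assumes Q: "\<And>T. T \<in> Q \<Longrightarrow> tree_size T = k" and k: "k > 0"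
  shows "forest_moment p Q m n q =
    (if q * k \<le> n then (\<Sum>T\<in>Q. tree_weight p T) ^ q * ballot p m (n - q * k) q else 0)"
proof (induction n arbitrary: m q rule: less_induct)
  case (less n)
  define \<pi> where "\<pi> = (\<Sum>T\<in>Q. tree_weight p T)"
  show ?case
  proof (cases m)
    case 0
    have "forest_moment p Q m n q = (if n = 0 \<and> q = 0 then 1 else 0)"
      by (cases q) (simp_all add: forest_moment_def forests_0_left 0)
    also have "\<dots> = (if q * k \<le> n then \<pi> ^ q * ballot p m (n - q * k) q else 0)"
      using k by (cases "q = 0") (auto simp: ballot_def 0)
    finally show ?thesis by (simp add: \<pi>_def)
  next
    case (Suc m')
    show ?thesis
    proof (cases n)
      case 0
      thus ?thesis using k by (auto simp: forest_moment_def forests_Suc_0 Suc ballot_def)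
    next
      case (Suc n')
      have IH1: "forest_moment p Q (m' + i) n' q =
          (if q * k \<le> n' then \<pi> ^ q * ballot p (m' + i) (n' - q * k) q else 0)" for i
        using less.IH[of n'] Suc by (simp add: \<pi>_def)
      have IH2: "forest_moment p Q m' (Suc n' - k) (q - 1) =
          (if (q - 1) * k \<le> Suc n' - k then \<pi> ^ (q - 1) * ballot p m' (Suc n' - k - (q - 1) * k) (q - 1) else 0)"
        using less.IH[of "Suc n' - k"] Suc k by (simp add: \<pi>_def)
      have rec: "forest_moment p Q m n q = (\<Sum>i\<le>n'. pmf p i * forest_moment p Q (m' + i) n' q) +
         (if q > 0 \<and> k \<le> Suc n' then \<pi> * forest_moment p Q m' (Suc n' - k) (q - 1) else 0)"
        unfolding Suc \<open>m = Suc m'\<close> \<pi>_def by (rule forest_moment_recursion[OF Q])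
      have second: "(if q > 0 \<and> k \<le> Suc n' then \<pi> * forest_moment p Q m' (Suc n' - k) (q - 1) else 0) =
          (if q > 0 \<and> q * k \<le> n then \<pi> ^ q * ballot p m' (n - q * k) (q - 1) else 0)"
      proof (cases q)
        case 0
        thus ?thesis by simp
      next
        case (Suc q')
        thus ?thesis unfolding IH2 using \<open>n = Suc n'\<close> by (auto simp: le_diff_conv2 add.commute)
      qed
      show ?thesis
      proof (cases "q * k \<le> n")
        case False
        thus ?thesis using rec second IH1 \<open>n = Suc n'\<close> by simp
      next
        case True
        define l where "l = n - q * k"
        have le: "l + q \<le> Suc n'"
        proof -
          have "q \<le> q * k" using k by simp
          thus ?thesis using True \<open>n = Suc n'\<close> unfolding l_def by linarith
        qed
        have ne: "l + q \<noteq> 0" using True \<open>n = Suc n'\<close> by (cases "q = 0") (auto simp: l_def)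
        have first: "(\<Sum>i\<le>n'. pmf p i * forest_moment p Q (m' + i) n' q) =
          \<pi> ^ q * (if l > 0 then (\<Sum>i\<le>n'. pmf p i * ballot p (m' + i) (l - 1) q) else 0)"
        proof (cases "l > 0")
          case True
          hence "q * k \<le> n'" "n' - q * k = l - 1" using \<open>n = Suc n'\<close> by (auto simp: l_def)
          thus ?thesis unfolding IH1 using True by (simp add: sum_distrib_left mult_ac)
        next
          case False
          hence "\<not> q * k \<le> n'" using \<open>n = Suc n'\<close> by (auto simp: l_def)
          thus ?thesis unfolding IH1 using False by simp
        qed
        have "forest_moment p Q m n q = \<pi> ^ q * ballot p (Suc m') l q"
          unfolding rec first second ballot_step[OF ne le] using True
          by (simp add: l_def distrib_left)
        thus ?thesis using True Suc by (simp add: l_def \<pi>_def \<open>m = Suc m'\<close>)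
      qed
    qed
  qed
qed

lemma sum_forests_1: "(\<Sum>ts\<in>forests 1 n. g ts) = (\<Sum>t\<in>trees_of_size n. g [t])"
proof -
  have "forests 1 n = (\<lambda>t. [t]) ` trees_of_size n"
    by (auto simp: forests_def trees_of_size_def length_Suc_conv)
  thus ?thesis by (simp add: sum.reindex inj_on_def)
qed

lemma size_prob_eq: 
  assumes "n > 0"
  shows "size_prob p n = walk_prob p n (n - 1) / real n"
proof -
  have "size_prob p n = forest_moment p {} 1 n 0"
    unfolding forest_moment_def sum_forests_1 by (simp add: size_prob_def)
  also have "\<dots> = walk_prob p n (n - 1) / real n"
    using assms by (subst forest_moment_eq[of _ 1]) (auto simp: ballot_def)
  finally show ?thesis .
qed

text \<open>The \<open>q\<close>-th binomial moment of the number of fringe trees from a set of trees of size \<open>k\<close>, divided by the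
  \<open>q\<close>-th power of the total weight of the set. It depends on the set through \<open>k\<close> alone, which later makes one tree
  comparable with all trees of its size.\<close>

definition marked_factor :: "nat pmf \<Rightarrow> nat \<Rightarrow> nat \<Rightarrow> nat \<Rightarrow> real" where
  "marked_factor p k n q =
     (if q * k \<le> n then real (n - q * k + q choose q) / real (n - q * k + q) *
        walk_prob p (n - q * k) (n - q * k + q - 1) / size_prob p n else 0)"

theorem expectation_fringe_number_choose:
  assumes Q: "\<And>T. T \<in> Q \<Longrightarrow> tree_size T = k" and k: "k > 0" and n: "size_prob p n > 0"
  shows "measure_pmf.expectation (conditioned_gw_pmf p n) (\<lambda>t. real (fringe_number Q t choose q)) =
    (\<Sum>T\<in>Q. tree_weight p T) ^ q * marked_factor p k n q"
proof -
  have "trees_of_size 0 = {}"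
    using tree_size_pos by (auto simp: trees_of_size_def intro: gr_implies_not0)
  hence "n > 0" using n by (cases n) (auto simp: size_prob_def)
  have "measure_pmf.expectation (conditioned_gw_pmf p n) (\<lambda>t. real (fringe_number Q t choose q)) =
     forest_moment p Q 1 n q / size_prob p n"
    unfolding expectation_conditioned_gw_pmf[OF n] forest_moment_def sum_forests_1
    by (simp add: divide_inverse mult.commute)
  also have "forest_moment p Q 1 n q =
      (if q * k \<le> n then (\<Sum>T\<in>Q. tree_weight p T) ^ q * ballot p 1 (n - q * k) q else 0)"
    by (rule forest_moment_eq) (use Q k in auto)
  also have "\<dots> / size_prob p n = (\<Sum>T\<in>Q. tree_weight p T) ^ q * marked_factor p k n q"
    using \<open>n > 0\<close>
    by (cases "q = 0") (auto simp: marked_factor_def ballot_def Suc_le_eq)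
  finally show ?thesis .
qed

section \<open>Regular variation along the integers\<close>

lemma tendsto_one_plus_inverse_powr: "(\<lambda>r. (real (Suc r) / real r) powr \<beta>) \<longlonglongrightarrow> 1"
proof -
  have "(\<lambda>r. real (Suc r) / real r) \<longlonglongrightarrow> 1" by (rule LIMSEQ_Suc_n_over_n)
  hence "(\<lambda>r. (real (Suc r) / real r) powr \<beta>) \<longlonglongrightarrow> 1 powr \<beta>"
    by (intro tendsto_powr tendsto_const) auto
  thus ?thesis by simp
qed

lemma filterlim_div_nat: "r > 0 \<Longrightarrow> filterlim (\<lambda>k::nat. k div r) at_top at_top"
  unfolding filterlim_at_top
proof (intro allI)
  fix Z :: nat assume "r > 0"
  thus "\<forall>\<^sub>F k in sequentially. Z \<le> k div r"
    by (intro eventually_sequentiallyI[of "Z * r"]) (simp add: less_eq_div_iff_mult_less_eq)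
qed

text \<open>Ratios are controlled only along integer multiples, which is all that a regularity condition at the integers
  gives; monotonicity upgrades them to arbitrary real factors.\<close>

locale regularly_varying =
  fixes W :: "nat \<Rightarrow> real" and \<beta> :: real
  assumes mono_W: "mono W"
    and W_nonneg: "\<And>k. W k \<ge> 0"
    and W_pos: "\<forall>\<^sub>F k in sequentially. W k > 0"
    and W_ratio: "\<And>m. m > 0 \<Longrightarrow> (\<lambda>k. W (m * k) / W k) \<longlonglongrightarrow> real m powr \<beta>"
begin

lemma W_ratio2:
  assumes "a > 0" "b > 0"
  shows "(\<lambda>k. W (a * k) / W (b * k)) \<longlonglongrightarrow> (real a / real b) powr \<beta>"
proof -
  have "(\<lambda>k. (W (a * k) / W k) / (W (b * k) / W k)) \<longlonglongrightarrow> real a powr \<beta> / real b powr \<beta>"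
    by (intro tendsto_divide W_ratio assms) (use assms in auto)
  moreover have "\<forall>\<^sub>F k in sequentially. (W (a * k) / W k) / (W (b * k) / W k) = W (a * k) / W (b * k)"
    using W_pos by eventually_elim auto
  ultimately have "(\<lambda>k. W (a * k) / W (b * k)) \<longlonglongrightarrow> real a powr \<beta> / real b powr \<beta>"
    by (rule Lim_transform_eventually)
  thus ?thesis by (simp add: powr_divide)
qed

text \<open>For \<open>r * i \<le> k < r * (i + 1)\<close> and \<open>i \<ge> r\<close>, both \<open>k\<close> and \<open>k + 1\<close> lie between \<open>r * i\<close> and \<open>(r + 1) * i\<close>,
  and the ratio of \<open>W\<close> at these two points is close to 1 for large \<open>r\<close>.\<close>

lemma W_Suc_ratio: "(\<lambda>k. W (Suc k) / W k) \<longlonglongrightarrow> 1"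
proof (rule order_tendstoI)
  fix l :: real assume "l < 1"
  show "\<forall>\<^sub>F k in sequentially. l < W (Suc k) / W k"
    using W_pos
  proof eventually_elim
    case (elim k)
    have "W k \<le> W (Suc k)" using mono_W by (auto simp: mono_def)
    hence "1 \<le> W (Suc k) / W k" using elim by simp
    thus ?case using \<open>l < 1\<close> by linarith
  qed
next
  fix u :: real assume "1 < u"
  have "\<forall>\<^sub>F r in sequentially. (real (Suc r) / real r) powr \<beta> < u"
    using tendsto_one_plus_inverse_powr \<open>1 < u\<close> by (rule order_tendstoD)
  hence "\<forall>\<^sub>F r in sequentially. (real (Suc r) / real r) powr \<beta> < u \<and> r > 0"
    using eventually_gt_at_top[of 0] by eventually_elim auto
  then obtain r :: nat where r: "(real (Suc r) / real r) powr \<beta> < u" "r > 0"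
    by (auto simp: eventually_sequentially)
  have "\<forall>\<^sub>F i in sequentially. W (Suc r * i) / W (r * i) < u"
    using W_ratio2[of "Suc r" r] r by (intro order_tendstoD) auto
  moreover have "\<forall>\<^sub>F i in sequentially. W (r * i) > 0"
    using eventually_compose_filterlim[OF W_pos mult_nat_left_at_top[OF \<open>r > 0\<close>]] .
  ultimately have "\<forall>\<^sub>F i in sequentially. W (Suc r * i) / W (r * i) < u \<and> W (r * i) > 0 \<and> i \<ge> r"
    using eventually_ge_at_top[of r] by eventually_elim auto
  from eventually_compose_filterlim[OF this filterlim_div_nat[OF \<open>r > 0\<close>]]
  show "\<forall>\<^sub>F k in sequentially. W (Suc k) / W k < u"
  proof eventually_elim
    case (elim k)
    define i where "i = k div r"
    have "k = r * i + k mod r" "k mod r < r"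
      using \<open>r > 0\<close> unfolding i_def by simp_all
    hence i: "r * i \<le> k" "Suc k \<le> r * i + r" by linarith+
    have "Suc k \<le> Suc r * i" using i elim by (simp add: i_def)
    hence "W (Suc k) \<le> W (Suc r * i)" using mono_W by (auto simp: mono_def)
    moreover have "W (r * i) \<le> W k" using mono_W i by (auto simp: mono_def)
    moreover have "W (r * i) > 0" using elim by (simp add: i_def)
    ultimately have "W (Suc k) / W k \<le> W (Suc r * i) / W (r * i)"
      by (intro frac_le) (auto simp: W_nonneg)
    also have "\<dots> < u" using elim by (simp add: i_def)
    finally show ?case .
  qed
qed

definition Wr :: "real \<Rightarrow> real" where "Wr x = W (nat \<lfloor>x\<rfloor>)"

lemma Wr_mono: "x \<le> y \<Longrightarrow> Wr x \<le> Wr y"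
  unfolding Wr_def by (intro monoD[OF mono_W] nat_mono floor_mono)

lemma Wr_nonneg: "Wr x \<ge> 0"
  by (simp add: Wr_def W_nonneg)

lemma filterlim_nat_floor: "filterlim (\<lambda>x::real. nat \<lfloor>x\<rfloor>) at_top at_top"
  by (intro filterlim_compose[OF filterlim_nat_sequentially filterlim_floor_sequentially])

lemma Wr_pos: "\<forall>\<^sub>F x in at_top. Wr x > 0"
  unfolding Wr_def by (rule eventually_compose_filterlim[OF W_pos filterlim_nat_floor])

text \<open>With \<open>a = \<lfloor>s * r\<rfloor>\<close>, the rationals \<open>a / r\<close> and \<open>(a + 1) / r\<close> squeeze the factor \<open>s\<close>. For \<open>x\<close> between
  \<open>r * i\<close> and \<open>r * (i + 1)\<close> only integer multiples of \<open>i\<close> and \<open>i + 1\<close> occur.\<close>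

lemma Wr_ratio:
  assumes s: "s > 0"
  shows "((\<lambda>x. Wr (s * x) / Wr x) \<longlongrightarrow> s powr \<beta>) at_top"
proof -
  define a where "a = (\<lambda>r::nat. nat \<lfloor>s * real r\<rfloor>)"
  have a_lim: "(\<lambda>r. real (a r) / real r) \<longlonglongrightarrow> s"
  proof (rule tendsto_sandwich)
    show "\<forall>\<^sub>F r in sequentially. s - 1 / real r \<le> real (a r) / real r"
      using eventually_gt_at_top[of 0]
    proof eventually_elim
      case (elim r)
      have "s * real r - 1 \<le> real (a r)" unfolding a_def using s by linarith
      hence "(s * real r - 1) / real r \<le> real (a r) / real r" by (rule divide_right_mono) simp
      thus ?case using elim by (simp add: diff_divide_distrib)
    qed
    show "\<forall>\<^sub>F r in sequentially. real (a r) / real r \<le> s"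
      using eventually_gt_at_top[of 0]
    proof eventually_elim
      case (elim r)
      have "real (a r) \<le> s * real r" unfolding a_def using s by simp
      thus ?case using elim by (simp add: field_simps)
    qed
    have "(\<lambda>r. s - 1 / real r) \<longlonglongrightarrow> s - 0" by (intro tendsto_intros lim_1_over_n)
    thus "(\<lambda>r. s - 1 / real r) \<longlonglongrightarrow> s" by simp
  qed auto
  have a_lim': "(\<lambda>r. real (Suc (a r)) / real r) \<longlonglongrightarrow> s"
  proof -
    have "(\<lambda>r. real (a r) / real r + 1 / real r) \<longlonglongrightarrow> s + 0" 
      by (intro tendsto_intros a_lim lim_1_over_n)
    thus ?thesis by (simp add: add_divide_distrib add.commute)
  qed
  have a_pos: "\<forall>\<^sub>F r in sequentially. a r > 0"
  proof -
    have "\<forall>\<^sub>F r in sequentially. 0 < real (a r) / real r"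
      using a_lim s by (rule order_tendstoD)
    thus ?thesis by eventually_elim (auto simp: zero_less_divide_iff)
  qed
  have bounds: "\<forall>\<^sub>F x in at_top. \<exists>i. W (a r * i) \<le> Wr (s * x) \<and> Wr (s * x) \<le> W (Suc (a r) * Suc i) \<and>
      W (r * i) \<le> Wr x \<and> Wr x \<le> W (r * Suc i) \<and> P i"
    if r: "r > 0" and P: "\<forall>\<^sub>F i in sequentially. P i" for r :: nat and P
  proof -
    have "filterlim (\<lambda>x::real. nat \<lfloor>x / real r\<rfloor>) at_top at_top"
    proof (rule filterlim_compose[OF filterlim_nat_floor])
      show "filterlim (\<lambda>x::real. x / real r) at_top at_top"
        using r by real_asymp
    qed
    from eventually_compose_filterlim[OF P this] show ?thesis
      using eventually_ge_at_top[of "0::real"]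
    proof eventually_elim
      case (elim x)
      define i where "i = nat \<lfloor>x / real r\<rfloor>"
      have "real i \<le> x / real r" "x / real r < real i + 1" unfolding i_def using elim by auto
      hence x: "real r * real i \<le> x" "x < real r * (real i + 1)"
        using r by (auto simp: field_simps)
      have asr: "real (a r) \<le> s * real r" "s * real r \<le> real (a r) + 1"
        
      proof -
        have "s * real r \<ge> 0" using s by simp
        thus "real (a r) \<le> s * real r" "s * real r \<le> real (a r) + 1" unfolding a_def by linarith+
      qed
      have "real (a r) * real i \<le> s * real r * real i" using asr by (intro mult_right_mono) auto
      also have "\<dots> \<le> s * x" using x s by (simp add: mult.assoc)
      finally have 1: "a r * i \<le> nat \<lfloor>s * x\<rfloor>" by (simp add: le_nat_floor)
      have "s * x \<le> s * real r * (real i + 1)" using x s by (simp add: mult.assoc)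
      also have "\<dots> \<le> (real (a r) + 1) * (real i + 1)" using asr by (intro mult_right_mono) auto
      also have "\<dots> = real (Suc (a r) * Suc i)" by (simp add: algebra_simps)
      finally have 2: "nat \<lfloor>s * x\<rfloor> \<le> Suc (a r) * Suc i" by linarith
      have 3: "r * i \<le> nat \<lfloor>x\<rfloor>" using x by (simp add: le_nat_floor)
      have "x \<le> real (r * Suc i)" using x by (simp add: algebra_simps)
      hence 4: "nat \<lfloor>x\<rfloor> \<le> r * Suc i" by linarith
      show ?case using 1 2 3 4 mono_W elim unfolding Wr_def i_def
        by (intro exI[of _ "nat \<lfloor>x / real r\<rfloor>"]) (auto simp: mono_def simp del: mult_Suc mult_Suc_right)
    qed
  qed
  have posr: "\<forall>\<^sub>F i in sequentially. W (r * i) > 0" if "r > 0" for r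
    using eventually_compose_filterlim[OF W_pos mult_nat_left_at_top[OF that]] .
  show ?thesis
  proof (rule order_tendstoI)
    fix l assume l: "l < s powr \<beta>"
    have "(\<lambda>r. (real (a r) / real r) powr \<beta>) \<longlonglongrightarrow> s powr \<beta>"
      using s by (intro tendsto_powr a_lim tendsto_const) auto
    from order_tendstoD(1)[OF this l] have "\<forall>\<^sub>F r in sequentially. l < (real (a r) / real r) powr \<beta> \<and> a r > 0 \<and> r > 0"
      using a_pos eventually_gt_at_top[of 0] by eventually_elim auto
    then obtain r where r: "l < (real (a r) / real r) powr \<beta>" "a r > 0" "r > 0"
      by (auto simp: eventually_sequentially)
    have "(\<lambda>i. (W (a r * i) / W (a r * Suc i)) * (W (a r * Suc i) / W (r * Suc i))) \<longlonglongrightarrow> 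
        1 * (real (a r) / real r) powr \<beta>"
    proof (intro tendsto_mult)
      show "(\<lambda>i. W (a r * Suc i) / W (r * Suc i)) \<longlonglongrightarrow> (real (a r) / real r) powr \<beta>"
        using W_ratio2[OF r(2,3)] by (rule LIMSEQ_Suc)
      have "(\<lambda>i. (W (a r * i) / W i) / (W (a r * Suc i) / W (Suc i)) / (W (Suc i) / W i)) \<longlonglongrightarrow>
         real (a r) powr \<beta> / real (a r) powr \<beta> / 1"
        using r by (intro tendsto_divide W_ratio LIMSEQ_Suc[OF W_ratio] W_Suc_ratio) auto
      moreover have "\<forall>\<^sub>F i in sequentially. (W (a r * i) / W i) / (W (a r * Suc i) / W (Suc i)) / (W (Suc i) / W i)
          = W (a r * i) / W (a r * Suc i)"
        using W_pos eventually_compose_filterlim[OF W_pos filterlim_Suc] by eventually_elim auto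
      ultimately show "(\<lambda>i. W (a r * i) / W (a r * Suc i)) \<longlonglongrightarrow> 1"
        using r by (simp add: tendsto_cong)
    qed
    from order_tendstoD(1)[OF this, of l] r(1)
    have "\<forall>\<^sub>F i in sequentially. l < (W (a r * i) / W (a r * Suc i)) * (W (a r * Suc i) / W (r * Suc i))" by simp
    moreover have "\<forall>\<^sub>F i in sequentially. W (r * i) > 0" using posr r by auto
    moreover have "\<forall>\<^sub>F i in sequentially. W (a r * Suc i) > 0"
      using eventually_compose_filterlim[OF posr[OF r(2)] filterlim_Suc] by simp
    ultimately have "\<forall>\<^sub>F i in sequentially. l < W (a r * i) / W (r * Suc i) \<and> W (r * i) > 0"
      by eventually_elim auto
    from bounds[OF r(3) this] show "\<forall>\<^sub>F x in at_top. l < Wr (s * x) / Wr x"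
    proof eventually_elim
      case (elim x)
      then obtain i where i: "W (a r * i) \<le> Wr (s * x)" "W (r * i) \<le> Wr x" "Wr x \<le> W (r * Suc i)"
        "l < W (a r * i) / W (r * Suc i)" "W (r * i) > 0" by blast
      have "W (a r * i) / W (r * Suc i) \<le> Wr (s * x) / Wr x"
        using i by (intro frac_le) (auto simp: Wr_nonneg)
      thus ?case using i by linarith
    qed
  next
    fix l assume l: "l > s powr \<beta>"
    have "(\<lambda>r. (real (Suc (a r)) / real r) powr \<beta>) \<longlonglongrightarrow> s powr \<beta>"
      using s by (intro tendsto_powr a_lim' tendsto_const) auto
    from order_tendstoD(2)[OF this l] have "\<forall>\<^sub>F r in sequentially. l > (real (Suc (a r)) / real r) powr \<beta> \<and> r > 0"
      using eventually_gt_at_top[of 0] by eventually_elim auto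
    then obtain r where r: "l > (real (Suc (a r)) / real r) powr \<beta>" "r > 0"
      by (auto simp: eventually_sequentially)
    have "(\<lambda>i. (W (Suc (a r) * Suc i) / W (Suc i)) * (W (Suc i) / W i) / (W (r * i) / W i)) \<longlonglongrightarrow> 
        real (Suc (a r)) powr \<beta> * 1 / real r powr \<beta>"
      using r by (intro tendsto_mult tendsto_divide W_Suc_ratio LIMSEQ_Suc[OF W_ratio] W_ratio) auto
    also have "real (Suc (a r)) powr \<beta> * 1 / real r powr \<beta> = (real (Suc (a r)) / real r) powr \<beta>"
      by (simp add: powr_divide)
    finally have "\<forall>\<^sub>F i in sequentially. l > (W (Suc (a r) * Suc i) / W (Suc i)) * (W (Suc i) / W i) / (W (r * i) / W i)"
      using r by (intro order_tendstoD) auto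
    moreover have "\<forall>\<^sub>F i in sequentially. W (r * i) > 0" using posr r by auto
    moreover note W_pos
    moreover have "\<forall>\<^sub>F i in sequentially. W (Suc i) > 0"
      using eventually_compose_filterlim[OF W_pos filterlim_Suc] by simp
    ultimately have "\<forall>\<^sub>F i in sequentially. l > W (Suc (a r) * Suc i) / W (r * i) \<and> W (r * i) > 0"
      by eventually_elim auto
    from bounds[OF r(2) this] show "\<forall>\<^sub>F x in at_top. l > Wr (s * x) / Wr x"
    proof eventually_elim
      case (elim x)
      then obtain i where i: "Wr (s * x) \<le> W (Suc (a r) * Suc i)" "W (r * i) \<le> Wr x"
        "l > W (Suc (a r) * Suc i) / W (r * i)" "W (r * i) > 0" by blast
      have "W (Suc (a r) * Suc i) / W (r * i) \<ge> Wr (s * x) / Wr x"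
        using i by (intro frac_le) (auto simp: Wr_nonneg W_nonneg simp del: mult_Suc mult_Suc_right)
      thus ?case using i by linarith
    qed
  qed
qed

text \<open>Iterate the bound for the factor 2.\<close>

lemma Potter_bound:
  assumes "\<beta> < \<gamma>" "0 \<le> \<gamma>"
  shows "\<exists>x0>0. \<forall>x\<ge>x0. Wr x > 0 \<and> (\<forall>s\<ge>1. Wr (s * x) \<le> 2 powr \<gamma> * s powr \<gamma> * Wr x)"
proof -
  have "\<forall>\<^sub>F x in at_top. Wr (2 * x) / Wr x < 2 powr \<gamma>"
    using Wr_ratio[of 2] assms by (intro order_tendstoD) auto
  hence "\<forall>\<^sub>F x in at_top. Wr x > 0 \<and> Wr (2 * x) \<le> 2 powr \<gamma> * Wr x"
    using Wr_pos by eventually_elim (auto simp: field_simps)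
  then obtain x1 where x1: "\<And>x. x \<ge> x1 \<Longrightarrow> Wr x > 0 \<and> Wr (2 * x) \<le> 2 powr \<gamma> * Wr x"
    by (auto simp: eventually_at_top_linorder)
  define x0 where "x0 = max 1 x1"
  show ?thesis
  proof (intro exI[of _ x0] conjI allI impI)
    fix x s :: real assume x: "x \<ge> x0" and s: "s \<ge> 1"
    have iter: "Wr (2 ^ m * x) \<le> (2 ^ m) powr \<gamma> * Wr x" for m
    proof (induction m)
      case (Suc m)
      have "1 * x \<le> 2 ^ m * x" using x by (intro mult_right_mono) (auto simp: x0_def)
      hence "2 ^ m * x \<ge> x1" using x unfolding x0_def by linarith
      hence "Wr (2 * (2 ^ m * x)) \<le> 2 powr \<gamma> * Wr (2 ^ m * x)" using x1 by blast
      also have "\<dots> \<le> 2 powr \<gamma> * ((2 ^ m) powr \<gamma> * Wr x)" by (intro mult_left_mono Suc.IH) auto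
      finally show ?case by (simp add: powr_mult mult_ac)
    qed simp
    define m where "m = nat \<lceil>log 2 s\<rceil>"
    have m: "log 2 s \<le> real m" "real m \<le> log 2 s + 1"
    proof -
      have "log 2 s \<ge> 0" using s by simp
      thus "log 2 s \<le> real m" "real m \<le> log 2 s + 1" unfolding m_def by linarith+
    qed
    have pow: "(2::real) ^ m = 2 powr real m" by (simp add: powr_realpow)
    have 1: "s \<le> 2 ^ m" unfolding pow using m s by (simp add: log_le_iff)
    have "(2::real) powr real m \<le> 2 powr (log 2 s + 1)" using m by (intro powr_mono) auto
    also have "\<dots> = 2 * s" using s by (simp add: powr_add)
    finally have 2: "(2::real) ^ m \<le> 2 * s" by (simp add: pow)
    have "Wr (s * x) \<le> Wr (2 ^ m * x)" using 1 x by (intro Wr_mono mult_right_mono) (auto simp: x0_def)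
    also have "\<dots> \<le> (2 ^ m) powr \<gamma> * Wr x" by (rule iter)
    also have "\<dots> \<le> (2 * s) powr \<gamma> * Wr x"
      using 2 assms by (intro mult_right_mono powr_mono2 Wr_nonneg) auto
    finally show "Wr (s * x) \<le> 2 powr \<gamma> * s powr \<gamma> * Wr x" using s by (simp add: powr_mult)
  qed (use x1 in \<open>auto simp: x0_def\<close>)
qed

end

section \<open>The kernel of the characteristic exponent\<close>

text \<open>For a centred integrable \<open>X\<close> one has \<open>1 - E exp (i t X) = t\<^sup>2 * E (X\<^sup>2 * kern (t * X))\<close>. This expresses the
  behaviour of the characteristic function at the origin by truncated second moments.\<close>

definition kern :: "real \<Rightarrow> complex" where
  "kern u = (1 + \<i> * u - exp (\<i> * u)) / u ^ 2"

definition dkern :: "real \<Rightarrow> complex" where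
  "dkern u = (\<i> - \<i> * exp (\<i> * u)) / u ^ 2 - 2 * (1 + \<i> * u - exp (\<i> * u)) / u ^ 3"

lemma kern_has_vector_derivative: 
  assumes "u \<noteq> 0"
  shows "(kern has_vector_derivative dkern u) (at u)"
proof -
  have "((\<lambda>z. (1 + \<i> * z - exp (\<i> * z)) / z ^ 2) has_field_derivative dkern u) (at (complex_of_real u))"
    using assms unfolding dkern_def
    by (auto intro!: derivative_eq_intros simp: field_simps power2_eq_square power3_eq_cube)
  from has_vector_derivative_real_field[OF this] show ?thesis
    by (simp add: kern_def[abs_def])
qed

lemma norm_iexp_quadratic:
  fixes u :: real
  shows "norm (exp (\<i> * u) - (1 + \<i> * u - u ^ 2 / 2)) \<le> \<bar>u\<bar> ^ 3 / 6"
proof -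
  have "cmod (exp (\<i> * u) - (\<Sum>k\<le>2. (\<i> * u)^k / fact k)) \<le> \<bar>u\<bar>^3 / fact 3"
    using iexp_approx1[of u 2] by (simp add: numeral_3_eq_3 numeral_2_eq_2)
  also have "(\<Sum>k\<le>2. (\<i> * u)^k / fact k) = 1 + \<i> * u - u ^ 2 / 2"
    by (simp add: numeral_2_eq_2 power2_eq_square field_simps)
  finally show ?thesis by (simp add: fact_numeral)
qed

lemma norm_dkern_le_1:
  assumes "0 < u" "u \<le> 1"
  shows "norm (dkern u) \<le> 1"
proof -
  define R where "R = exp (\<i> * u) - (1 + \<i> * u - u ^ 2 / 2)"
  have R: "norm R \<le> u ^ 3 / 6"
    unfolding R_def using norm_iexp_quadratic[of u] assms by simp
  have e: "exp (\<i> * u) = R + (1 + \<i> * u - u ^ 2 / 2)" by (simp add: R_def)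
  have dKu: "dkern u * u ^ 3 = \<i> * u ^ 3 / 2 + (2 - \<i> * u) * R"
  proof -
    have clear: "(X / U ^ 2 - 2 * Y / U ^ 3) * U ^ 3 = X * U - 2 * Y" if "U \<noteq> 0" for X Y U :: complex
      using that by (simp add: field_simps power2_eq_square power3_eq_cube)
    have "dkern u * u ^ 3 = (\<i> - \<i> * exp (\<i> * u)) * u - 2 * (1 + \<i> * u - exp (\<i> * u))"
      unfolding dkern_def of_real_power by (rule clear) (use assms in simp)
    also have "\<dots> = \<i> * u ^ 3 / 2 + (2 - \<i> * u) * R"
      unfolding e of_real_power by (simp add: algebra_simps power2_eq_square power3_eq_cube)
    finally show ?thesis .
  qed
  have "norm (dkern u) * u ^ 3 = norm (dkern u * complex_of_real (u ^ 3))"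
    using assms by (simp only: norm_mult norm_of_real abs_of_pos zero_less_power)
  also have "\<dots> \<le> norm (\<i> * complex_of_real (u ^ 3) / 2) + norm ((2 - \<i> * u) * R)"
    unfolding dKu by (rule norm_triangle_ineq)
  also have "norm (\<i> * complex_of_real (u ^ 3) / 2) = u ^ 3 / 2"
    using assms by (simp add: norm_mult norm_divide norm_power)
  also have "norm ((2 - \<i> * u) * R) \<le> 3 * (u ^ 3 / 6)"
    unfolding norm_mult
  proof (intro mult_mono R)
    have "norm (2 - \<i> * complex_of_real u) \<le> norm (2::complex) + norm (\<i> * complex_of_real u)"
      by (rule norm_triangle_ineq4)
    also have "\<dots> \<le> 3" using assms by (simp add: norm_mult)
    finally show "norm (2 - \<i> * complex_of_real u) \<le> 3" .
  qed auto
  also have "u ^ 3 / 2 + 3 * (u ^ 3 / 6) = 1 * u ^ 3" by simp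
  finally show ?thesis using assms by (simp only: mult_le_cancel_right) auto
qed

lemma norm_kern_numerator: "0 \<le> u \<Longrightarrow> norm (1 + \<i> * u - exp (\<i> * u)) \<le> 2 + u"
proof -
  assume "0 \<le> u"
  have "norm (1 + \<i> * u - exp (\<i> * u)) \<le> norm (1 + \<i> * complex_of_real u) + norm (exp (\<i> * u))"
    by (rule norm_triangle_ineq4)
  also have "\<dots> \<le> (norm (1::complex) + norm (\<i> * complex_of_real u)) + 1"
    by (intro add_mono norm_triangle_ineq) simp
  finally show ?thesis using \<open>0 \<le> u\<close> by (simp add: norm_mult)
qed

text \<open>The decay \<open>1 / u\<^sup>2\<close> remains integrable at infinity after multiplication by a power of exponent less than 1;
  this is where a stable index above 1 enters.\<close>

lemma norm_dkern_le:
  assumes "0 < u"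
  shows "norm (dkern u) \<le> 8 / u ^ 2"
proof (cases "u \<le> 1")
  case True
  hence "norm (dkern u) \<le> 1" using norm_dkern_le_1 assms by blast
  also have "1 \<le> 8 / u ^ 2" using True assms power_le_one[of u 2] by (simp add: field_simps)
  finally show ?thesis .
next
  case False
  have "norm (dkern u) \<le> norm ((\<i> - \<i> * exp (\<i> * u)) / complex_of_real (u ^ 2)) + 
      norm (2 * (1 + \<i> * u - exp (\<i> * u)) / complex_of_real (u ^ 3))"
    unfolding dkern_def of_real_power by (rule norm_triangle_ineq4)
  also have "norm ((\<i> - \<i> * exp (\<i> * u)) / complex_of_real (u ^ 2)) = norm (\<i> - \<i> * exp (\<i> * u)) / u ^ 2"
    using assms by (simp add: norm_divide norm_power)
  also have "norm (\<i> - \<i> * exp (\<i> * u)) \<le> norm \<i> + norm (\<i> * exp (\<i> * u))"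
    by (rule norm_triangle_ineq4)
  also have "norm \<i> + norm (\<i> * exp (\<i> * u)) = 2" by (simp add: norm_mult)
  also have "norm (2 * (1 + \<i> * u - exp (\<i> * u)) / complex_of_real (u ^ 3)) = 
      2 * norm (1 + \<i> * u - exp (\<i> * u)) / u ^ 3"
    using assms by (simp only: norm_divide norm_mult norm_numeral norm_of_real abs_of_pos zero_less_power)
  also have "norm (1 + \<i> * u - exp (\<i> * u)) \<le> 2 + u" using assms by (intro norm_kern_numerator) auto
  also have "2 + u \<le> 3 * u" using False by simp
  also have "2 / u ^ 2 + 2 * (3 * u) / u ^ 3 = 8 / u ^ 2"
    using assms by (simp add: power2_eq_square power3_eq_cube field_simps)
  finally show ?thesis using assms by (simp add: divide_right_mono)
qed

lemma norm_kern_le: "0 < u \<Longrightarrow> norm (kern u) \<le> (2 + u) / u ^ 2"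
  using norm_kern_numerator[of u] by (simp add: kern_def norm_divide norm_power divide_right_mono)

lemma kern_tendsto_0: "(kern \<longlongrightarrow> 0) at_top"
proof (rule Lim_null_comparison)
  show "\<forall>\<^sub>F u in at_top. norm (kern u) \<le> (2 + u) / u ^ 2"
    using eventually_gt_at_top[of 0] by eventually_elim (rule norm_kern_le)
  show "((\<lambda>u::real. (2 + u) / u ^ 2) \<longlongrightarrow> 0) at_top" by real_asymp
qed

lemma Re_kern: "Re (kern u) = (1 - cos u) / u ^ 2"
proof -
  have "kern u = (1 / u ^ 2) *\<^sub>R (1 + \<i> * u - exp (\<i> * u))" by (simp add: kern_def scaleR_conv_of_real)
  thus ?thesis by (simp only: scaleR_complex.sel) (simp add: Re_exp)
qed

lemma Re_kern_nonneg: "Re (kern u) \<ge> 0"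
  by (simp add: Re_kern)

lemma one_minus_cos_ge:
  assumes "0 \<le> u" "u \<le> 1"
  shows "1 - cos u \<ge> u ^ 2 / (3::real)"
proof -
  have "norm (exp (\<i> * u) - (1 + \<i> * u - u ^ 2 / 2)) \<le> \<bar>u\<bar> ^ 3 / 6" by (rule norm_iexp_quadratic)
  hence "\<bar>Re (exp (\<i> * u) - (1 + \<i> * u - complex_of_real (u ^ 2 / 2)))\<bar> \<le> u ^ 3 / 6"
    using assms abs_Re_le_cmod[of "exp (\<i> * u) - (1 + \<i> * u - u ^ 2 / 2)"] by (simp add: fact_numeral)
  hence "\<bar>cos u - (1 - u ^ 2 / 2)\<bar> \<le> u ^ 3 / 6" by (simp add: Re_exp)
  moreover have "u ^ 3 \<le> u ^ 2" using assms by (intro power_decreasing) auto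
  ultimately show ?thesis by linarith
qed

text \<open>Together with \<open>Re_kern_nonneg\<close> this bounds the real part of a weighted sum of kernel values from below by
  the weight below the truncation point.\<close>

lemma Re_kern_ge: "0 < u \<Longrightarrow> u \<le> 1 \<Longrightarrow> Re (kern u) \<ge> 1 / 3"
  using one_minus_cos_ge[of u] by (simp add: Re_kern field_simps)

lemma dkern_measurable [measurable]: "dkern \<in> borel_measurable borel"
  unfolding dkern_def by measurable

lemma integrable_powr_atLeast:
  fixes a e :: real
  assumes "a > 0" "e < -1"
  shows "integrable lborel (\<lambda>x. indicator {a..} x * x powr e)"
    and "(\<integral>x. indicator {a..} x * x powr e \<partial>lborel) = a powr (e + 1) / (-1 - e)"
proof -
  have "(\<integral>\<^sup>+x. ennreal (x powr e) * indicator {a..} x \<partial>lborel) = 0 - a powr (e + 1) / (e + 1)"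
  proof (rule nn_integral_FTC_atLeast)
    show "DERIV (\<lambda>x. x powr (e + 1) / (e + 1)) x :> x powr e" if "a \<le> x" for x
      using that assms by (auto intro!: derivative_eq_intros)
    have "((\<lambda>x. x powr (e + 1)) \<longlongrightarrow> 0) at_top"
      using assms by (intro tendsto_neg_powr filterlim_ident) auto
    thus "((\<lambda>x. x powr (e + 1) / (e + 1)) \<longlongrightarrow> 0) at_top"
      using tendsto_divide[of _ 0 at_top "\<lambda>_. e + 1" "e + 1"] assms by simp
  qed (use assms in auto)
  also have "(\<integral>\<^sup>+x. ennreal (x powr e) * indicator {a..} x \<partial>lborel) =
      (\<integral>\<^sup>+x. ennreal (indicator {a..} x * x powr e) \<partial>lborel)"
    by (intro nn_integral_cong) (auto simp: indicator_def)
  also have "0 - a powr (e + 1) / (e + 1) = a powr (e + 1) / (-1 - e)"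
    using assms by (simp add: field_simps)
  finally have *: "(\<integral>\<^sup>+x. ennreal (indicator {a..} x * x powr e) \<partial>lborel) = ennreal (a powr (e + 1) / (-1 - e))" .
  have "a powr (e + 1) / (-1 - e) \<ge> 0" using assms by auto
  with * nn_integral_eq_integrable[of "\<lambda>x. indicator {a..} x * x powr e" lborel "a powr (e + 1) / (-1 - e)"]
  show "integrable lborel (\<lambda>x. indicator {a..} x * x powr e)"
    "(\<integral>x. indicator {a..} x * x powr e \<partial>lborel) = a powr (e + 1) / (-1 - e)" by auto
qed

lemma
  assumes "c > 0"
  shows integrable_dkern: "integrable lborel (\<lambda>v. indicator {c..} v *\<^sub>R dkern v)"
    and integral_dkern: "(\<integral>v. indicator {c..} v *\<^sub>R dkern v \<partial>lborel) = - kern c"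
    and integral_norm_dkern_le: "(\<integral>v. norm (indicator {c..} v *\<^sub>R dkern v) \<partial>lborel) \<le> 8 / c"
proof -
  have bnd: "norm (indicator {c..} v *\<^sub>R dkern v) \<le> 8 * (indicator {c..} v * v powr (-2))" for v
    using norm_dkern_le[of v] assms by (auto simp: indicator_def powr_minus powr_numeral divide_inverse)
  show int: "integrable lborel (\<lambda>v. indicator {c..} v *\<^sub>R dkern v)"
  proof (rule Bochner_Integration.integrable_bound)
    show "integrable lborel (\<lambda>v. 8 * (indicator {c..} v * v powr (-2)))"
      using assms by (intro integrable_mult_right integrable_powr_atLeast(1)) auto
    show "AE v in lborel. norm (indicator {c..} v *\<^sub>R dkern v) \<le> norm (8 * (indicator {c..} v * v powr (-2)))"
      using bnd by (intro AE_I2) (metis abs_ge_self order_trans real_norm_def)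
  qed simp
  have "(\<integral>v. norm (indicator {c..} v *\<^sub>R dkern v) \<partial>lborel) \<le> (\<integral>v. 8 * (indicator {c..} v * v powr (-2)) \<partial>lborel)"
    by (intro integral_mono integrable_norm int integrable_mult_right integrable_powr_atLeast(1) assms bnd) auto
  also have "\<dots> = 8 / c"
    using integrable_powr_atLeast(2)[OF assms, of "-2"] assms by (simp add: powr_minus divide_inverse)
  finally show "(\<integral>v. norm (indicator {c..} v *\<^sub>R dkern v) \<partial>lborel) \<le> 8 / c" .
  have "((\<lambda>y. \<integral>v. indicator {..y} v *\<^sub>R (indicator {c..} v *\<^sub>R dkern v) \<partial>lborel) \<longlongrightarrow>
      (\<integral>v. indicator {c..} v *\<^sub>R dkern v \<partial>lborel)) at_top"
    by (rule tendsto_integral_at_top[OF _ int]) simp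
  moreover have "\<forall>\<^sub>F y in at_top. (\<integral>v. indicator {..y} v *\<^sub>R (indicator {c..} v *\<^sub>R dkern v) \<partial>lborel) = kern y - kern c"
    using eventually_ge_at_top[of c]
  proof eventually_elim
    case (elim y)
    have "(\<integral>v. indicator {..y} v *\<^sub>R (indicator {c..} v *\<^sub>R dkern v) \<partial>lborel) =
        (\<integral>v. indicator {c..y} v *\<^sub>R dkern v \<partial>lborel)"
      by (intro Bochner_Integration.integral_cong) (auto simp: indicator_def)
    also have "\<dots> = kern y - kern c"
    proof (rule integral_FTC_Icc)
      show "continuous_on {c..y} dkern"
        unfolding dkern_def using assms by (intro continuous_intros) auto
    qed (use assms elim in \<open>auto intro!: has_vector_derivative_at_within kern_has_vector_derivative\<close>)
    finally show ?case .
  qed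
  ultimately have lim: "((\<lambda>y. kern y - kern c) \<longlongrightarrow> (\<integral>v. indicator {c..} v *\<^sub>R dkern v \<partial>lborel)) at_top"
    by (rule Lim_transform_eventually)
  have "((\<lambda>y. kern y - kern c) \<longlongrightarrow> 0 - kern c) at_top"
    by (intro tendsto_intros kern_tendsto_0)
  with lim have "(\<integral>v. indicator {c..} v *\<^sub>R dkern v \<partial>lborel) = 0 - kern c"
    by (intro tendsto_unique[OF trivial_limit_at_top_linorder])
  thus "(\<integral>v. indicator {c..} v *\<^sub>R dkern v \<partial>lborel) = - kern c" by simp
qed

section \<open>Sums of the kernel against a regularly varying measure\<close>

text \<open>Summability of \<open>a j / j\<close> (a finite mean, in the application) makes the sum of \<open>a j * kern (j / x)\<close>
  converge, because the kernel decays like \<open>1 / u\<close>.\<close>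

locale regularly_varying_sum = regularly_varying W \<beta> for W \<beta> +
  fixes a :: "nat \<Rightarrow> real"
  assumes W_eq: "\<And>k. W k = (\<Sum>j\<le>k. a j)"
    and a_nonneg: "\<And>j. a j \<ge> 0"
    and a_0: "a 0 = 0"
    and summable_a: "summable (\<lambda>j. a j / real j)"
    and \<beta>_nonneg: "0 \<le> \<beta>" and \<beta>_less: "\<beta> < 1"
begin

definition \<kappa> :: complex where
  "\<kappa> = - (\<integral>v. (if v > 0 then v powr \<beta> else 0) *\<^sub>R dkern v \<partial>lborel)"

lemma Wr_eq_0: "v \<le> 0 \<Longrightarrow> Wr v = 0"
  by (simp add: Wr_def W_eq a_0 nat_eq_iff2 le_nat_iff)

lemma Wr_measurable [measurable]: "Wr \<in> borel_measurable borel"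
  by (rule borel_measurable_mono) (auto simp: mono_def Wr_mono)

text \<open>Summation by parts: each kernel value is minus the integral of \<open>dkern\<close> over a tail, and exchanging sum and
  integral collects the \<open>a j\<close> with \<open>j \<le> v * x\<close>.\<close>

lemma sums_a_kern:
  assumes x: "x > 0"
  shows "(\<lambda>j. a j *\<^sub>R kern (j / x)) sums - (\<integral>v. Wr (v * x) *\<^sub>R dkern v \<partial>lborel)"
proof -
  define f where "f = (\<lambda>j::nat. \<lambda>v::real. a j *\<^sub>R (indicator {j / x..} v *\<^sub>R dkern v))"
  have pos: "real j / x > 0" if "j \<noteq> 0" for j :: nat using that x by simp
  have int: "integrable lborel (f j)" for j
  proof (cases "j = 0")
    case False
    thus ?thesis unfolding f_def by (intro integrable_scaleR_right integrable_dkern pos)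
  qed (simp add: f_def a_0)
  have fsum: "(\<lambda>j. f j v) sums (Wr (v * x) *\<^sub>R dkern v)" and fsum': "summable (\<lambda>j. norm (f j v))" for v
  proof -
    have z: "f j v = 0" if "j \<notin> {..nat \<lfloor>v * x\<rfloor>}" for j
    proof -
      have "v * x < j" using that by (simp add: not_le) linarith
      hence "\<not> j / x \<le> v" using x by (simp add: field_simps)
      thus ?thesis by (simp add: f_def)
    qed
    have e: "f j v = a j *\<^sub>R dkern v" if j: "j \<in> {..nat \<lfloor>v * x\<rfloor>}" for j
    proof (cases "j = 0")
      case False
      hence "real j \<le> v * x" using j by (simp add: le_nat_iff) linarith
      hence "j / x \<le> v" using x by (simp add: field_simps)
      thus ?thesis by (simp add: f_def)
    qed (simp add: f_def a_0)
    have "(\<Sum>j\<le>nat \<lfloor>v * x\<rfloor>. f j v) = Wr (v * x) *\<^sub>R dkern v"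
      by (simp add: e Wr_def W_eq scaleR_sum_left)
    thus "(\<lambda>j. f j v) sums (Wr (v * x) *\<^sub>R dkern v)"
      using sums_finite[of "{..nat \<lfloor>v * x\<rfloor>}" "\<lambda>j. f j v"] z by auto
    show "summable (\<lambda>j. norm (f j v))"
      by (rule summable_finite[of "{..nat \<lfloor>v * x\<rfloor>}"]) (use z in auto)
  qed
  have "summable (\<lambda>j. \<integral>v. norm (f j v) \<partial>lborel)"
  proof (rule summable_comparison_test')
    show "summable (\<lambda>j. 8 * x * (a j / real j))" by (intro summable_mult summable_a)
    fix j :: nat assume "j \<ge> 0"
    show "norm (\<integral>v. norm (f j v) \<partial>lborel) \<le> 8 * x * (a j / real j)"
    proof (cases "j = 0")
      case False
      have "(\<integral>v. norm (f j v) \<partial>lborel) = a j * (\<integral>v. norm (indicator {j / x..} v *\<^sub>R dkern v) \<partial>lborel)"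
        unfolding f_def using a_nonneg[of j] by (simp add: mult.assoc)
      also have "\<dots> \<le> a j * (8 / (j / x))"
        by (intro mult_left_mono integral_norm_dkern_le pos False a_nonneg)
      finally show ?thesis using x by (simp add: mult_ac)
    qed (simp add: f_def a_0)
  qed
  from sums_integral[OF int AE_I2[OF fsum'] this]
  have "(\<lambda>j. integral\<^sup>L lborel (f j)) sums (\<integral>v. (\<Sum>j. f j v) \<partial>lborel)" .
  also have "(\<lambda>v. \<Sum>j. f j v) = (\<lambda>v. Wr (v * x) *\<^sub>R dkern v)"
    using fsum by (auto simp: sums_iff)
  also have "(\<lambda>j. integral\<^sup>L lborel (f j)) = (\<lambda>j. - (a j *\<^sub>R kern (j / x)))"
  proof
    fix j show "integral\<^sup>L lborel (f j) = - (a j *\<^sub>R kern (j / x))"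
      by (cases "j = 0") (use integral_dkern[OF pos, of j] in \<open>auto simp: f_def a_0 simp del: scaleR_scaleR\<close>)
  qed
  finally show ?thesis using sums_minus by fastforce
qed

lemma dominating_integrable:
  assumes "\<gamma> < 1"
  shows "integrable lborel (\<lambda>v::real. indicator {0..1} v + 16 * (indicator {1..} v * v powr (\<gamma> - 2)))"
  by (intro Bochner_Integration.integrable_add integrable_mult_right integrable_powr_atLeast(1)) (use assms in auto)

text \<open>The ratio \<open>Wr (v * x) / Wr x\<close> under the integral tends to \<open>v powr \<beta>\<close>, and the Potter bound with
  an exponent strictly between \<open>\<beta>\<close> and 1 dominates it.\<close>

lemma sum_a_kern_asymptotics:
  "((\<lambda>x. (\<Sum>j. a j *\<^sub>R kern (j / x)) /\<^sub>R Wr x) \<longlongrightarrow> \<kappa>) at_top"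
proof -
  \<comment> \<open>The derivative of the kernel decays like \<open>v powr (-2)\<close>, so a majorant of index
    \<open>\<gamma>\<close> is integrable as long as \<open>\<gamma> < 1\<close>; the midpoint leaves room on
    both sides.\<close>
  define \<gamma> where "\<gamma> = (1 + \<beta>) / 2"
  have \<gamma>: "\<beta> < \<gamma>" "0 \<le> \<gamma>" "\<gamma> < 1" using \<beta>_nonneg \<beta>_less by (auto simp: \<gamma>_def)
  obtain x0 where x0: "x0 > 0" "\<And>x. x \<ge> x0 \<Longrightarrow> Wr x > 0"
    "\<And>x s. x \<ge> x0 \<Longrightarrow> s \<ge> 1 \<Longrightarrow> Wr (s * x) \<le> 2 powr \<gamma> * s powr \<gamma> * Wr x"
    using Potter_bound[OF \<gamma>(1,2)] by blast
  define w where "w = (\<lambda>v::real. indicator {0..1} v + 16 * (indicator {1..} v * v powr (\<gamma> - 2)) :: real)"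
  have bound: "norm ((Wr (v * x) / Wr x) *\<^sub>R dkern v) \<le> w v" if x: "x \<ge> x0" for x v
  proof -
    note Wx = x0(2)[OF x]
    consider "v \<le> 0" | "0 < v" "v \<le> 1" | "1 < v" by linarith
    thus ?thesis
    proof cases
      case 1
      hence "Wr (v * x) = 0" using x x0(1) by (intro Wr_eq_0) (simp add: mult_le_0_iff)
      thus ?thesis by (simp add: w_def)
    next
      case 2
      have "v * x \<le> 1 * x" using 2 x x0(1) by (intro mult_right_mono) auto
      hence "Wr (v * x) / Wr x \<le> 1" using Wx by (simp add: Wr_mono)
      hence "(Wr (v * x) / Wr x) * norm (dkern v) \<le> 1 * 1"
        using norm_dkern_le_1[of v] 2 by (intro mult_mono) auto
      thus ?thesis using 2 Wx Wr_nonneg[of "v * x"] norm_dkern_le_1[of v]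
        by (auto simp: w_def indicator_def)
    next
      case 3
      have "Wr (v * x) / Wr x \<le> 2 powr \<gamma> * v powr \<gamma>"
        using x0(3)[OF x, of v] 3 Wx by (simp add: field_simps)
      also have "\<dots> \<le> 2 powr 1 * v powr \<gamma>"
        using \<gamma> by (intro mult_right_mono powr_mono) auto
      finally have "(Wr (v * x) / Wr x) * norm (dkern v) \<le> (2 * v powr \<gamma>) * (8 / v ^ 2)"
        using norm_dkern_le[of v] 3 by (intro mult_mono) auto
      also have "\<dots> = 16 * v powr (\<gamma> - 2)"
        using 3 by (simp add: powr_diff powr_numeral)
      finally show ?thesis using 3 Wx Wr_nonneg[of "v * x"] by (simp add: w_def indicator_def)
    qed
  qed
  have "((\<lambda>x. \<integral>v. (Wr (v * x) / Wr x) *\<^sub>R dkern v \<partial>lborel) \<longlongrightarrow>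
      (\<integral>v. (if v > 0 then v powr \<beta> else 0) *\<^sub>R dkern v \<partial>lborel)) at_top"
  proof (rule integral_dominated_convergence_at_top)
    show "integrable lborel w" unfolding w_def by (rule dominating_integrable[OF \<gamma>(3)])
    show "AE v in lborel. ((\<lambda>x. (Wr (v * x) / Wr x) *\<^sub>R dkern v) \<longlongrightarrow> (if v > 0 then v powr \<beta> else 0) *\<^sub>R dkern v) at_top"
    proof (intro AE_I2)
      fix v :: real
      have "((\<lambda>x. Wr (v * x) / Wr x) \<longlongrightarrow> (if v > 0 then v powr \<beta> else 0)) at_top"
      proof (cases "v > 0")
        case True thus ?thesis using Wr_ratio[of v] by simp
      next
        case False
        have "\<forall>\<^sub>F x in at_top. Wr (v * x) / Wr x = 0"
          using eventually_ge_at_top[of 0]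
          by eventually_elim (use False in \<open>auto intro!: Wr_eq_0 simp: mult_le_0_iff\<close>)
        thus ?thesis using False by (simp add: tendsto_eventually)
      qed
      thus "((\<lambda>x. (Wr (v * x) / Wr x) *\<^sub>R dkern v) \<longlongrightarrow> (if v > 0 then v powr \<beta> else 0) *\<^sub>R dkern v) at_top"
        by (intro tendsto_scaleR tendsto_const)
    qed
    show "\<forall>\<^sub>F x in at_top. AE v in lborel. norm ((Wr (v * x) / Wr x) *\<^sub>R dkern v) \<le> w v"
      using eventually_ge_at_top[of x0] by eventually_elim (use bound in auto)
  qed measurable
  hence "((\<lambda>x. - (\<integral>v. (Wr (v * x) / Wr x) *\<^sub>R dkern v \<partial>lborel)) \<longlongrightarrow> \<kappa>) at_top"
    unfolding \<kappa>_def by (rule tendsto_minus)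
  moreover have "\<forall>\<^sub>F x in at_top. - (\<integral>v. (Wr (v * x) / Wr x) *\<^sub>R dkern v \<partial>lborel) =
      (\<Sum>j. a j *\<^sub>R kern (j / x)) /\<^sub>R Wr x"
    using eventually_gt_at_top[of 0]
  proof eventually_elim
    case (elim x)
    have "(\<lambda>v. (Wr (v * x) / Wr x) *\<^sub>R dkern v) = (\<lambda>v. inverse (Wr x) *\<^sub>R (Wr (v * x) *\<^sub>R dkern v))"
      by (simp add: divide_inverse mult.commute)
    hence "- (\<integral>v. (Wr (v * x) / Wr x) *\<^sub>R dkern v \<partial>lborel) = inverse (Wr x) *\<^sub>R (- (\<integral>v. Wr (v * x) *\<^sub>R dkern v \<partial>lborel))"
      by (simp only: integral_scaleR_right scaleR_minus_right)
    thus ?case using sums_a_kern[OF elim] by (simp add: sums_iff)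
  qed
  ultimately show ?thesis by (rule Lim_transform_eventually)
qed

text \<open>The real part of the kernel is nonnegative, and at least
  \<open>1 / 3\<close> on the part of the sum that makes up \<open>Wr x\<close>.\<close>

lemma Re_\<kappa>: "Re \<kappa> \<ge> 1 / 3"
proof (rule tendsto_lowerbound)
  show "((\<lambda>x. Re ((\<Sum>j. a j *\<^sub>R kern (j / x)) /\<^sub>R Wr x)) \<longlongrightarrow> Re \<kappa>) at_top"
    by (intro tendsto_Re sum_a_kern_asymptotics)
  show "\<forall>\<^sub>F x in at_top. 1 / 3 \<le> Re ((\<Sum>j. a j *\<^sub>R kern (j / x)) /\<^sub>R Wr x)"
    using eventually_gt_at_top[of 0] Wr_pos
  proof eventually_elim
    case (elim x)
    have *: "(\<lambda>j. a j * Re (kern (j / x))) sums Re (\<Sum>j. a j *\<^sub>R kern (j / x))"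
      using sums_Re[OF summable_sums[OF sums_summable[OF sums_a_kern[OF elim(1)]]]] by simp
    have "(1 / 3) * Wr x = (\<Sum>j\<le>nat \<lfloor>x\<rfloor>. a j * (1 / 3))"
      by (simp add: Wr_def W_eq sum_distrib_left mult.commute sum_divide_distrib)
    also have "\<dots> \<le> (\<Sum>j\<le>nat \<lfloor>x\<rfloor>. a j * Re (kern (j / x)))"
    proof (intro sum_mono)
      fix j assume j: "j \<in> {..nat \<lfloor>x\<rfloor>}"
      show "a j * (1 / 3) \<le> a j * Re (kern (j / x))"
      proof (cases "j = 0")
        case False
        have "real j \<le> x" using j elim by (simp add: le_nat_iff) linarith
        hence "Re (kern (j / x)) \<ge> 1 / 3" using elim False by (intro Re_kern_ge) auto
        thus ?thesis by (intro mult_left_mono a_nonneg)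
      qed (simp add: a_0)
    qed
    also have "\<dots> \<le> Re (\<Sum>j. a j *\<^sub>R kern (j / x))"
      using sum_le_suminf[OF sums_summable[OF *], of "{..nat \<lfloor>x\<rfloor>}"] *
      by (simp add: sums_iff a_nonneg Re_kern_nonneg)
    finally show ?case using elim by (simp add: field_simps)
  qed
qed auto

end

section \<open>The density at 0 of a spectrally positive stable law\<close>

lemma integral_powr_substitution:
  fixes f :: "real \<Rightarrow> complex"
  assumes \<alpha>: "\<alpha> > 0" and f [measurable]: "f \<in> borel_measurable borel"
    and int: "integrable lborel (\<lambda>s. indicator {0<..} s *\<^sub>R f s)"
  shows "(\<integral>s. indicator {0<..} s *\<^sub>R f s \<partial>lborel) =
    (\<integral>x. indicator {0<..} x *\<^sub>R ((1 / \<alpha>) * x powr (1 / \<alpha> - 1)) *\<^sub>R f (x powr (1 / \<alpha>)) \<partial>lborel)"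
proof -
  define g where "g = (\<lambda>x::real. x powr (1 / \<alpha>))"
  define g' where "g' = (\<lambda>x::real. (1 / \<alpha>) * x powr (1 / \<alpha> - 1))"
  have img: "g ` {0<..} = {0<..}"
  proof (intro equalityI subsetI)
    fix s :: real assume "s \<in> {0<..}"
    hence "s = g (s powr \<alpha>)" "s powr \<alpha> \<in> {0<..}" using \<alpha> by (auto simp: g_def powr_powr)
    thus "s \<in> g ` {0<..}" by blast
  qed (auto simp: g_def)
  have inj: "inj_on g {0<..}"
    using \<alpha> by (intro inj_on_inverseI[where g = "\<lambda>s. s powr \<alpha>"]) (auto simp: g_def powr_powr)
  have der: "(g has_field_derivative g' x) (at x within {0<..})" if "x \<in> {0<..}" for x
    using that \<alpha> unfolding g_def g'_def
    by (auto intro!: derivative_eq_intros)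
  have ai: "f absolutely_integrable_on {0<..}"
    using int unfolding set_integrable_def by (subst integrable_completion) auto
  define b where "b = integral {0<..} f"
  have "f absolutely_integrable_on (g ` {0<..}) \<and> integral (g ` {0<..}) f = b"
    using ai img by (simp add: b_def)
  hence *: "(\<lambda>x. \<bar>g' x\<bar> *\<^sub>R f (g x)) absolutely_integrable_on {0<..} \<and>
     integral {0<..} (\<lambda>x. \<bar>g' x\<bar> *\<^sub>R f (g x)) = b"
    by (subst has_absolute_integral_change_of_variables_real[OF _ der inj]) auto
  have "b = set_lebesgue_integral lebesgue {0<..} f"
    unfolding b_def by (rule set_lebesgue_integral_eq_integral(2)[OF ai, symmetric])
  also have "\<dots> = (\<integral>s. indicator {0<..} s *\<^sub>R f s \<partial>lborel)"
    unfolding set_lebesgue_integral_def by (subst integral_completion) auto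
  finally have 1: "b = (\<integral>s. indicator {0<..} s *\<^sub>R f s \<partial>lborel)" .
  have "b = set_lebesgue_integral lebesgue {0<..} (\<lambda>x. \<bar>g' x\<bar> *\<^sub>R f (g x))"
    using * set_lebesgue_integral_eq_integral(2) by metis
  also have "\<dots> = (\<integral>x. indicator {0<..} x *\<^sub>R \<bar>g' x\<bar> *\<^sub>R f (g x) \<partial>lborel)"
    unfolding set_lebesgue_integral_def g_def g'_def by (subst integral_completion) auto
  also have "\<dots> = (\<integral>x. indicator {0<..} x *\<^sub>R g' x *\<^sub>R f (g x) \<partial>lborel)"
    using \<alpha> by (intro Bochner_Integration.integral_cong) (auto simp: g'_def indicator_def)
  finally show ?thesis using 1 by (simp add: g_def g'_def)
qed

lemma
  assumes z: "Re z > 0"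
  shows integrable_exp_complex: "integrable lborel (\<lambda>x. indicator {0<..} x *\<^sub>R exp (- z * complex_of_real x))"
    and integral_exp_complex: "(\<integral>x. indicator {0<..} x *\<^sub>R exp (- z * complex_of_real x) \<partial>lborel) = 1 / z"
proof -
  define a where "a = Re z"
  have a: "a > 0" using z by (simp add: a_def)
  have z0: "z \<noteq> 0" using z by auto
  have "(\<integral>\<^sup>+x. ennreal (exp (- a * x)) * indicator {0..} x \<partial>lborel) = 0 - (- exp (- a * 0) / a)"
  proof (rule nn_integral_FTC_atLeast)
    show "((\<lambda>x. - exp (- a * x) / a) \<longlongrightarrow> 0) at_top" using a by real_asymp
  qed (use a in \<open>auto intro!: derivative_eq_intros\<close>)
  also have "(\<integral>\<^sup>+x. ennreal (exp (- a * x)) * indicator {0..} x \<partial>lborel) =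
      (\<integral>\<^sup>+x. ennreal (indicator {0..} x * exp (- a * x)) \<partial>lborel)"
    by (intro nn_integral_cong) (auto simp: indicator_def)
  finally have "integrable lborel (\<lambda>x. indicator {0..} x * exp (- a * x))"
    by (intro integrableI_nn_integral_finite[where x = "1 / a"]) (use a in auto)
  hence int0: "integrable lborel (\<lambda>x. indicator {0..} x *\<^sub>R exp (- z * complex_of_real x))"
  proof (rule Bochner_Integration.integrable_bound)
    show "AE x in lborel. norm (indicator {0..} x *\<^sub>R exp (- z * complex_of_real x)) \<le> norm (indicator {0..} x * exp (- a * x))"
      by (intro AE_I2) (simp add: a_def)
  qed measurable
  have ae: "(\<integral>x. indicator {0<..} x *\<^sub>R exp (- z * complex_of_real x) \<partial>lborel) =
      (\<integral>x. indicator {0..} x *\<^sub>R exp (- z * complex_of_real x) \<partial>lborel)"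
  proof (rule integral_cong_AE)
    show "AE x in lborel. indicator {0<..} x *\<^sub>R exp (- z * complex_of_real x) =
        indicator {0..} x *\<^sub>R exp (- z * complex_of_real x)"
      using AE_lborel_singleton[of "0::real"] by eventually_elim (auto simp: indicator_def)
  qed measurable
  show "integrable lborel (\<lambda>x. indicator {0<..} x *\<^sub>R exp (- z * complex_of_real x))"
  proof (rule Bochner_Integration.integrable_bound[OF int0])
    show "AE x in lborel. norm (indicator {0<..} x *\<^sub>R exp (- z * complex_of_real x)) \<le>
        norm (indicator {0..} x *\<^sub>R exp (- z * complex_of_real x))"
      by (intro AE_I2) (simp add: indicator_def)
  qed measurable
  have lim1: "((\<lambda>y. \<integral>x. indicator {..y} x *\<^sub>R (indicator {0..} x *\<^sub>R exp (- z * complex_of_real x)) \<partial>lborel) \<longlongrightarrow>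
      (\<integral>x. indicator {0..} x *\<^sub>R exp (- z * complex_of_real x) \<partial>lborel)) at_top"
    by (rule tendsto_integral_at_top[OF _ int0]) simp
  have ev: "\<forall>\<^sub>F y in at_top. (\<integral>x. indicator {..y} x *\<^sub>R (indicator {0..} x *\<^sub>R exp (- z * complex_of_real x)) \<partial>lborel) =
      1 / z - exp (- z * complex_of_real y) / z"
    using eventually_ge_at_top[of 0]
  proof eventually_elim
    case (elim y)
    have "(\<integral>x. indicator {..y} x *\<^sub>R (indicator {0..} x *\<^sub>R exp (- z * complex_of_real x)) \<partial>lborel) =
        (\<integral>x. indicator {0..y} x *\<^sub>R exp (- z * complex_of_real x) \<partial>lborel)"
      by (intro Bochner_Integration.integral_cong) (auto simp: indicator_def)
    also have "\<dots> = - exp (- z * complex_of_real y) / z - (- exp (- z * complex_of_real 0) / z)"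
    proof (rule integral_FTC_Icc)
      fix x assume "0 \<le> x" "x \<le> y"
      have "((\<lambda>w. - exp (- z * w) / z) has_field_derivative exp (- z * x)) (at (complex_of_real x))"
        using z0 by (auto intro!: derivative_eq_intros)
      from has_vector_derivative_real_field[OF this]
      show "((\<lambda>x. - exp (- z * complex_of_real x) / z) has_vector_derivative exp (- z * complex_of_real x)) (at x within {0..y})"
        by (rule has_vector_derivative_at_within)
    qed (use elim in \<open>auto intro!: continuous_intros\<close>)
    finally show ?case by simp
  qed
  have lim2: "((\<lambda>y. 1 / z - exp (- z * complex_of_real y) / z) \<longlongrightarrow> 1 / z - 0 / z) at_top"
  proof (intro tendsto_intros z0)
    show "((\<lambda>y. exp (- z * complex_of_real y)) \<longlongrightarrow> 0) at_top"
    proof (rule tendsto_norm_zero_cancel)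
      have "((\<lambda>y. exp (- a * y)) \<longlongrightarrow> 0) at_top" using a by real_asymp
      thus "((\<lambda>y. norm (exp (- z * complex_of_real y))) \<longlongrightarrow> 0) at_top" by (simp add: a_def)
    qed
  qed
  have "(\<integral>x. indicator {0..} x *\<^sub>R exp (- z * complex_of_real x) \<partial>lborel) = 1 / z - 0 / z"
    by (rule tendsto_unique[OF trivial_limit_at_top_linorder Lim_transform_eventually[OF lim1 ev] lim2])
  thus "(\<integral>x. indicator {0<..} x *\<^sub>R exp (- z * complex_of_real x) \<partial>lborel) = 1 / z" using ae by simp
qed

lemma
  assumes \<gamma>: "\<gamma> > 0" and x: "x > (0::real)"
  shows integrable_Gamma_scaled: "integrable lborel (\<lambda>y. indicator {0<..} y * (y powr (\<gamma> - 1) * exp (- x * y)))"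
    and integral_Gamma_scaled: "(\<integral>y. indicator {0<..} y * (y powr (\<gamma> - 1) * exp (- x * y)) \<partial>lborel) = Gamma \<gamma> * x powr (- \<gamma>)"
proof -
  have "(\<integral>\<^sup>+t. ennreal (indicator {0..} t * t powr (\<gamma> - 1) / exp t) \<partial>lborel) =
        (\<integral>\<^sup>+t. ennreal (indicator {0<..} t * (t powr (\<gamma> - 1) * exp (- t))) \<partial>lborel)"
    by (intro nn_integral_cong) (auto simp: indicator_def exp_minus divide_inverse)
  hence "(\<integral>\<^sup>+t. ennreal (indicator {0<..} t * (t powr (\<gamma> - 1) * exp (- t))) \<partial>lborel) = ennreal (Gamma \<gamma>)"
    using Gamma_conv_nn_integral_real[OF \<gamma>] by simp
  moreover have "Gamma \<gamma> \<ge> 0" using Gamma_real_pos[OF \<gamma>] by simp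
  ultimately have "has_bochner_integral lborel (\<lambda>t. indicator {0<..} t * (t powr (\<gamma> - 1) * exp (- t))) (Gamma \<gamma>)"
    using nn_integral_eq_integrable[of "\<lambda>t. indicator {0<..} t * (t powr (\<gamma> - 1) * exp (- t))" lborel "Gamma \<gamma>"]
    by (auto simp: has_bochner_integral_iff)
  hence "has_bochner_integral lborel (\<lambda>y. indicator {0<..} (0 + x * y) * ((0 + x * y) powr (\<gamma> - 1) * exp (- (0 + x * y)))) (Gamma \<gamma> /\<^sub>R \<bar>x\<bar>)"
    using x by (subst (asm) lborel_has_bochner_integral_real_affine_iff[of x _ _ 0]) auto
  hence "has_bochner_integral lborel (\<lambda>y. x powr (1 - \<gamma>) * (indicator {0<..} (0 + x * y) * ((0 + x * y) powr (\<gamma> - 1) * exp (- (0 + x * y)))))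
      (x powr (1 - \<gamma>) * (Gamma \<gamma> /\<^sub>R \<bar>x\<bar>))"
    by (rule has_bochner_integral_mult_right)
  also have "(\<lambda>y. x powr (1 - \<gamma>) * (indicator {0<..} (0 + x * y) * ((0 + x * y) powr (\<gamma> - 1) * exp (- (0 + x * y))))) =
      (\<lambda>y. indicator {0<..} y * (y powr (\<gamma> - 1) * exp (- x * y)))"
  proof
    fix y
    have "x powr (1 - \<gamma>) * x powr (\<gamma> - 1) = 1" using x by (simp add: powr_add[symmetric])
    thus "x powr (1 - \<gamma>) * (indicator {0<..} (0 + x * y) * ((0 + x * y) powr (\<gamma> - 1) * exp (- (0 + x * y)))) =
      indicator {0<..} y * (y powr (\<gamma> - 1) * exp (- x * y))"
      using x by (auto simp: indicator_def powr_mult zero_less_mult_iff mult.assoc[symmetric])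
  qed
  also have "x powr (1 - \<gamma>) * (Gamma \<gamma> /\<^sub>R \<bar>x\<bar>) = Gamma \<gamma> * x powr (- \<gamma>)"
    using x by (simp add: powr_diff powr_minus field_simps)
  finally show "integrable lborel (\<lambda>y. indicator {0<..} y * (y powr (\<gamma> - 1) * exp (- x * y)))"
    "(\<integral>y. indicator {0<..} y * (y powr (\<gamma> - 1) * exp (- x * y)) \<partial>lborel) = Gamma \<gamma> * x powr (- \<gamma>)"
    by (auto simp: has_bochner_integral_iff)
qed

text \<open>The function \<open>x powr - \<gamma>\<close> is a mixture of the exponentials \<open>exp (- x * y)\<close> with positive weights. For each
  of them the integral is \<open>1 / (\<kappa> + y)\<close>, which has positive real part.\<close>

lemma Laplace_powr_pos:
  assumes \<gamma>: "0 < \<gamma>" "\<gamma> < 1" and \<kappa>: "Re \<kappa> = 1"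
  shows "Re (\<integral>x. indicator {0<..} x *\<^sub>R (x powr (- \<gamma>)) *\<^sub>R exp (- \<kappa> * complex_of_real x) \<partial>lborel) > 0"
proof -
  define f where "f = (\<lambda>x y::real. (indicator {0<..} x * indicator {0<..} y * y powr (\<gamma> - 1)) *\<^sub>R
      exp (- (\<kappa> + complex_of_real y) * complex_of_real x))"
  have f_y: "f x y = (indicator {0<..} x *\<^sub>R exp (- \<kappa> * complex_of_real x)) *
      complex_of_real (indicator {0<..} y * (y powr (\<gamma> - 1) * exp (- x * y)))" for x y
    by (simp add: f_def scaleR_conv_of_real exp_add[symmetric] algebra_simps exp_of_real[symmetric])
  have f_x: "f x y = (indicator {0<..} y * y powr (\<gamma> - 1)) *\<^sub>R 
      (indicator {0<..} x *\<^sub>R exp (- (\<kappa> + complex_of_real y) * complex_of_real x))" for x y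
    by (simp add: f_def mult_ac)
  have norm_f: "norm (f x y) = (indicator {0<..} x * exp (- x)) * (indicator {0<..} y * (y powr (\<gamma> - 1) * exp (- x * y)))" for x y
    unfolding f_y norm_mult norm_scaleR norm_of_real by (simp add: \<kappa>)
  have int: "integrable (lborel \<Otimes>\<^sub>M lborel) (case_prod f)"
  proof (rule lborel_pair.Fubini_integrable)
    show "case_prod f \<in> borel_measurable (lborel \<Otimes>\<^sub>M lborel)" unfolding f_def by measurable
    have "(\<lambda>x. \<integral>y. norm (case_prod f (x, y)) \<partial>lborel) =
        (\<lambda>x. Gamma \<gamma> * (indicator {0<..} x * (x powr ((1 - \<gamma>) - 1) * exp (- 1 * x))))"
    proof
      fix x show "(\<integral>y. norm (case_prod f (x, y)) \<partial>lborel) = Gamma \<gamma> * (indicator {0<..} x * (x powr ((1 - \<gamma>) - 1) * exp (- 1 * x)))"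
        using integral_Gamma_scaled[OF \<gamma>(1), of x] by (cases "x > 0") (auto simp: norm_f)
    qed
    thus "integrable lborel (\<lambda>x. \<integral>y. norm (case_prod f (x, y)) \<partial>lborel)"
      using integrable_Gamma_scaled[of "1 - \<gamma>" 1] \<gamma> by (auto intro!: integrable_mult_right)
    have "integrable lborel (f x)" for x
    proof (cases "x > 0")
      case True
      have "integrable lborel (\<lambda>y. complex_of_real (indicator {0<..} y * (y powr (\<gamma> - 1) * exp (- x * y))))"
        by (intro integrable_of_real integrable_Gamma_scaled \<gamma> True)
      thus ?thesis unfolding f_y[abs_def] by (rule integrable_mult_right)
    qed (simp add: f_def)
    thus "AE x in lborel. integrable lborel (\<lambda>y. case_prod f (x, y))" by simp
  qed
  have swap: "(\<integral>y. \<integral>x. f x y \<partial>lborel \<partial>lborel) = (\<integral>x. \<integral>y. f x y \<partial>lborel \<partial>lborel)"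
    by (rule lborel_pair.Fubini_integral[OF int])
  have "(\<lambda>x. \<integral>y. f x y \<partial>lborel) = (\<lambda>x. Gamma \<gamma> *\<^sub>R (indicator {0<..} x *\<^sub>R (x powr (- \<gamma>)) *\<^sub>R exp (- \<kappa> * complex_of_real x)))"
  proof
    fix x show "(\<integral>y. f x y \<partial>lborel) = Gamma \<gamma> *\<^sub>R (indicator {0<..} x *\<^sub>R (x powr (- \<gamma>)) *\<^sub>R exp (- \<kappa> * complex_of_real x))"
    proof (cases "x > 0")
      case True
      have "(\<integral>y. f x y \<partial>lborel) = (indicator {0<..} x *\<^sub>R exp (- \<kappa> * complex_of_real x)) *
         complex_of_real (\<integral>y. indicator {0<..} y * (y powr (\<gamma> - 1) * exp (- x * y)) \<partial>lborel)"
        unfolding f_y[abs_def] by (subst integral_mult_right_zero, subst integral_complex_of_real) simp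
      thus ?thesis unfolding integral_Gamma_scaled[OF \<gamma>(1) True] using True by (simp add: scaleR_conv_of_real mult_ac)
    qed (simp add: f_def)
  qed
  hence rhs: "(\<integral>x. \<integral>y. f x y \<partial>lborel \<partial>lborel) = Gamma \<gamma> *\<^sub>R
      (\<integral>x. indicator {0<..} x *\<^sub>R (x powr (- \<gamma>)) *\<^sub>R exp (- \<kappa> * complex_of_real x) \<partial>lborel)"
    by (simp only: integral_scaleR_right)
  define G where "G = (\<lambda>y. \<integral>x. f x y \<partial>lborel)"
  have G: "G y = (indicator {0<..} y * y powr (\<gamma> - 1)) *\<^sub>R (1 / (\<kappa> + complex_of_real y))" for y
  proof (cases "y > 0")
    case True
    thus ?thesis unfolding G_def f_x integral_scaleR_right
      by (subst integral_exp_complex) (auto simp: \<kappa>)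
  qed (simp add: G_def f_def)
  have Gint: "integrable lborel G"
    unfolding G_def using lborel_pair.integrable_snd[OF int] by simp
  have ReG: "Re (G y) = indicator {0<..} y * (y powr (\<gamma> - 1) * ((1 + y) / (norm (\<kappa> + complex_of_real y))\<^sup>2))" for y
    unfolding G by (simp add: Re_divide \<kappa> cmod_power2)
  have ReG0: "Re (G y) \<ge> 0" for y unfolding ReG by (auto simp: indicator_def)
  have pos: "(\<integral>y. Re (G y) \<partial>lborel) > 0"
  proof (rule ccontr)
    assume "\<not> ?thesis"
    moreover have "(\<integral>y. Re (G y) \<partial>lborel) \<ge> 0" by (intro integral_nonneg_AE) (simp add: ReG0)
    ultimately have "(\<integral>y. Re (G y) \<partial>lborel) = 0" by simp
    hence "AE y in lborel. Re (G y) = 0"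
      using ReG0 Gint by (subst (asm) integral_nonneg_eq_0_iff_AE) auto
    hence "AE y in lborel. y \<notin> {0<..<1::real}"
    proof (rule AE_mp, intro AE_I2 impI)
      fix y assume "Re (G y) = 0"
      show "y \<notin> {0<..<1::real}"
      proof
        assume y: "y \<in> {0<..<1::real}"
        hence "\<kappa> + complex_of_real y \<noteq> 0" using \<kappa> by (auto simp: complex_eq_iff)
        hence "Re (G y) > 0" using y unfolding ReG by simp
        thus False using \<open>Re (G y) = 0\<close> by simp
      qed
    qed
    hence "emeasure lborel {0<..<1::real} = 0"
      by (subst (asm) AE_iff_measurable[where N = "{0<..<1::real}"]) auto
    thus False by simp
  qed
  have "(\<integral>y. Re (G y) \<partial>lborel) = Re (\<integral>y. G y \<partial>lborel)" using Gint by simp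
  also have "(\<integral>y. G y \<partial>lborel) = Gamma \<gamma> *\<^sub>R
      (\<integral>x. indicator {0<..} x *\<^sub>R (x powr (- \<gamma>)) *\<^sub>R exp (- \<kappa> * complex_of_real x) \<partial>lborel)"
    using swap rhs by (simp add: G_def)
  finally show ?thesis using pos Gamma_real_pos[OF \<gamma>(1)] by (simp add: zero_less_mult_iff)
qed

lemma integrable_exp_powr:
  assumes \<alpha>: "\<alpha> > 1" and \<kappa>: "Re \<kappa> = 1"
  shows "integrable lborel (\<lambda>s. indicator {0<..} s *\<^sub>R exp (- \<kappa> * complex_of_real (s powr \<alpha>)))"
proof (rule Bochner_Integration.integrable_bound)
  show "integrable lborel (\<lambda>s::real. indicator {0..1} s + 2 * (indicator {1..} s * s powr (-2)))"
    by (intro Bochner_Integration.integrable_add integrable_mult_right integrable_powr_atLeast(1)) auto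
  have "norm (indicator {0<..} s *\<^sub>R exp (- \<kappa> * complex_of_real (s powr \<alpha>))) \<le>
      norm (indicator {0..1} s + 2 * (indicator {1..} s * s powr (-2)))" for s :: real
  proof -
    have n: "norm (exp (- \<kappa> * complex_of_real (s powr \<alpha>))) = exp (- (s powr \<alpha>))" using \<kappa> by simp
    consider "s \<le> 0" | "0 < s" "s < 1" | "s \<ge> 1" by linarith
    thus ?thesis
    proof cases
      case 3
      have "s = s powr 1" using 3 by simp
      also have "\<dots> \<le> s powr \<alpha>" using 3 \<alpha> by (intro powr_mono) auto
      finally have "exp (- (s powr \<alpha>)) \<le> exp (- s)" by simp
      also have "\<dots> \<le> 2 * s powr (-2)"
      proof -
        have "s\<^sup>2 / 2 \<le> exp s" using exp_lower_Taylor_quadratic[of s] 3 by simp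
        thus ?thesis using 3 by (simp add: exp_minus powr_minus field_simps powr_numeral)
      qed
      finally show ?thesis using 3 unfolding norm_scaleR n by (auto simp: indicator_def)
    qed (auto simp: indicator_def \<kappa>)
  qed
  thus "AE s in lborel. norm (indicator {0<..} s *\<^sub>R exp (- \<kappa> * complex_of_real (s powr \<alpha>))) \<le>
      norm (indicator {0..1} s + 2 * (indicator {1..} s * s powr (-2)))" by simp
qed measurable

text \<open>Up to a positive factor this is the density at 0 of a spectrally positive stable law of index \<open>\<alpha>\<close>. The
  substitution \<open>x = s powr \<alpha>\<close> reduces it to \<open>Laplace_powr_pos\<close>.\<close>

lemma stable_density_pos:
  assumes \<alpha>: "\<alpha> > 1" and \<kappa>: "Re \<kappa> = 1"
  shows "Re (\<integral>s. indicator {0<..} s *\<^sub>R exp (- \<kappa> * complex_of_real (s powr \<alpha>)) \<partial>lborel) > 0"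
proof -
  have "(\<integral>s. indicator {0<..} s *\<^sub>R exp (- \<kappa> * complex_of_real (s powr \<alpha>)) \<partial>lborel) =
    (\<integral>x. indicator {0<..} x *\<^sub>R ((1 / \<alpha>) * x powr (1 / \<alpha> - 1)) *\<^sub>R
       exp (- \<kappa> * complex_of_real ((x powr (1 / \<alpha>)) powr \<alpha>)) \<partial>lborel)"
    by (rule integral_powr_substitution) (use \<alpha> integrable_exp_powr[OF assms] in auto)
  also have "\<dots> = (\<integral>x. (1 / \<alpha>) *\<^sub>R (indicator {0<..} x *\<^sub>R (x powr (- (1 - 1 / \<alpha>))) *\<^sub>R
       exp (- \<kappa> * complex_of_real x)) \<partial>lborel)"
    using \<alpha> by (intro Bochner_Integration.integral_cong) (auto simp: indicator_def powr_powr)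
  also have "\<dots> = (1 / \<alpha>) *\<^sub>R (\<integral>x. indicator {0<..} x *\<^sub>R (x powr (- (1 - 1 / \<alpha>))) *\<^sub>R
       exp (- \<kappa> * complex_of_real x) \<partial>lborel)"
    by (rule integral_scaleR_right)
  finally show ?thesis
    using Laplace_powr_pos[of "1 - 1 / \<alpha>" \<kappa>] \<alpha> \<kappa> by (simp add: zero_less_mult_iff)
qed

section \<open>Fourier inversion for the offspring walk\<close>

locale critical_offspring =
  fixes p :: "nat pmf"
  assumes p0: "pmf p 0 > 0"
    and p2: "\<exists>i\<ge>2. pmf p i > 0"
    and mean: "(\<lambda>i. real i * pmf p i) sums 1"
begin

text \<open>The offspring walk is carried by the multiples of this number.\<close>

definition span :: nat where "span = Gcd {i. pmf p i > 0}"

lemma span_dvd: "pmf p i > 0 \<Longrightarrow> span dvd i"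
  unfolding span_def by (rule Gcd_dvd) simp

lemma span_pos: "span > 0"
proof -
  obtain i where "i \<ge> 2" "pmf p i > 0" using p2 by blast
  thus ?thesis using span_dvd[of i] by (cases "span = 0") auto
qed

lemma sums_pmf: "pmf p sums 1"
proof -
  have "infsetsum (pmf p) UNIV = 1" by (rule infsetsum_pmf_eq_1) simp
  moreover have "summable (\<lambda>i. norm (pmf p i))"
    by (rule iffD1[OF abs_summable_on_nat_iff' pmf_abs_summable])
  ultimately show ?thesis using infsetsum_nat'[OF pmf_abs_summable[of p UNIV]]
    by (simp add: sums_iff)
qed

text \<open>The characteristic function of the offspring number minus 1.\<close>

definition phi :: "real \<Rightarrow> complex" where
  "phi t = (\<Sum>i. pmf p i *\<^sub>R exp (\<i> * (t * (real i - 1))))"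

lemma norm_exp_i [simp]: "norm (exp (\<i> * complex_of_real x)) = 1"
  by simp

lemma summable_phi: "summable (\<lambda>i. norm (pmf p i *\<^sub>R exp (\<i> * (t * (real i - 1)))))"
  using sums_pmf by (simp add: sums_iff norm_exp_i del: of_real_mult of_real_diff)

lemma sums_phi: "(\<lambda>i. pmf p i *\<^sub>R exp (\<i> * (t * (real i - 1)))) sums phi t"
  unfolding phi_def by (rule summable_sums[OF summable_norm_cancel[OF summable_phi]])

lemma norm_phi_le_1: "norm (phi t) \<le> 1"
proof -
  have "norm (phi t) \<le> (\<Sum>i. norm (pmf p i *\<^sub>R exp (\<i> * (t * (real i - 1)))))"
    unfolding phi_def by (rule summable_norm[OF summable_phi])
  also have "\<dots> = 1" using sums_pmf by (simp add: sums_iff norm_exp_i del: of_real_mult of_real_diff)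
  finally show ?thesis .
qed

lemma walk_prob_nonneg: "walk_prob p l y \<ge> 0"
  by (induction l arbitrary: y) (auto simp: walk_prob_0 walk_prob_Suc intro!: sum_nonneg mult_nonneg_nonneg)

lemma walk_prob_sums:
  "walk_prob p l sums 1 \<and> (\<lambda>y. walk_prob p l y *\<^sub>R exp (\<i> * (t * (real y - real l)))) sums phi t ^ l"
proof (induction l)
  case 0
  have "(\<lambda>y. if y = 0 then 1 else 0) sums (1::real)" using sums_single[of 0 "\<lambda>_. 1::real"] by simp
  moreover have "(\<lambda>y. walk_prob p 0 y *\<^sub>R exp (\<i> * (t * (real y - real 0)))) =
     (\<lambda>y. if y = 0 then 1 else 0)"
    by (auto simp: walk_prob_0 fun_eq_iff)
  moreover have "(\<lambda>y. if y = 0 then 1 else 0) sums (1::complex)" using sums_single[of 0 "\<lambda>_. 1::complex"] by simp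
  ultimately show ?case by (simp add: walk_prob_0[abs_def])
next
  case (Suc l)
  have s1: "summable (\<lambda>k. norm (walk_prob p l k))" using Suc by (simp add: sums_iff walk_prob_nonneg)
  have s2: "summable (\<lambda>i. norm (pmf p i))" using sums_pmf by (simp add: sums_iff)
  have "(\<lambda>y. \<Sum>i\<le>y. pmf p i * walk_prob p l (y - i)) sums ((\<Sum>i. pmf p i) * (\<Sum>k. walk_prob p l k))"
    by (rule Cauchy_product_sums[OF s2 s1])
  hence 1: "walk_prob p (Suc l) sums 1"
    using Suc sums_pmf by (simp add: walk_prob_Suc[abs_def] sums_iff)
  have s1': "summable (\<lambda>k. norm (walk_prob p l k *\<^sub>R exp (\<i> * (t * (real k - real l)))))"
    using s1 by (simp add: norm_exp_i walk_prob_nonneg del: of_real_mult of_real_diff)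
  have "(\<lambda>y. \<Sum>i\<le>y. (pmf p i *\<^sub>R exp (\<i> * (t * (real i - 1)))) *
      (walk_prob p l (y - i) *\<^sub>R exp (\<i> * (t * (real (y - i) - real l))))) sums
     (phi t * (\<Sum>k. walk_prob p l k *\<^sub>R exp (\<i> * (t * (real k - real l)))))"
    unfolding phi_def by (rule Cauchy_product_sums[OF summable_phi s1'])
  also have "(\<Sum>k. walk_prob p l k *\<^sub>R exp (\<i> * (t * (real k - real l)))) = phi t ^ l"
    using Suc by (simp add: sums_iff)
  also have "(\<lambda>y. \<Sum>i\<le>y. (pmf p i *\<^sub>R exp (\<i> * (t * (real i - 1)))) *
      (walk_prob p l (y - i) *\<^sub>R exp (\<i> * (t * (real (y - i) - real l))))) =
     (\<lambda>y. walk_prob p (Suc l) y *\<^sub>R exp (\<i> * (t * (real y - real (Suc l)))))"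
  proof
    fix y
    have e: "exp (\<i> * (t * (real i - 1))) * exp (\<i> * (t * (real (y - i) - real l))) =
        exp (\<i> * (t * (real y - real (Suc l))))" if "i \<le> y" for i
      using that by (simp add: exp_add[symmetric] of_nat_diff algebra_simps)
    have "(\<Sum>i\<le>y. (pmf p i *\<^sub>R exp (\<i> * (t * (real i - 1)))) *
      (walk_prob p l (y - i) *\<^sub>R exp (\<i> * (t * (real (y - i) - real l))))) =
      (\<Sum>i\<le>y. (pmf p i * walk_prob p l (y - i)) *\<^sub>R exp (\<i> * (t * (real y - real (Suc l)))))"
    proof (intro sum.cong refl)
      fix i assume "i \<in> {..y}"
      thus "(pmf p i *\<^sub>R exp (\<i> * (t * (real i - 1)))) *
      (walk_prob p l (y - i) *\<^sub>R exp (\<i> * (t * (real (y - i) - real l)))) =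
        (pmf p i * walk_prob p l (y - i)) *\<^sub>R exp (\<i> * (t * (real y - real (Suc l))))"
        using e[of i] by (simp only: mult_scaleR_left mult_scaleR_right scaleR_scaleR atMost_iff mult.commute[of "pmf p i"])
    qed
    thus "(\<Sum>i\<le>y. (pmf p i *\<^sub>R exp (\<i> * (t * (real i - 1)))) *
      (walk_prob p l (y - i) *\<^sub>R exp (\<i> * (t * (real (y - i) - real l))))) =
       walk_prob p (Suc l) y *\<^sub>R exp (\<i> * (t * (real y - real (Suc l))))"
      by (simp only: walk_prob_Suc scaleR_sum_left)
  qed
  finally show ?case using 1 by simp
qed

lemma walk_prob_eq_0:
  assumes "\<not> span dvd y"
  shows "walk_prob p l y = 0"
  using assms
proof (induction l arbitrary: y)
  case 0
  thus ?case by (cases "y = 0") (auto simp: walk_prob_0)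
next
  case (Suc l)
  have "pmf p i * walk_prob p l (y - i) = 0" if "i \<le> y" for i
  proof (cases "span dvd i")
    case True
    hence "\<not> span dvd y - i" using Suc.prems that by (metis dvd_diffD)
    thus ?thesis using Suc.IH by simp
  next
    case False
    hence "\<not> pmf p i > 0" using span_dvd by blast
    thus ?thesis by (simp add: order_less_le)
  qed
  thus ?case by (auto simp: walk_prob_Suc intro!: sum.neutral)
qed

lemma walk_prob_le_1: "walk_prob p l y \<le> 1"
proof -
  have "walk_prob p l y \<le> (\<Sum>y. walk_prob p l y)"
    using walk_prob_sums[of l 0] sum_le_suminf[of "walk_prob p l" "{y}"]
    by (auto simp: sums_iff walk_prob_nonneg)
  thus ?thesis using walk_prob_sums[of l 0] by (simp add: sums_iff)
qed

lemma integral_cos_Icc: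
  assumes "c \<noteq> (0::real)" "a \<ge> 0"
  shows "(\<integral>t. indicator {0..a} t * cos (c * t) \<partial>lborel) = sin (c * a) / c"
proof -
  have "(\<integral>t. cos (c * t) * indicator {0..a} t \<partial>lborel) = sin (c * a) / c - sin (c * 0) / c"
    using assms by (intro integral_FTC_Icc_real) (auto intro!: derivative_eq_intros continuous_intros)
  thus ?thesis by (simp add: mult.commute)
qed

lemma phi_measurable [measurable]: "phi \<in> borel_measurable borel"
  unfolding phi_def[abs_def] by measurable

text \<open>Fourier inversion. As all values of the walk are multiples of \<open>span\<close>, the cosines already separate them on
  \<open>[0, pi / span]\<close>, and the points with \<open>norm (phi t) = 1\<close> other than 0 are avoided.\<close>

lemma walk_prob_eq_integral:
  assumes y: "span dvd y"
  shows "walk_prob p l y = real span / pi *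
    (\<integral>t. indicator {0..pi / span} t * Re (phi t ^ l * exp (\<i> * (t * (real l - real y)))) \<partial>lborel)"
proof -
  define P where "P = walk_prob p l"
  define f where "f = (\<lambda>j t. indicator {0..pi / span} t * (P j * cos ((real j - real y) * t)))"
  have Psum: "summable P" using walk_prob_sums[of l 0] by (auto simp: P_def sums_iff)
  have Pnn: "P j \<ge> 0" for j by (simp add: P_def walk_prob_nonneg)
  have fsums: "(\<lambda>j. f j t) sums (indicator {0..pi / span} t * Re (phi t ^ l * exp (\<i> * (t * (real l - real y)))))" for t
  proof -
    have "(\<lambda>j. walk_prob p l j *\<^sub>R exp (\<i> * (t * (real j - real l)))) sums phi t ^ l"
      using walk_prob_sums by blast
    hence "(\<lambda>j. walk_prob p l j *\<^sub>R exp (\<i> * (t * (real j - real l))) * exp (\<i> * (t * (real l - real y))))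
        sums (phi t ^ l * exp (\<i> * (t * (real l - real y))))" by (rule sums_mult2)
    also have "(\<lambda>j. walk_prob p l j *\<^sub>R exp (\<i> * (t * (real j - real l))) * exp (\<i> * (t * (real l - real y)))) =
        (\<lambda>j. P j *\<^sub>R exp (\<i> * ((real j - real y) * t)))"
      by (simp add: exp_add[symmetric] fun_eq_iff P_def algebra_simps)
    finally have "(\<lambda>j. P j * cos ((real j - real y) * t)) sums Re (phi t ^ l * exp (\<i> * (t * (real l - real y))))"
      by (auto dest!: sums_Re simp: Re_exp)
    thus ?thesis unfolding f_def by (rule sums_mult)
  qed
  have bound: "norm (f j t) \<le> P j * indicator {0..pi / span} t" for j t
    using Pnn[of j] abs_cos_le_one[of "(real j - real y) * t"]
    by (auto simp: f_def indicator_def abs_mult mult_left_le)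
  have fin: "integrable lborel (\<lambda>t. P j * indicator {0..pi / span} t)" for j
    by simp
  have int: "integrable lborel (f j)" for j
    by (rule Bochner_Integration.integrable_bound[OF fin[of j]])
       (use bound Pnn in \<open>auto simp: f_def abs_mult\<close>)
  have "summable (\<lambda>j. \<integral>t. norm (f j t) \<partial>lborel)"
  proof (rule summable_comparison_test')
    show "summable (\<lambda>j. P j * (pi / span))" by (intro summable_mult2 Psum)
    fix j :: nat assume "j \<ge> 0"
    have "(\<integral>t. norm (f j t) \<partial>lborel) \<le> (\<integral>t. P j * indicator {0..pi / span} t \<partial>lborel)"
      by (intro integral_mono integrable_norm int fin bound)
    thus "norm (\<integral>t. norm (f j t) \<partial>lborel) \<le> P j * (pi / span)" by simp
  qed
  moreover have "summable (\<lambda>j. norm (f j t))" for t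
  proof (rule summable_comparison_test')
    show "summable (\<lambda>j. P j * indicator {0..pi / span} t)" by (intro summable_mult2 Psum)
    show "norm (norm (f j t)) \<le> P j * indicator {0..pi / span} t" if "j \<ge> 0" for j using bound by simp
  qed
  ultimately have "(\<lambda>j. integral\<^sup>L lborel (f j)) sums (\<integral>t. (\<Sum>j. f j t) \<partial>lborel)"
    by (intro sums_integral int) auto
  also have "(\<lambda>t. \<Sum>j. f j t) = (\<lambda>t. indicator {0..pi / span} t * Re (phi t ^ l * exp (\<i> * (t * (real l - real y)))))"
    using fsums by (auto simp: sums_iff)
  also have "(\<lambda>j. integral\<^sup>L lborel (f j)) = (\<lambda>j. if j = y then P y * (pi / span) else 0)"
  proof
    fix j
    consider "j = y" | "j \<noteq> y" "span dvd j" | "\<not> span dvd j" by blast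
    thus "integral\<^sup>L lborel (f j) = (if j = y then P y * (pi / span) else 0)"
    proof cases
      case 1
      thus ?thesis by (simp add: f_def mult.commute)
    next
      case 2
      then obtain u v where uv: "j = span * u" "y = span * v" using y by blast
      have c: "real j - real y \<noteq> 0" using 2 by simp
      have "(real j - real y) * (pi / span) = pi * real_of_int (int u - int v)"
        using span_pos by (simp add: uv field_simps)
      hence s0: "sin ((real j - real y) * (pi / span)) = 0" by (simp only: sin_npi_int)
      have "integral\<^sup>L lborel (f j) =
          P j * (\<integral>t. indicator {0..pi / span} t * cos ((real j - real y) * t) \<partial>lborel)"
        unfolding f_def by (subst integral_mult_right_zero[symmetric]) (simp add: mult_ac)
      also have "\<dots> = 0" by (subst integral_cos_Icc[OF c]) (use s0 in auto)
      finally show ?thesis using 2 by simp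
    next
      case 3
      thus ?thesis using y by (auto simp: f_def P_def walk_prob_eq_0)
    qed
  qed
  finally have "(\<lambda>j. if j = y then P y * (pi / span) else 0) sums
      (\<integral>t. indicator {0..pi / span} t * Re (phi t ^ l * exp (\<i> * (t * (real l - real y)))) \<partial>lborel)" .
  moreover have "(\<lambda>j. if j = y then P y * (pi / span) else 0) sums (P y * (pi / span))"
    using sums_single[of y "\<lambda>_. P y * (pi / span)"] by simp
  ultimately have "P y * (pi / span) = 
      (\<integral>t. indicator {0..pi / span} t * Re (phi t ^ l * exp (\<i> * (t * (real l - real y)))) \<partial>lborel)"
    by (rule sums_unique2[symmetric])
  thus ?thesis using span_pos by (simp add: P_def[symmetric] field_simps)
qed

end

section \<open>Regular variation of the offspring law\<close>

context critical_offspring begin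

text \<open>The second moments of the positive values of the offspring number minus 1.\<close>

definition a :: "nat \<Rightarrow> real" where "a j = (real j)\<^sup>2 * pmf p (Suc j)"
definition W :: "nat \<Rightarrow> real" where "W k = (\<Sum>j\<le>k. a j)"

lemma a_nonneg: "a j \<ge> 0" by (simp add: a_def)

lemma W_mono: "mono W"
  by (rule monoI) (auto simp: W_def intro!: sum_mono2 a_nonneg)

lemma W_nonneg: "W k \<ge> 0"
  by (auto simp: W_def intro!: sum_nonneg a_nonneg)

lemma W_eventually_pos: "\<forall>\<^sub>F k in sequentially. W k > 0"
proof -
  obtain i where i: "i \<ge> 2" "pmf p i > 0" using p2 by blast
  then obtain j where j: "i = Suc j" "j \<ge> 1" by (cases i) auto
  have "W k > 0" if "k \<ge> j" for k
  proof -
    have "0 < a j" using i j by (simp add: a_def)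
    also have "a j \<le> W k" unfolding W_def using that by (intro member_le_sum a_nonneg) auto
    finally show ?thesis .
  qed
  thus ?thesis by (rule eventually_sequentiallyI)
qed

lemma summable_a_div: "summable (\<lambda>j. a j / real j)"
proof (rule summable_comparison_test')
  show "summable (\<lambda>j. real (Suc j) * pmf p (Suc j))"
    using sums_summable[OF mean] by (subst summable_Suc_iff)
  show "norm (a j / real j) \<le> real (Suc j) * pmf p (Suc j)" if "j \<ge> 0" for j
    by (cases "j = 0") (auto simp: a_def power2_eq_square intro!: mult_right_mono)
qed

lemma W_bounded_imp_ratio:
  assumes "summable a" "m > 0"
  shows "(\<lambda>k. W (m * k) / W k) \<longlonglongrightarrow> 1"
proof -
  have lim: "W \<longlonglongrightarrow> suminf a" unfolding W_def[abs_def] using assms(1) by (rule summable_LIMSEQ')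
  obtain k0 where k0: "W k0 > 0" using W_eventually_pos by (auto simp: eventually_sequentially)
  have "W k0 \<le> suminf a" unfolding W_def using assms(1) by (intro sum_le_suminf) (auto simp: a_nonneg)
  hence pos: "suminf a > 0" using k0 by linarith
  have "(\<lambda>k. W (m * k)) \<longlonglongrightarrow> suminf a"
    by (rule filterlim_compose[OF lim mult_nat_left_at_top[OF assms(2)]])
  from tendsto_divide[OF this lim] pos show ?thesis by simp
qed

definition V :: "nat \<Rightarrow> real" where "V k = (\<Sum>i\<le>k. (real i)\<^sup>2 * pmf p i)"

text \<open>Passing from \<open>i\<close> to \<open>i - 1\<close> changes a truncated second moment by at most twice the mean, which is negligible
  when the variance is infinite.\<close>

lemma V_Suc_minus_W: "0 \<le> V (Suc k) - W k" "V (Suc k) - W k \<le> 2"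
proof -
  have eq: "V (Suc k) - W k = (\<Sum>j\<le>k. (2 * real j + 1) * pmf p (Suc j))"
  proof -
    have "V (Suc k) = (\<Sum>j\<le>k. (real (Suc j))\<^sup>2 * pmf p (Suc j))"
      unfolding V_def by (subst sum.atMost_Suc_shift) simp
    thus ?thesis unfolding W_def a_def
      by (simp add: sum_subtractf[symmetric] algebra_simps power2_eq_square)
  qed
  show "0 \<le> V (Suc k) - W k" unfolding eq by (auto intro!: sum_nonneg)
  have "(\<Sum>j\<le>k. (2 * real j + 1) * pmf p (Suc j)) \<le> (\<Sum>j\<le>k. 2 * (real (Suc j) * pmf p (Suc j)))"
  proof (rule sum_mono)
    fix j
    have "(2 * real j + 1) * pmf p (Suc j) \<le> (2 * real (Suc j)) * pmf p (Suc j)"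
      by (intro mult_right_mono) auto
    thus "(2 * real j + 1) * pmf p (Suc j) \<le> 2 * (real (Suc j) * pmf p (Suc j))"
      by (simp only: mult.assoc)
  qed
  also have "\<dots> = 2 * (\<Sum>j\<le>k. real (Suc j) * pmf p (Suc j))" by (simp add: sum_distrib_left)
  also have "(\<Sum>j\<le>k. real (Suc j) * pmf p (Suc j)) = (\<Sum>i\<le>Suc k. real i * pmf p i)"
    by (subst sum.atMost_Suc_shift) simp
  also have "\<dots> \<le> (\<Sum>i. real i * pmf p i)"
    using sums_summable[OF mean] by (intro sum_le_suminf) auto
  also have "\<dots> = 1" using mean by (simp add: sums_iff)
  finally show "V (Suc k) - W k \<le> 2" unfolding eq by simp
qed

lemma summable_second_moment_imp:
  assumes "offspring_variance p < \<infinity>"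
  shows "summable a"
proof -
  have "summable (\<lambda>i. (real i - 1)\<^sup>2 * pmf p i)"
    using assms unfolding offspring_variance_def
    by (intro summable_suminf_not_top) auto
  hence "summable (\<lambda>i. (real (Suc i) - 1)\<^sup>2 * pmf p (Suc i))"
    by (subst summable_Suc_iff)
  thus ?thesis by (simp add: a_def[abs_def])
qed

lemma offspring_variance_finite:
  assumes "summable a"
  shows "offspring_variance p < \<infinity>"
proof -
  have "summable (\<lambda>i. (real (Suc i) - 1)\<^sup>2 * pmf p (Suc i))" using assms by (simp add: a_def[abs_def])
  hence s: "summable (\<lambda>i. (real i - 1)\<^sup>2 * pmf p i)" by (subst (asm) summable_Suc_iff)
  show ?thesis unfolding offspring_variance_def
    by (subst suminf_ennreal2[OF _ s]) (auto simp: ennreal_less_top)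
qed

lemma V_filterlim:
  assumes "offspring_variance p = \<infinity>"
  shows "filterlim V at_top sequentially"
proof -
  have "\<not> summable a" using offspring_variance_finite assms by auto
  hence nb: "\<not> (\<exists>c. \<forall>n. (\<Sum>j<n. a j) \<le> c)"
    using summableI_nonneg_bounded[of a] a_nonneg by blast
  show ?thesis unfolding filterlim_at_top
  proof
    fix Z
    obtain n where n: "(\<Sum>j<n. a j) > Z" using nb by (metis not_le)
    have "V k \<ge> Z" if "k \<ge> Suc n" for k
    proof -
      have "Z \<le> W n" using n unfolding W_def lessThan_Suc_atMost[symmetric] using a_nonneg[of n] by simp
      also have "\<dots> \<le> V (Suc n)" using V_Suc_minus_W(1)[of n] by simp
      also have "\<dots> \<le> V k" unfolding V_def using that by (intro sum_mono2) auto
      finally show ?thesis .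
    qed
    thus "\<forall>\<^sub>F k in sequentially. Z \<le> V k" by (rule eventually_sequentiallyI)
  qed
qed

lemma W_ratio_infinite_variance:
  assumes inf: "offspring_variance p = \<infinity>" and reg: "truncated_moments_regular p \<alpha>" and m: "m > 0"
  shows "(\<lambda>k. W (m * k) / W k) \<longlonglongrightarrow> real m powr (2 - \<alpha>)"
proof -
  obtain L where L: "slowly_varying L" "\<forall>\<^sub>F k in sequentially. V k = real k powr (2 - \<alpha>) * L (real k)"
    using reg unfolding truncated_moments_regular_def V_def by blast
  have Vtop: "filterlim V at_top sequentially" by (rule V_filterlim[OF inf])
  interpret V: regularly_varying V "2 - \<alpha>"
  proof
    show "mono V" by (rule monoI) (auto simp: V_def intro!: sum_mono2)
    show "V k \<ge> 0" for k by (auto simp: V_def intro!: sum_nonneg)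
    show "\<forall>\<^sub>F k in sequentially. V k > 0"
      using Vtop by (auto simp: filterlim_at_top_dense)
    fix m :: nat assume m: "m > 0"
    have "((\<lambda>x. L (real m * x) / L x) \<longlongrightarrow> 1) at_top"
      using L(1) m unfolding slowly_varying_def by auto
    from filterlim_compose[OF this filterlim_real_sequentially]
    have "(\<lambda>k. real m powr (2 - \<alpha>) * (L (real m * real k) / L (real k))) \<longlonglongrightarrow> real m powr (2 - \<alpha>) * 1"
      by (intro tendsto_mult tendsto_const)
    moreover have "\<forall>\<^sub>F k in sequentially. real m powr (2 - \<alpha>) * (L (real m * real k) / L (real k)) = V (m * k) / V k"
      using L(2) eventually_compose_filterlim[OF L(2) mult_nat_left_at_top[OF m]] eventually_gt_at_top[of 0]
    proof eventually_elim
      case (elim k)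
      have "L (real k) > 0" using L(1) elim by (simp add: slowly_varying_def)
      thus ?case using elim by (simp add: powr_mult)
    qed
    ultimately show "(\<lambda>k. V (m * k) / V k) \<longlonglongrightarrow> real m powr (2 - \<alpha>)"
      by (simp add: Lim_transform_eventually)
  qed
  have WV: "(\<lambda>k. W k / V k) \<longlonglongrightarrow> 1"
  proof -
    have "(\<lambda>k. (V (Suc k) - W k) / V k) \<longlonglongrightarrow> 0"
    proof (rule tendsto_sandwich[of "\<lambda>_. 0" _ _ "\<lambda>k. 2 / V k"])
      have "(\<lambda>k. 2 / V k) \<longlonglongrightarrow> 0" by (rule tendsto_divide_0[OF tendsto_const filterlim_at_top_imp_at_infinity[OF Vtop]])
      thus "(\<lambda>k. 2 / V k) \<longlonglongrightarrow> 0" .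
      show "\<forall>\<^sub>F k in sequentially. (V (Suc k) - W k) / V k \<le> 2 / V k"
        using V_Suc_minus_W V.W_nonneg by (intro always_eventually allI divide_right_mono) auto
      show "\<forall>\<^sub>F k in sequentially. 0 \<le> (V (Suc k) - W k) / V k"
        using V_Suc_minus_W V.W_nonneg by (intro always_eventually allI divide_nonneg_nonneg) auto
    qed auto
    from tendsto_diff[OF V.W_Suc_ratio this] show ?thesis by (simp add: diff_divide_distrib)
  qed
  have WVm: "(\<lambda>k. W (m * k) / V (m * k)) \<longlonglongrightarrow> 1"
    by (rule filterlim_compose[OF WV mult_nat_left_at_top[OF m]])
  have "(\<lambda>k. (W (m * k) / V (m * k)) * (V (m * k) / V k) / (W k / V k)) \<longlonglongrightarrow> 1 * real m powr (2 - \<alpha>) / 1"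
    by (intro tendsto_intros WVm V.W_ratio m WV) auto
  moreover have "\<forall>\<^sub>F k in sequentially. (W (m * k) / V (m * k)) * (V (m * k) / V k) / (W k / V k) = W (m * k) / W k"
    using V.W_pos eventually_compose_filterlim[OF V.W_pos mult_nat_left_at_top[OF m]]
    by eventually_elim auto
  ultimately show ?thesis by (simp add: Lim_transform_eventually)
qed

text \<open>For finite variance \<open>W\<close> converges to a positive limit, so \<open>\<beta> = 0\<close>; otherwise \<open>\<beta> = 2 - \<alpha>\<close>. From here on
  both cases are treated alike.\<close>

lemma exists_regularly_varying_sum:
  assumes cond: "(0 < offspring_variance p \<and> offspring_variance p < \<infinity>) \<or>
      (offspring_variance p = \<infinity> \<and> (\<exists>\<alpha>. 1 < \<alpha> \<and> \<alpha> \<le> 2 \<and> truncated_moments_regular p \<alpha>))"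
  shows "\<exists>\<beta>. regularly_varying_sum W \<beta> a"
proof -
  have "\<exists>\<beta>. 0 \<le> \<beta> \<and> \<beta> < 1 \<and> (\<forall>m>0. (\<lambda>k. W (m * k) / W k) \<longlonglongrightarrow> real m powr \<beta>)"
  proof (cases "offspring_variance p = \<infinity>")
    case False
    hence "summable a" using cond by (intro summable_second_moment_imp) auto
    thus ?thesis using W_bounded_imp_ratio by (intro exI[of _ 0]) auto
  next
    case True
    then obtain \<alpha> where "1 < \<alpha>" "\<alpha> \<le> 2" "truncated_moments_regular p \<alpha>" using cond by auto
    thus ?thesis using W_ratio_infinite_variance True by (intro exI[of _ "2 - \<alpha>"]) auto
  qed
  then obtain \<beta> where \<beta>: "0 \<le> \<beta>" "\<beta> < 1" "\<And>m. m > 0 \<Longrightarrow> (\<lambda>k. W (m * k) / W k) \<longlonglongrightarrow> real m powr \<beta>"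
    by blast
  have "regularly_varying_sum W \<beta> a"
    by unfold_locales
       (use \<beta> W_mono W_nonneg W_eventually_pos a_nonneg summable_a_div in \<open>auto simp: W_def a_def\<close>)
  thus ?thesis by blast
qed

end

section \<open>The characteristic exponent away from the origin\<close>

lemma norm_kern_minus_half: "u \<noteq> 0 \<Longrightarrow> norm (kern u - 1 / 2) \<le> \<bar>u\<bar>"
proof -
  assume False: "u \<noteq> 0"
  have "kern u - 1 / 2 = - ((exp (\<i> * u) - (1 + \<i> * u - u ^ 2 / 2)) / complex_of_real (u ^ 2))"
    using False by (simp add: kern_def field_simps)
  hence "norm (kern u - 1 / 2) = norm (exp (\<i> * u) - (1 + \<i> * u - u ^ 2 / 2)) / u ^ 2"
    by (simp only: norm_minus_cancel norm_divide norm_of_real) simp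
  also have "\<dots> \<le> (\<bar>u\<bar> ^ 3 / 6) / u ^ 2" by (intro divide_right_mono norm_iexp_quadratic) auto
  also have "\<dots> = \<bar>u\<bar> / 6" using False
    by (cases "u > 0") (simp_all add: fact_numeral power3_eq_cube power2_eq_square divide_simps)
  also have "\<dots> \<le> \<bar>u\<bar>" by simp
  finally show ?thesis .
qed

lemma kern_minus_tendsto: "((\<lambda>x. kern (- (1 / x))) \<longlongrightarrow> 1 / 2) at_top"
proof -
  have "((\<lambda>x. kern (- (1 / x)) - 1 / 2) \<longlongrightarrow> 0) at_top"
  proof (rule Lim_null_comparison)
    show "\<forall>\<^sub>F x in at_top. norm (kern (- (1 / x)) - 1 / 2) \<le> \<bar>1 / x\<bar>"
      using eventually_gt_at_top[of 0]
    proof eventually_elim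
      case (elim x)
      thus ?case using norm_kern_minus_half[of "- (1 / x)"] by simp
    qed
    show "((\<lambda>x. \<bar>1 / x\<bar>) \<longlongrightarrow> (0::real)) at_top" by real_asymp
  qed
  from tendsto_add[OF this tendsto_const[of "1/2"]] show ?thesis by simp
qed

lemma norm_add_less:
  fixes z :: complex
  assumes "norm z = 1" "z \<noteq> 1" "a > 0" "b > 0"
  shows "norm (of_real a + of_real b * z) < a + b"
proof -
  have "Re z \<noteq> 1"
  proof
    assume "Re z = 1"
    moreover from this have "Im z = 0" using assms(1) by (simp add: norm_complex_def)
    ultimately show False using assms(2) by (simp add: complex_eq_iff)
  qed
  moreover have "Re z \<le> 1" using complex_Re_le_cmod[of z] assms(1) by simp
  ultimately have re: "Re z < 1" by simp
  have z2: "(Re z)\<^sup>2 + (Im z)\<^sup>2 = 1" using assms(1) by (simp add: norm_complex_def)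
  have "(norm (of_real a + of_real b * z))\<^sup>2 = (a + b * Re z)\<^sup>2 + (b * Im z)\<^sup>2"
    by (simp add: cmod_power2)
  also have "\<dots> = a\<^sup>2 + 2 * a * b * Re z + b\<^sup>2 * ((Re z)\<^sup>2 + (Im z)\<^sup>2)"
    by (simp add: power2_eq_square algebra_simps)
  also have "\<dots> < a\<^sup>2 + 2 * a * b * 1 + b\<^sup>2 * 1"
    using re assms(3,4) z2 by simp
  also have "\<dots> = (a + b)\<^sup>2" by (simp add: power2_eq_square algebra_simps)
  finally show ?thesis using assms(3,4) by (rule_tac power2_less_imp_less) auto
qed

context critical_offspring begin

definition psi :: "real \<Rightarrow> complex" where "psi t = 1 - phi t"
definition h :: "real \<Rightarrow> real" where "h t = Re (psi t)"
text \<open>The right end of the interval of Fourier inversion.\<close>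

definition D :: real where "D = pi / span"

lemma D_pos: "D > 0" using span_pos by (simp add: D_def)

lemma psi_sums: "(\<lambda>i. pmf p i *\<^sub>R (1 + \<i> * (t * (real i - 1)) - exp (\<i> * (t * (real i - 1))))) sums psi t"
proof -
  have "(\<lambda>i. pmf p i *\<^sub>R (1 :: complex)) sums (1 *\<^sub>R 1)" by (intro sums_scaleR_left sums_pmf)
  moreover have "(\<lambda>i. (real i * pmf p i - pmf p i) *\<^sub>R (\<i> * t)) sums ((1 - 1) *\<^sub>R (\<i> * t))"
    by (intro sums_scaleR_left sums_diff mean sums_pmf)
  ultimately have "(\<lambda>i. pmf p i *\<^sub>R (1 :: complex) + (real i * pmf p i - pmf p i) *\<^sub>R (\<i> * t) -
       pmf p i *\<^sub>R exp (\<i> * (t * (real i - 1)))) sums (1 *\<^sub>R 1 + (1 - 1) *\<^sub>R (\<i> * t) - phi t)"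
    by (intro sums_diff sums_add sums_phi)
  moreover have "pmf p i *\<^sub>R (1 :: complex) + (real i * pmf p i - pmf p i) *\<^sub>R (\<i> * t) -
       pmf p i *\<^sub>R exp (\<i> * (t * (real i - 1))) =
       pmf p i *\<^sub>R (1 + \<i> * (t * (real i - 1)) - exp (\<i> * (t * (real i - 1))))" for i
    by (simp add: scaleR_conv_of_real algebra_simps)
  ultimately show ?thesis by (simp add: psi_def)
qed

lemma psi_term:
  assumes "t \<noteq> 0"
  shows "pmf p i *\<^sub>R (1 + \<i> * (t * (real i - 1)) - exp (\<i> * (t * (real i - 1)))) =
    t\<^sup>2 *\<^sub>R ((real i - 1)\<^sup>2 * pmf p i) *\<^sub>R kern (t * (real i - 1))"
proof (cases "i = 1")
  case False
  define u where "u = t * (real i - 1)"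
  have u: "u \<noteq> 0" using assms False by (simp add: u_def)
  have "u\<^sup>2 *\<^sub>R kern u = 1 + \<i> * u - exp (\<i> * u)"
    using u by (simp add: kern_def scaleR_conv_of_real)
  moreover have "t\<^sup>2 *\<^sub>R ((real i - 1)\<^sup>2 * pmf p i) *\<^sub>R kern u = pmf p i *\<^sub>R (u\<^sup>2 *\<^sub>R kern u)"
    by (simp add: u_def power_mult_distrib mult_ac)
  ultimately show ?thesis by (simp only: u_def)
qed simp

text \<open>The value 0 of the offspring number, a step to the left, is kept apart, since the kernel sums run over
  positive steps.\<close>

lemma psi_inverse_sums:
  assumes x: "x > 0"
  shows "(\<lambda>j. a j *\<^sub>R kern (j / x)) sums (x\<^sup>2 *\<^sub>R psi (1 / x) - pmf p 0 *\<^sub>R kern (- (1 / x)))"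
proof -
  have "(\<lambda>i. (1 / x)\<^sup>2 *\<^sub>R ((real i - 1)\<^sup>2 * pmf p i) *\<^sub>R kern ((1 / x) * (real i - 1))) sums psi (1 / x)"
    using psi_sums[of "1 / x"] psi_term[of "1 / x"] x by simp
  hence "(\<lambda>i. x\<^sup>2 *\<^sub>R (1 / x)\<^sup>2 *\<^sub>R ((real i - 1)\<^sup>2 * pmf p i) *\<^sub>R kern ((1 / x) * (real i - 1))) sums (x\<^sup>2 *\<^sub>R psi (1 / x))"
    by (rule sums_scaleR_right)
  also have "(\<lambda>i. x\<^sup>2 *\<^sub>R (1 / x)\<^sup>2 *\<^sub>R ((real i - 1)\<^sup>2 * pmf p i) *\<^sub>R kern ((1 / x) * (real i - 1))) =
     (\<lambda>i. ((real i - 1)\<^sup>2 * pmf p i) *\<^sub>R kern ((real i - 1) / x))"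
    using x by (simp add: power_divide)
  finally have "(\<lambda>i. ((real (Suc i) - 1)\<^sup>2 * pmf p (Suc i)) *\<^sub>R kern ((real (Suc i) - 1) / x)) sums
      (x\<^sup>2 *\<^sub>R psi (1 / x) - ((real 0 - 1)\<^sup>2 * pmf p 0) *\<^sub>R kern ((real 0 - 1) / x))"
    by (subst sums_Suc_iff) simp
  thus ?thesis by (simp add: a_def)
qed

lemma norm_psi_le_linear: "norm (psi t) \<le> 2 * \<bar>t\<bar>"
proof -
  have s: "(\<lambda>i. pmf p i *\<^sub>R (1 - exp (\<i> * (t * (real i - 1))))) sums (1 - phi t)"
    using sums_diff[OF sums_scaleR_left[OF sums_pmf, of "1::complex"] sums_phi[of t]]
    by (simp add: scaleR_diff_right)
  have le: "norm (pmf p i *\<^sub>R (1 - exp (\<i> * (t * (real i - 1))))) \<le> \<bar>t\<bar> * (real i * pmf p i + pmf p i)" for i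
  proof -
    have "norm (1 - exp (\<i> * (t * (real i - 1)))) \<le> \<bar>t * (real i - 1)\<bar>"
      using iexp_approx1[of "t * (real i - 1)" 0] by (simp add: norm_minus_commute)
    also have "\<dots> \<le> \<bar>t\<bar> * (real i + 1)" unfolding abs_mult by (intro mult_left_mono) auto
    finally have "pmf p i * norm (1 - exp (\<i> * (t * (real i - 1)))) \<le> pmf p i * (\<bar>t\<bar> * (real i + 1))"
      by (intro mult_left_mono) auto
    moreover have "pmf p i * (\<bar>t\<bar> * (real i + 1)) = \<bar>t\<bar> * (real i * pmf p i + pmf p i)"
      by (simp add: algebra_simps)
    ultimately show ?thesis by (simp only: norm_scaleR abs_of_nonneg pmf_nonneg)
  qed
  have s2: "(\<lambda>i. \<bar>t\<bar> * (real i * pmf p i + pmf p i)) sums (\<bar>t\<bar> * (1 + 1))"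
    by (intro sums_mult sums_add mean sums_pmf)
  have "norm (\<Sum>i. pmf p i *\<^sub>R (1 - exp (\<i> * (t * (real i - 1))))) \<le> (\<Sum>i. \<bar>t\<bar> * (real i * pmf p i + pmf p i))"
    by (rule norm_suminf_le[OF le sums_summable[OF s2]])
  thus ?thesis using s s2 by (simp add: psi_def sums_iff)
qed

lemma continuous_on_phi: "continuous_on UNIV phi"
proof -
  have "uniform_limit UNIV (\<lambda>n t. \<Sum>i<n. pmf p i *\<^sub>R exp (\<i> * (t * (real i - 1)))) 
     (\<lambda>t. suminf (\<lambda>i. pmf p i *\<^sub>R exp (\<i> * (t * (real i - 1))))) sequentially"
    using sums_summable[OF sums_pmf]
    by (intro Weierstrass_m_test[where M = "pmf p"]) (auto simp del: of_real_mult of_real_diff)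
  thus ?thesis unfolding phi_def[abs_def]
    by (rule uniform_limit_theorem[rotated])
       (auto intro!: always_eventually continuous_intros)
qed

lemma continuous_on_psi [continuous_intros]: "continuous_on A psi"
  unfolding psi_def[abs_def] by (intro continuous_intros continuous_on_subset[OF continuous_on_phi]) auto

lemma continuous_on_h [continuous_intros]: "continuous_on A h"
  unfolding h_def[abs_def] by (intro continuous_intros)

lemma h_measurable [measurable]: "h \<in> borel_measurable borel"
  by (intro borel_measurable_continuous_onI continuous_intros)

lemma psi_measurable [measurable]: "psi \<in> borel_measurable borel"
  by (intro borel_measurable_continuous_onI continuous_intros)

text \<open>Otherwise \<open>t / (2 * pi)\<close> would be a fraction whose reduced denominator divides every point of the support,
  hence \<open>span\<close>, and \<open>t * span\<close> would be at least \<open>2 * pi\<close>.\<close>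

lemma exp_ne_1_on_support:
  assumes t: "0 < t" "t \<le> D"
  shows "\<exists>i. pmf p i > 0 \<and> exp (\<i> * (t * real i)) \<noteq> 1"
proof (rule ccontr)
  assume "\<not> ?thesis"
  hence "exp (\<i> * (t * real i)) = 1" if "pmf p i > 0" for i using that by blast
  hence "\<exists>n::int. t * real i = of_int (2 * n) * pi" if "pmf p i > 0" for i
    using that by (auto simp: exp_eq_1)
  then obtain m :: "nat \<Rightarrow> int" where m: "\<And>i. pmf p i > 0 \<Longrightarrow> t * real i = of_int (2 * m i) * pi" by metis
  obtain i0 where i0: "i0 \<ge> 2" "pmf p i0 > 0" using p2 by blast
  define g where "g = gcd (m i0) (int i0)"
  define u where "u = m i0 div g"
  define v where "v = int i0 div g"
  have g0: "g > 0" using i0 by (simp add: g_def)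
  have uv: "m i0 = u * g" "int i0 = v * g" "coprime u v"
    using i0 unfolding u_def v_def g_def by (auto intro: div_gcd_coprime)
  have "v * g > 0" using uv(2) i0 by linarith
  hence vpos: "v > 0" using g0 by (simp add: zero_less_mult_iff)
  have t_eq: "t = 2 * pi * of_int u / of_int v"
  proof -
    have "t * real i0 = of_int (2 * m i0) * pi" using m i0 by blast
    moreover have "real i0 = of_int v * of_int g" using uv(2) by (metis of_int_mult of_int_of_nat_eq)
    ultimately show ?thesis using g0 vpos uv(1) by (simp add: field_simps)
  qed
  have "v dvd int i" if i: "pmf p i > 0" for i
  proof -
    have "2 * pi * (of_int u * real i) = 2 * pi * (of_int v * of_int (m i))"
      using m[OF i] t_eq vpos by (simp add: field_simps)
    hence "real_of_int (u * int i) = real_of_int (v * m i)" by simp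
    hence "u * int i = v * m i" by (simp only: of_int_eq_iff)
    hence "v dvd u * int i" by simp
    thus ?thesis using uv(3) by (simp add: coprime_commute coprime_dvd_mult_right_iff)
  qed
  hence "nat v dvd i" if "pmf p i > 0" for i using that vpos by (simp add: nat_dvd_iff)
  hence "nat v dvd span" unfolding span_def by (intro Gcd_greatest) auto
  then obtain w where w: "span = nat v * w" by blast
  have tspan: "t * real span = 2 * pi * of_int (u * int w)" using vpos by (simp add: t_eq w)
  have "0 < t * real span" using t span_pos by simp
  hence "0 < 2 * pi * real_of_int (u * int w)" by (simp only: tspan)
  hence "real_of_int (u * int w) > 0" using pi_gt_zero by (simp only: zero_less_mult_iff) auto
  hence "1 \<le> u * int w" by (simp only: of_int_0_less_iff int_one_le_iff_zero_less)
  hence "real_of_int (u * int w) \<ge> 1" by (simp only: of_int_1_le_iff)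
  hence "2 * pi * 1 \<le> 2 * pi * of_int (u * int w)" by (rule mult_left_mono) simp
  also have "\<dots> = t * real span" using tspan by simp
  also have "\<dots> \<le> D * real span" using t by (intro mult_right_mono) auto
  also have "\<dots> = pi" using span_pos by (simp add: D_def)
  finally show False using pi_gt_zero by simp
qed

text \<open>The atoms at 0 and at the number \<open>i\<close> from the preceding lemma have different phases, so the triangle
  inequality is strict.\<close>

lemma norm_phi_less_1:
  assumes t: "0 < t" "t \<le> D"
  shows "norm (phi t) < 1"
proof -
  obtain i where i: "pmf p i > 0" "exp (\<i> * (t * real i)) \<noteq> 1" using exp_ne_1_on_support[OF t] by blast
  have "i \<noteq> 0" using i by (cases "i = 0") auto
  define f where "f = (\<lambda>j. pmf p j *\<^sub>R exp (\<i> * (t * (real j - 1))))"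
  define g where "g = (\<lambda>j. if j = 0 \<or> j = i then 0 else f j)"
  have fin: "(\<lambda>j. if j \<in> {0, i} then f j else 0) sums (\<Sum>j\<in>{0, i}. f j)" by (rule sums_If_finite_set) auto
  have "(\<lambda>j. f j - (if j \<in> {0, i} then f j else 0)) sums (phi t - (\<Sum>j\<in>{0, i}. f j))"
    unfolding f_def by (intro sums_diff sums_phi fin[unfolded f_def])
  moreover have "(\<lambda>j. f j - (if j \<in> {0, i} then f j else 0)) = g" by (auto simp: g_def)
  ultimately have gs: "g sums (phi t - (f 0 + f i))" using \<open>i \<noteq> 0\<close> by simp
  have finp: "(\<lambda>j. if j \<in> {0, i} then pmf p j else 0) sums (\<Sum>j\<in>{0, i}. pmf p j)" by (rule sums_If_finite_set) auto
  have ps: "(\<lambda>j. pmf p j - (if j \<in> {0, i} then pmf p j else 0)) sums (1 - (pmf p 0 + pmf p i))"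
    using sums_diff[OF sums_pmf finp] \<open>i \<noteq> 0\<close> by simp
  have "norm (suminf g) \<le> (\<Sum>j. pmf p j - (if j \<in> {0, i} then pmf p j else 0))"
    by (rule norm_suminf_le[OF _ sums_summable[OF ps]]) (auto simp: g_def f_def simp del: of_real_mult of_real_diff)
  hence gn: "norm (phi t - (f 0 + f i)) \<le> 1 - (pmf p 0 + pmf p i)" using gs ps by (simp add: sums_iff)
  have "f 0 + f i = exp (- (\<i> * t)) * (of_real (pmf p 0) + of_real (pmf p i) * exp (\<i> * (t * real i)))"
    by (simp add: f_def scaleR_conv_of_real algebra_simps exp_diff exp_minus divide_inverse)
  hence "norm (f 0 + f i) = norm (of_real (pmf p 0) + of_real (pmf p i) * exp (\<i> * (t * real i)))"
    using norm_exp_i[of "-t"] by (simp add: norm_mult)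
  also have "\<dots> < pmf p 0 + pmf p i"
    using i p0 norm_exp_i[of "t * real i"] by (intro norm_add_less) (auto simp del: of_real_mult)
  finally have "norm (f 0 + f i) < pmf p 0 + pmf p i" .
  moreover have "norm (phi t) \<le> norm (phi t - (f 0 + f i)) + norm (f 0 + f i)"
    using norm_triangle_ineq[of "phi t - (f 0 + f i)" "f 0 + f i"] by simp
  ultimately show ?thesis using gn by linarith
qed

lemma h_pos: "0 < t \<Longrightarrow> t \<le> D \<Longrightarrow> h t > 0"
  using norm_phi_less_1[of t] complex_Re_le_cmod[of "phi t"] by (simp add: h_def psi_def)

lemma h_nonneg: "h t \<ge> 0"
  using norm_phi_le_1[of t] complex_Re_le_cmod[of "phi t"] by (simp add: h_def psi_def)

lemma norm_psi_le_2: "norm (psi t) \<le> 2"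
  using norm_triangle_ineq4[of 1 "phi t"] norm_phi_le_1[of t] by (simp add: psi_def)

lemma h_le_norm_psi: "h t \<le> norm (psi t)"
  by (simp add: h_def complex_Re_le_cmod)

text \<open>A bound near the origin extends to the whole interval by compactness.\<close>

lemma bound_on_period:
  assumes f: "continuous_on {0<..D} f" and g: "continuous_on {0<..D} g"
    and pos: "\<And>t. 0 < t \<Longrightarrow> t \<le> D \<Longrightarrow> (g t :: real) > 0"
    and near: "\<forall>\<^sub>F x in at_top. (f (1 / x) :: real) \<le> C0 * g (1 / x)"
  shows "\<exists>C>0. \<forall>t. 0 < t \<longrightarrow> t \<le> D \<longrightarrow> f t \<le> C * g t"
proof -
  obtain x0 where x0: "\<And>x. x \<ge> x0 \<Longrightarrow> f (1 / x) \<le> C0 * g (1 / x)"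
    using near by (auto simp: eventually_at_top_linorder)
  define \<delta> where "\<delta> = min D (1 / max 1 x0)"
  have \<delta>: "0 < \<delta>" "\<delta> \<le> D" using D_pos by (auto simp: \<delta>_def)
  have "continuous_on {\<delta>..D} (\<lambda>t. f t / g t)"
    using \<delta> pos by (intro continuous_intros continuous_on_subset[OF f] continuous_on_subset[OF g])
      (auto simp: less_imp_neq[symmetric])
  hence "\<exists>t1\<in>{\<delta>..D}. \<forall>t\<in>{\<delta>..D}. f t / g t \<le> f t1 / g t1"
    using \<delta> by (intro continuous_attains_sup) auto
  then obtain t1 where t1: "\<And>t. t \<in> {\<delta>..D} \<Longrightarrow> f t / g t \<le> f t1 / g t1"
    by blast
  define C where "C = max 1 (max C0 (f t1 / g t1))"
  show ?thesis
  proof (intro exI[of _ C] conjI allI impI)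
    fix t assume t: "0 < t" "t \<le> D"
    note gp = pos[OF t]
    show "f t \<le> C * g t"
    proof (cases "t \<ge> \<delta>")
      case True
      hence "f t / g t \<le> C" using t1[of t] t by (simp add: C_def)
      thus ?thesis using gp by (simp add: field_simps)
    next
      case False
      hence "t \<le> 1 / max 1 x0" by (simp add: \<delta>_def)
      hence "t * max 1 x0 \<le> 1" by (simp add: pos_le_divide_eq)
      hence "max 1 x0 \<le> 1 / t" using t by (simp add: pos_le_divide_eq mult.commute del: max.bounded_iff)
      hence "x0 \<le> 1 / t" by simp
      hence "f t \<le> C0 * g t" using x0[of "1 / t"] by simp
      also have "\<dots> \<le> C * g t" using gp by (intro mult_right_mono) (auto simp: C_def)
      finally show ?thesis .
    qed
  qed (simp add: C_def)
qed

end

section \<open>The characteristic exponent near the origin\<close>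

locale critical_regular = critical_offspring p + 
  RV: regularly_varying_sum "critical_offspring.W p" \<beta> "critical_offspring.a p" for p \<beta>
begin

text \<open>The limit is positive exactly when the variance is finite.\<close>

lemma inverse_Wr_tendsto: "\<exists>c\<ge>0. ((\<lambda>x. inverse (RV.Wr x)) \<longlongrightarrow> c) at_top"
proof -
  obtain k0 where k0: "\<And>k. k \<ge> k0 \<Longrightarrow> W k > 0" using W_eventually_pos by (auto simp: eventually_sequentially)
  have "decseq (\<lambda>k. inverse (W (k + k0)))"
    using W_mono k0 by (auto simp: decseq_def mono_def intro!: le_imp_inverse_le)
  then obtain c where c: "(\<lambda>k. inverse (W (k + k0))) \<longlonglongrightarrow> c" 
    using W_nonneg by (elim decseq_convergent[of _ 0]) auto
  hence "(\<lambda>k. inverse (W k)) \<longlonglongrightarrow> c" by (rule LIMSEQ_offset)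
  moreover from this have "c \<ge> 0" by (rule LIMSEQ_le_const) (use W_nonneg in auto)
  ultimately show ?thesis unfolding RV.Wr_def
    using filterlim_compose[OF _ RV.filterlim_nat_floor, of "\<lambda>k. inverse (W k)"] by blast
qed

text \<open>The left step adds a nonnegative real number to \<open>RV.\<kappa>\<close>, so the lower bound for the real part persists.\<close>

lemma psi_asymptotics_ex:
  "\<exists>\<kappa>1. ((\<lambda>x. (x\<^sup>2 *\<^sub>R psi (1 / x)) /\<^sub>R RV.Wr x) \<longlongrightarrow> \<kappa>1) at_top \<and> Re \<kappa>1 \<ge> 1 / 3"
proof -
  obtain c where c: "c \<ge> 0" "((\<lambda>x. inverse (RV.Wr x)) \<longlongrightarrow> c) at_top" using inverse_Wr_tendsto by blast
  have "((\<lambda>x. inverse (RV.Wr x) *\<^sub>R (\<Sum>j. a j *\<^sub>R kern (j / x)) + inverse (RV.Wr x) *\<^sub>R pmf p 0 *\<^sub>R kern (- (1 / x)))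
      \<longlongrightarrow> RV.\<kappa> + c *\<^sub>R pmf p 0 *\<^sub>R (1 / 2)) at_top"
    by (intro tendsto_add RV.sum_a_kern_asymptotics tendsto_scaleR c tendsto_const kern_minus_tendsto)
  moreover have "\<forall>\<^sub>F x in at_top. inverse (RV.Wr x) *\<^sub>R (\<Sum>j. a j *\<^sub>R kern (j / x)) +
      inverse (RV.Wr x) *\<^sub>R pmf p 0 *\<^sub>R kern (- (1 / x)) = (x\<^sup>2 *\<^sub>R psi (1 / x)) /\<^sub>R RV.Wr x"
    using eventually_gt_at_top[of 0]
  proof eventually_elim
    case (elim x)
    have "(\<Sum>j. a j *\<^sub>R kern (j / x)) = x\<^sup>2 *\<^sub>R psi (1 / x) - pmf p 0 *\<^sub>R kern (- (1 / x))"
      using psi_inverse_sums[OF elim] by (simp add: sums_iff)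
    thus ?case by (simp only: scaleR_diff_right diff_add_cancel)
  qed
  ultimately have "((\<lambda>x. (x\<^sup>2 *\<^sub>R psi (1 / x)) /\<^sub>R RV.Wr x) \<longlongrightarrow> RV.\<kappa> + c *\<^sub>R pmf p 0 *\<^sub>R (1 / 2)) at_top"
    by (rule Lim_transform_eventually)
  moreover have "Re (RV.\<kappa> + c *\<^sub>R pmf p 0 *\<^sub>R (1 / 2)) \<ge> 1 / 3"
    using RV.Re_\<kappa> c(1) by (simp add: add_increasing2)
  ultimately show ?thesis by blast
qed

definition \<kappa>1 :: complex where
  "\<kappa>1 = (SOME \<kappa>1. ((\<lambda>x. (x\<^sup>2 *\<^sub>R psi (1 / x)) /\<^sub>R RV.Wr x) \<longlongrightarrow> \<kappa>1) at_top \<and> Re \<kappa>1 \<ge> 1 / 3)"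

lemma psi_asymptotics: "((\<lambda>x. (x\<^sup>2 *\<^sub>R psi (1 / x)) /\<^sub>R RV.Wr x) \<longlongrightarrow> \<kappa>1) at_top"
  and Re_\<kappa>1: "Re \<kappa>1 \<ge> 1 / 3"
  using someI_ex[OF psi_asymptotics_ex] unfolding \<kappa>1_def by auto

lemma h_asymptotics: "((\<lambda>x. x\<^sup>2 * h (1 / x) / RV.Wr x) \<longlongrightarrow> Re \<kappa>1) at_top"
  using tendsto_Re[OF psi_asymptotics] by (simp add: h_def divide_inverse mult_ac)

text \<open>Normalised to real part 1, so that \<open>psi\<close> can be compared with its own real part \<open>h\<close>.\<close>

definition \<kappa>2 :: complex where "\<kappa>2 = \<kappa>1 /\<^sub>R Re \<kappa>1"

lemma Re_\<kappa>2: "Re \<kappa>2 = 1"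
  using Re_\<kappa>1 by (simp add: \<kappa>2_def)

lemma psi_scaling:
  assumes s: "s > 0"
  shows "((\<lambda>x. psi (s / x) /\<^sub>R h (1 / x)) \<longlongrightarrow> (s powr (2 - \<beta>)) *\<^sub>R \<kappa>2) at_top"
proof -
  have div: "filterlim (\<lambda>x::real. x / s) at_top at_top" using s by real_asymp
  have 1: "((\<lambda>x. ((x / s)\<^sup>2 *\<^sub>R psi (1 / (x / s))) /\<^sub>R RV.Wr (x / s)) \<longlongrightarrow> \<kappa>1) at_top"
    by (rule filterlim_compose[OF psi_asymptotics div])
  have 2: "((\<lambda>x. RV.Wr ((1 / s) * x) / RV.Wr x) \<longlongrightarrow> (1 / s) powr \<beta>) at_top"
    using s by (intro RV.Wr_ratio) auto
  have 3: "((\<lambda>x. (RV.Wr ((1 / s) * x) / RV.Wr x) / (x\<^sup>2 * h (1 / x) / RV.Wr x)) \<longlongrightarrow>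
      (1 / s) powr \<beta> / Re \<kappa>1) at_top"
    using Re_\<kappa>1 by (intro tendsto_divide 2 h_asymptotics) auto
  have 4: "((\<lambda>x. (s\<^sup>2 * ((RV.Wr ((1 / s) * x) / RV.Wr x) / (x\<^sup>2 * h (1 / x) / RV.Wr x))) *\<^sub>R
       (((x / s)\<^sup>2 *\<^sub>R psi (1 / (x / s))) /\<^sub>R RV.Wr (x / s))) \<longlongrightarrow> (s\<^sup>2 * ((1 / s) powr \<beta> / Re \<kappa>1)) *\<^sub>R \<kappa>1) at_top"
    by (intro tendsto_scaleR tendsto_mult tendsto_const 3 1)
  have "\<forall>\<^sub>F x in at_top. (s\<^sup>2 * ((RV.Wr ((1 / s) * x) / RV.Wr x) / (x\<^sup>2 * h (1 / x) / RV.Wr x))) *\<^sub>R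
       (((x / s)\<^sup>2 *\<^sub>R psi (1 / (x / s))) /\<^sub>R RV.Wr (x / s)) = psi (s / x) /\<^sub>R h (1 / x)"
    using eventually_gt_at_top[of 0] RV.Wr_pos eventually_compose_filterlim[OF RV.Wr_pos div]
  proof eventually_elim
    case (elim x)
    have "s\<^sup>2 * ((RV.Wr ((1 / s) * x) / RV.Wr x) / (x\<^sup>2 * h (1 / x) / RV.Wr x)) *
       (inverse (RV.Wr (x / s)) * (x / s)\<^sup>2) = inverse (h (1 / x))"
      using elim s by (simp add: field_simps)
    thus ?case by (simp add: mult_ac)
  qed
  from Lim_transform_eventually[OF 4 this]
  have "((\<lambda>x. psi (s / x) /\<^sub>R h (1 / x)) \<longlongrightarrow> (s\<^sup>2 * ((1 / s) powr \<beta> / Re \<kappa>1)) *\<^sub>R \<kappa>1) at_top" .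
  also have "(s\<^sup>2 * ((1 / s) powr \<beta> / Re \<kappa>1)) *\<^sub>R \<kappa>1 = (s powr (2 - \<beta>)) *\<^sub>R \<kappa>2"
    using s by (simp add: \<kappa>2_def powr_diff powr_divide powr_numeral) (simp add: divide_inverse)
  finally show ?thesis .
qed

lemma eventually_at_top_inverse_le: "\<forall>\<^sub>F x in at_top. 0 < 1 / x \<and> 1 / x \<le> D"
  using eventually_ge_at_top[of "1 / D"] eventually_gt_at_top[of 0]
  by eventually_elim (use D_pos in \<open>auto simp: field_simps\<close>)

text \<open>The quotient of \<open>psi\<close> and its real part converges at the origin, so \<open>psi\<close> stays in a sector around the
  positive half-axis.\<close>

lemma sector: "\<exists>C>0. \<forall>t. 0 < t \<longrightarrow> t \<le> D \<longrightarrow> norm (psi t) \<le> C * h t"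
proof (rule bound_on_period)
  have "((\<lambda>x. norm (psi (1 / x) /\<^sub>R h (1 / x))) \<longlongrightarrow> norm \<kappa>2) at_top"
    using tendsto_norm[OF psi_scaling[of 1]] by simp
  hence "\<forall>\<^sub>F x in at_top. norm (psi (1 / x) /\<^sub>R h (1 / x)) < norm \<kappa>2 + 1"
    by (rule order_tendstoD) simp
  thus "\<forall>\<^sub>F x in at_top. norm (psi (1 / x)) \<le> (norm \<kappa>2 + 1) * h (1 / x)"
    using eventually_at_top_inverse_le
  proof eventually_elim
    case (elim x)
    have "h (1 / x) > 0" using elim by (intro h_pos) auto
    thus ?case using elim by (simp add: field_simps)
  qed
qed (auto intro!: h_pos continuous_intros)

lemma square_le_h: "\<exists>C>0. \<forall>t. 0 < t \<longrightarrow> t \<le> D \<longrightarrow> t\<^sup>2 \<le> C * h t"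
proof -
  obtain x1 where x1: "RV.Wr x1 > 0" using eventually_happens[OF RV.Wr_pos] by auto
  have "\<forall>\<^sub>F x in at_top. 1 / 6 < x\<^sup>2 * h (1 / x) / RV.Wr x"
    using h_asymptotics Re_\<kappa>1 by (intro order_tendstoD) auto
  hence "\<forall>\<^sub>F x in at_top. (1 / x)\<^sup>2 \<le> (6 / RV.Wr x1) * h (1 / x)"
    using RV.Wr_pos eventually_gt_at_top[of 0] eventually_ge_at_top[of x1]
  proof eventually_elim
    case (elim x)
    have "RV.Wr x1 / 6 \<le> RV.Wr x / 6" using RV.Wr_mono elim by simp
    also have "\<dots> \<le> x\<^sup>2 * h (1 / x)" using elim by (simp add: field_simps)
    finally show ?case using elim x1 by (simp add: field_simps power2_eq_square)
  qed
  thus ?thesis by (rule bound_on_period[rotated 3]) (auto intro!: h_pos continuous_intros)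
qed

text \<open>The square of \<open>norm (phi t)\<close> is \<open>1 - 2 * h t + (norm (psi t))\<^sup>2\<close>, and by the sector bound the last term is of
  order \<open>(h t)\<^sup>2\<close>.\<close>

lemma norm_phi_le_exp: "\<exists>c>0. \<forall>t. 0 \<le> t \<longrightarrow> t \<le> D \<longrightarrow> norm (phi t) \<le> exp (- c * h t)"
proof -
  obtain C where C: "C > 0" "\<And>t. 0 < t \<Longrightarrow> t \<le> D \<Longrightarrow> norm (psi t) \<le> C * h t" using sector by blast
  have "\<exists>C>0. \<forall>t. 0 < t \<longrightarrow> t \<le> D \<longrightarrow> h t \<le> C * (1 - norm (phi t))"
  proof (rule bound_on_period)
    have "((\<lambda>x. h (1 / x)) \<longlongrightarrow> 0) at_top"
    proof (rule Lim_null_comparison)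
      show "\<forall>\<^sub>F x in at_top. norm (h (1 / x)) \<le> 2 * \<bar>1 / x\<bar>"
        using h_nonneg h_le_norm_psi norm_psi_le_linear
        by (intro always_eventually allI) (metis abs_of_nonneg order_trans real_norm_def)
      show "((\<lambda>x. 2 * \<bar>1 / x\<bar>) \<longlongrightarrow> (0::real)) at_top" by real_asymp
    qed
    hence "\<forall>\<^sub>F x in at_top. h (1 / x) < 1 / C\<^sup>2" using C(1) by (intro order_tendstoD) auto
    thus "\<forall>\<^sub>F x in at_top. h (1 / x) \<le> 2 * (1 - norm (phi (1 / x)))"
      using eventually_at_top_inverse_le
    proof eventually_elim
      case (elim x)
      define t where "t = 1 / x"
      have t: "0 < t" "t \<le> D" "h t < 1 / C\<^sup>2" using elim by (auto simp: t_def)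
      have "(norm (psi t))\<^sup>2 \<le> (C * h t)\<^sup>2" using C(2) t by (intro power_mono) auto
      also have "\<dots> = (C\<^sup>2 * h t) * h t" by (simp add: power2_eq_square mult_ac)
      also have "\<dots> \<le> 1 * h t" using t(3) C(1) h_nonneg[of t] by (intro mult_right_mono) (auto simp: field_simps)
      finally have 1: "(norm (psi t))\<^sup>2 \<le> h t" by simp
      have "phi t = 1 - psi t" by (simp add: psi_def)
      hence "(norm (phi t))\<^sup>2 = (1 - Re (psi t))\<^sup>2 + (Im (psi t))\<^sup>2" by (simp add: cmod_power2)
      also have "\<dots> = 1 - 2 * h t + (norm (psi t))\<^sup>2"
        unfolding cmod_power2 h_def by (simp add: power2_eq_square algebra_simps)
      also have "\<dots> \<le> 1 - h t" using 1 by simp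
      finally have "h t \<le> 1 - (norm (phi t))\<^sup>2" by simp
      also have "\<dots> = (1 - norm (phi t)) * (1 + norm (phi t))" by (simp add: power2_eq_square algebra_simps)
      also have "\<dots> \<le> (1 - norm (phi t)) * 2" using norm_phi_le_1[of t] by (intro mult_left_mono) auto
      finally show ?case by (simp add: t_def)
    qed
  qed (use norm_phi_less_1 in \<open>auto intro!: continuous_intros continuous_on_subset[OF continuous_on_phi]\<close>)
  then obtain C1 where C1: "C1 > 0" "\<And>t. 0 < t \<Longrightarrow> t \<le> D \<Longrightarrow> h t \<le> C1 * (1 - norm (phi t))" by blast
  show ?thesis
  proof (intro exI[of _ "1 / C1"] conjI allI impI)
    fix t assume t: "0 \<le> t" "t \<le> D"
    show "norm (phi t) \<le> exp (- (1 / C1) * h t)"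
    proof (cases "t = 0")
      case True
      have "psi 0 = 0" using norm_psi_le_linear[of 0] by simp
      thus ?thesis using True by (simp add: h_def psi_def)
    next
      case False
      hence "norm (phi t) \<le> 1 + (- (1 / C1) * h t)" using C1 t by (simp add: field_simps)
      also have "\<dots> \<le> exp (- (1 / C1) * h t)" by (rule exp_ge_add_one_self)
      finally show ?thesis .
    qed
  qed (use C1 in auto)
qed

text \<open>Near the origin \<open>h\<close> grows with index \<open>2 - \<beta>\<close>, which exceeds 1. Linear growth is enough to dominate
  \<open>exp (- n * h t)\<close> after rescaling.\<close>

lemma h_growth: "\<exists>c>0. \<forall>t s. 0 < t \<longrightarrow> 1 \<le> s \<longrightarrow> s * t \<le> D \<longrightarrow> c * s * h t \<le> h (s * t)"
proof -
  define A where "A = Re \<kappa>1"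
  have A: "A > 0" using Re_\<kappa>1 by (simp add: A_def)
  obtain x0 where x0: "x0 > 0" "\<And>x s. x \<ge> x0 \<Longrightarrow> s \<ge> 1 \<Longrightarrow> RV.Wr (s * x) \<le> 2 powr 1 * s powr 1 * RV.Wr x"
    using RV.Potter_bound[of 1] RV.\<beta>_less by auto
  have "\<forall>\<^sub>F x in at_top. A / 2 < x\<^sup>2 * h (1 / x) / RV.Wr x"
    using h_asymptotics A unfolding A_def by (intro order_tendstoD) auto
  moreover have "\<forall>\<^sub>F x in at_top. x\<^sup>2 * h (1 / x) / RV.Wr x < 2 * A"
    using h_asymptotics A unfolding A_def by (intro order_tendstoD) auto
  ultimately have "\<forall>\<^sub>F x in at_top. A / 2 * RV.Wr x \<le> x\<^sup>2 * h (1 / x) \<and> x\<^sup>2 * h (1 / x) \<le> 2 * A * RV.Wr x"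
    using RV.Wr_pos by eventually_elim (auto simp: field_simps)
  then obtain x1 where x1: "\<And>x. x \<ge> x1 \<Longrightarrow> A / 2 * RV.Wr x \<le> x\<^sup>2 * h (1 / x)"
    "\<And>x. x \<ge> x1 \<Longrightarrow> x\<^sup>2 * h (1 / x) \<le> 2 * A * RV.Wr x"
    by (auto simp: eventually_at_top_linorder)
  \<comment> \<open>The asymptotics settle arguments with \<open>s * t < \<delta>\<close>; beyond
    \<open>\<delta>\<close> compactness bounds \<open>h\<close> from below and \<open>s * t \<le> D\<close>
    bounds \<open>s * h t\<close> from above.\<close>
  define x2 where "x2 = max (1 / D) (max x0 x1)"
  have x2: "x2 > 0" using x0 by (simp add: x2_def less_max_iff_disj)
  define \<delta> where "\<delta> = 1 / x2"
  have \<delta>: "\<delta> > 0" using x2 by (simp add: \<delta>_def)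
  have "1 / D \<le> x2" by (simp add: x2_def)
  hence "1 / x2 \<le> D" using x2 D_pos by (simp add: pos_divide_le_eq mult.commute)
  hence \<delta>: "\<delta> > 0" "\<delta> \<le> D" using \<delta> by (auto simp: \<delta>_def)
  have "\<exists>t1\<in>{\<delta>..D}. \<forall>t\<in>{\<delta>..D}. h t1 \<le> h t"
    using \<delta> by (intro continuous_attains_inf continuous_intros) auto
  then obtain t1 where t1: "t1 \<in> {\<delta>..D}" "\<And>t. t \<in> {\<delta>..D} \<Longrightarrow> h t1 \<le> h t" by blast
  have m: "h t1 > 0" using t1 \<delta> by (intro h_pos) auto
  define c where "c = min (1 / 8) (h t1 / (2 * D))"
  show ?thesis
  proof (intro exI[of _ c] conjI allI impI)
    show "c > 0" using m D_pos by (simp add: c_def)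
    fix t s :: real assume t: "0 < t" "1 \<le> s" "s * t \<le> D"
    show "c * s * h t \<le> h (s * t)"
    proof (cases "s * t \<ge> \<delta>")
      case True
      have "h t \<le> 2 * t" using h_le_norm_psi[of t] norm_psi_le_linear[of t] t by simp
      hence "s * h t \<le> s * (2 * t)" using t by (intro mult_left_mono) auto
      hence sh: "s * h t \<le> 2 * D" using t(3) by linarith
      have "c * (s * h t) \<le> (h t1 / (2 * D)) * (2 * D)"
        by (rule mult_mono) (use sh t h_nonneg[of t] m D_pos in \<open>auto simp: c_def\<close>)
      also have "\<dots> = h t1" using D_pos by simp
      also have "\<dots> \<le> h (s * t)" using True t by (intro t1) auto
      finally show ?thesis by (simp add: mult.assoc)
    next
      case False
      define y where "y = 1 / (s * t)"
      have st: "s * t > 0" using t by simp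
      have y: "y \<ge> x2" using False st x2 unfolding y_def \<delta>_def by (simp add: field_simps)
      have ypos: "y > 0" using y x2 by simp
      have inv: "1 / y = s * t" "1 / (s * y) = t" using t by (auto simp: y_def)
      have "1 * y \<le> s * y" using t ypos by (intro mult_right_mono) auto
      moreover have "x1 \<le> y" using y by (simp add: x2_def)
      ultimately have sy: "s * y \<ge> x1" by linarith
      have "(s * y)\<^sup>2 * h t \<le> 2 * A * RV.Wr (s * y)" using x1(2)[OF sy] inv by simp
      also have "\<dots> \<le> 2 * A * (2 * s * RV.Wr y)"
        using x0(2)[of y s] y t A by (intro mult_left_mono) (auto simp: x2_def)
      also have "\<dots> = 8 * s * (A / 2 * RV.Wr y)" by simp
      also have "\<dots> \<le> 8 * s * (y\<^sup>2 * h (s * t))"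
        using x1(1)[of y] y t inv by (intro mult_left_mono) (auto simp: x2_def)
      finally have "s * y\<^sup>2 * (s * h t) \<le> s * y\<^sup>2 * (8 * h (s * t))"
        by (simp add: power_mult_distrib power2_eq_square mult_ac)
      hence "s * h t \<le> 8 * h (s * t)" using t ypos by (simp add: mult_le_cancel_left)
      moreover have "c * (s * h t) \<le> 1 / 8 * (s * h t)"
        using t h_nonneg[of t] by (intro mult_right_mono) (auto simp: c_def)
      ultimately show ?thesis by (simp add: mult.assoc)
    qed
  qed
qed

end

section \<open>A lower bound in the local limit theorem\<close>

lemma exp_minus_le: "0 < y \<Longrightarrow> exp (- y) \<le> 2 / y\<^sup>2" for y :: real
proof -
  assume y: "0 < y"
  have "y\<^sup>2 / 2 \<le> exp y" using exp_lower_Taylor_quadratic[of y] y by simp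
  thus ?thesis using y by (simp add: exp_minus field_simps)
qed

context critical_regular begin

text \<open>The inverse of the order of fluctuation of the walk with \<open>n\<close> steps: the exponent \<open>n * h t\<close> equals 1 at
  \<open>t = scale n\<close>.\<close>

definition scale :: "nat \<Rightarrow> real" where
  "scale n = (SOME b. 0 < b \<and> b \<le> D \<and> h b = 1 / real n)"

lemma h_0: "h 0 = 0"
  using norm_psi_le_linear[of 0] by (simp add: h_def)

lemma eventually_scale: "\<forall>\<^sub>F n in sequentially. n > 0 \<and> 0 < scale n \<and> scale n \<le> D \<and> h (scale n) = 1 / real n"
proof -
  have "h D > 0" by (rule h_pos) (use D_pos in auto)
  have "(\<lambda>n. 1 / real n) \<longlonglongrightarrow> 0" by (rule lim_1_over_n)
  hence "\<forall>\<^sub>F n in sequentially. 1 / real n < h D" using \<open>h D > 0\<close> by (rule order_tendstoD)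
  thus ?thesis using eventually_gt_at_top[of 0]
  proof eventually_elim
    case (elim n)
    have "\<exists>b\<ge>0. b \<le> D \<and> h b = 1 / real n"
      using elim D_pos by (intro IVT') (auto simp: h_0 intro!: continuous_intros)
    then obtain b where b: "0 \<le> b" "b \<le> D" "h b = 1 / real n" by blast
    have "b \<noteq> 0" using b elim by (auto simp: h_0)
    hence "\<exists>b. 0 < b \<and> b \<le> D \<and> h b = 1 / real n" using b by (intro exI[of _ b]) auto
    from someI_ex[OF this] show ?case unfolding scale_def using elim by blast
  qed
qed

lemma scale_ge: "\<forall>\<^sub>F n in sequentially. scale n \<ge> 1 / (2 * real n)"
  using eventually_scale
proof eventually_elim
  case (elim n)
  have "1 / real n \<le> 2 * scale n"
    using h_le_norm_psi[of "scale n"] norm_psi_le_linear[of "scale n"] elim by simp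
  thus ?case by simp
qed

lemma filterlim_inverse_scale: "filterlim (\<lambda>n. 1 / scale n) at_top sequentially"
  unfolding filterlim_at_top_gt[where c = "1 / D"]
proof (intro allI impI)
  fix Z assume Z: "Z > 1 / D"
  hence Zpos: "Z > 0" using D_pos by (meson less_trans zero_less_divide_1_iff)
  have "\<exists>t1\<in>{1 / Z..D}. \<forall>t\<in>{1 / Z..D}. h t1 \<le> h t"
    using Z Zpos D_pos by (intro continuous_attains_inf continuous_intros) (auto simp: field_simps)
  then obtain t1 where t1: "t1 \<in> {1 / Z..D}" "\<And>t. t \<in> {1 / Z..D} \<Longrightarrow> h t1 \<le> h t" by blast
  have "t1 > 0" using t1(1) Zpos by (meson atLeastAtMost_iff less_le_trans zero_less_divide_1_iff)
  hence "h t1 > 0" using t1 by (intro h_pos) auto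
  have "(\<lambda>n. 1 / real n) \<longlonglongrightarrow> 0" by (rule lim_1_over_n)
  hence "\<forall>\<^sub>F n in sequentially. 1 / real n < h t1" using \<open>h t1 > 0\<close> by (rule order_tendstoD)
  thus "\<forall>\<^sub>F n in sequentially. Z \<le> 1 / scale n"
    using eventually_scale
  proof eventually_elim
    case (elim n)
    have "\<not> 1 / Z \<le> scale n" using t1(2)[of "scale n"] elim by auto
    thus ?case using elim Zpos by (simp add: field_simps)
  qed
qed

text \<open>In the variable \<open>s = t / scale n\<close> the exponent \<open>n * h t\<close> is at least proportional to \<open>s\<close> for \<open>s \<ge> 1\<close>.\<close>

lemma dominating_function:
  assumes \<theta>: "\<theta> > 0"
  shows "\<exists>w. integrable lborel w \<and> (\<forall>s. w s \<ge> 0) \<and>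
    (\<forall>\<^sub>F n in sequentially. \<forall>s. indicator {0..D} (scale n * s) * exp (- \<theta> * real n * h (scale n * s)) \<le> w s)"
proof -
  obtain c where c: "c > 0" "\<And>t s. 0 < t \<Longrightarrow> 1 \<le> s \<Longrightarrow> s * t \<le> D \<Longrightarrow> c * s * h t \<le> h (s * t)"
    using h_growth by blast
  \<comment> \<open>For \<open>s \<ge> 1\<close> the exponent is at most \<open>- \<theta> * c * s\<close>;
    \<open>exp_minus_le\<close> turns this into an integrable power.\<close>
  define w where "w = (\<lambda>s::real. indicator {0..1} s + 2 / (\<theta> * c)\<^sup>2 * (indicator {1..} s * s powr (-2)))"
  have "integrable lborel w" unfolding w_def
    by (intro Bochner_Integration.integrable_add integrable_mult_right integrable_powr_atLeast(1)) auto
  moreover have w0: "w s \<ge> 0" for s by (auto simp: w_def)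
  moreover have "\<forall>\<^sub>F n in sequentially. \<forall>s. indicator {0..D} (scale n * s) * exp (- \<theta> * real n * h (scale n * s)) \<le> w s"
    using eventually_scale
  proof eventually_elim
    case (elim n)
    show ?case
    proof
      fix s :: real
      define b where "b = scale n"
      have b: "0 < b" "h b = 1 / real n" "n > 0" using elim by (auto simp: b_def)
      consider "b * s \<notin> {0..D}" | "b * s \<in> {0..D}" "s \<le> 1" | "b * s \<in> {0..D}" "s > 1" by linarith
      hence "indicator {0..D} (b * s) * exp (- \<theta> * real n * h (b * s)) \<le> w s"
      proof cases
        case 1
        thus ?thesis using w0 by simp
      next
        case 2
        hence "s \<ge> 0" using b by (simp add: zero_le_mult_iff)
        have "exp (- \<theta> * real n * h (b * s)) \<le> 1" using \<theta> h_nonneg[of "b * s"] by simp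
        also have "1 \<le> w s" using \<open>s \<ge> 0\<close> 2 by (simp add: w_def indicator_def)
        finally show ?thesis using 2 by simp
      next
        case 3
        have "c * s * h b \<le> h (s * b)" using 3 b by (intro c) (auto simp: mult.commute)
        hence "c * s \<le> real n * h (b * s)" using b by (simp add: field_simps)
        hence "\<theta> * (c * s) \<le> \<theta> * (real n * h (b * s))" using \<theta> by (intro mult_left_mono) auto
        hence "exp (- \<theta> * real n * h (b * s)) \<le> exp (- (\<theta> * c * s))" by (simp add: mult_ac)
        also have "\<dots> \<le> 2 / (\<theta> * c * s)\<^sup>2" using \<theta> c(1) 3 by (intro exp_minus_le) auto
        also have "\<dots> = 2 / (\<theta> * c)\<^sup>2 * (indicator {1..} s * s powr (-2))"
          using 3 by (simp add: powr_minus powr_numeral power_mult_distrib divide_inverse)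
        also have "\<dots> \<le> w s" by (simp add: w_def)
        finally show ?thesis using 3 by simp
      qed
      thus "indicator {0..D} (scale n * s) * exp (- \<theta> * real n * h (scale n * s)) \<le> w s" by (simp add: b_def)
    qed
  qed
  ultimately show ?thesis by blast
qed

lemma integral_exp_h_le:
  assumes \<theta>: "\<theta> > 0"
  shows "\<exists>C>0. \<forall>\<^sub>F n in sequentially. (\<integral>t. indicator {0..D} t * exp (- \<theta> * real n * h t) \<partial>lborel) \<le> C * scale n"
proof -
  obtain w where w: "integrable lborel w" "\<And>s. w s \<ge> 0"
    "\<forall>\<^sub>F n in sequentially. \<forall>s. indicator {0..D} (scale n * s) * exp (- \<theta> * real n * h (scale n * s)) \<le> w s"
    using dominating_function[OF \<theta>] by blast
  define C where "C = max 1 (\<integral>s. w s \<partial>lborel)"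
  have "\<forall>\<^sub>F n in sequentially. (\<integral>t. indicator {0..D} t * exp (- \<theta> * real n * h t) \<partial>lborel) \<le> C * scale n"
    using w(3) eventually_scale
  proof eventually_elim
    case (elim n)
    define b where "b = scale n"
    have b: "b > 0" using elim by (simp add: b_def)
    have "(\<integral>t. indicator {0..D} t * exp (- \<theta> * real n * h t) \<partial>lborel) =
        b * (\<integral>s. indicator {0..D} (b * s) * exp (- \<theta> * real n * h (b * s)) \<partial>lborel)"
      using b by (subst lborel_integral_real_affine[of b _ 0]) auto
    also have "(\<integral>s. indicator {0..D} (b * s) * exp (- \<theta> * real n * h (b * s)) \<partial>lborel) \<le> (\<integral>s. w s \<partial>lborel)"
    proof (rule integral_mono)
      show "integrable lborel (\<lambda>s. indicator {0..D} (b * s) * exp (- \<theta> * real n * h (b * s)))"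
        by (rule Bochner_Integration.integrable_bound[OF w(1)])
           (use elim w(2) in \<open>auto simp: b_def abs_mult\<close>)
    qed (use w elim in \<open>auto simp: b_def\<close>)
    also have "(\<integral>s. w s \<partial>lborel) \<le> C" by (simp add: C_def)
    finally show ?case using b by (simp add: b_def mult.commute)
  qed
  thus ?thesis by (intro exI[of _ C]) (auto simp: C_def)
qed

lemma integrable_on_period:
  fixes f :: "real \<Rightarrow> real"
  assumes [measurable]: "f \<in> borel_measurable borel" and "\<And>t. 0 \<le> t \<Longrightarrow> t \<le> D \<Longrightarrow> \<bar>f t\<bar> \<le> B"
  shows "integrable lborel (\<lambda>t. indicator {0..D} t * f t)"
proof (rule Bochner_Integration.integrable_bound)
  have "integrable lborel (indicator {0..D} :: real \<Rightarrow> real)"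
    by (rule integrable_real_indicator) (auto simp: emeasure_lborel_Icc_eq)
  thus "integrable lborel (\<lambda>t. indicator {0..D} t * B)" by (rule integrable_mult_left)
  show "AE t in lborel. norm (indicator {0..D} t * f t) \<le> norm (indicator {0..D} t * B)"
    using assms(2) by (intro AE_I2) (fastforce simp: indicator_def intro: order_trans[OF _ abs_ge_self])
qed measurable

lemma integrable_period_phi_h:
  "integrable lborel (\<lambda>t. indicator {0..D} t * norm (phi t) ^ m)"
  "integrable lborel (\<lambda>t. indicator {0..D} t * (norm (phi t) ^ m * h t))"
proof -
  show "integrable lborel (\<lambda>t. indicator {0..D} t * norm (phi t) ^ m)"
    by (rule integrable_on_period[where B = 1]) (auto intro!: power_le_one norm_phi_le_1)
  show "integrable lborel (\<lambda>t. indicator {0..D} t * (norm (phi t) ^ m * h t))"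
  proof (rule integrable_on_period[where B = "1 * 2"])
    fix t
    have "norm (phi t) ^ m * h t \<le> 1 * 2"
      using h_le_norm_psi[of t] norm_psi_le_2[of t] h_nonneg[of t]
      by (intro mult_mono power_le_one norm_phi_le_1) auto
    thus "\<bar>norm (phi t) ^ m * h t\<bar> \<le> 1 * 2" using h_nonneg[of t] by (simp add: abs_mult)
  qed measurable
qed

text \<open>A factor \<open>h t\<close> gains \<open>1 / n\<close>, because \<open>y * exp (- y) \<le> 1\<close>. The exponent \<open>m\<close> may be as small as \<open>n / 2\<close>, which
  leaves room for the steps that are absorbed by marked trees.\<close>

lemma integral_phi_power_le:
  "\<exists>C>0. \<forall>\<^sub>F n in sequentially. \<forall>m. n \<le> 2 * m \<longrightarrow>
     (\<integral>t. indicator {0..D} t * norm (phi t) ^ m \<partial>lborel) \<le> C * scale n \<and>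
     (\<integral>t. indicator {0..D} t * (norm (phi t) ^ m * h t) \<partial>lborel) \<le> C * scale n / real n"
proof -
  obtain c where c: "c > 0" "\<And>t. 0 \<le> t \<Longrightarrow> t \<le> D \<Longrightarrow> norm (phi t) \<le> exp (- c * h t)"
    using norm_phi_le_exp by blast
  obtain C1 where C1: "C1 > 0" "\<forall>\<^sub>F n in sequentially. (\<integral>t. indicator {0..D} t * exp (- (c / 4) * real n * h t) \<partial>lborel) \<le> C1 * scale n"
    using integral_exp_h_le[of "c / 4"] c by auto
  define C where "C = max C1 (4 / c * C1)"
  have "\<forall>\<^sub>F n in sequentially. \<forall>m. n \<le> 2 * m \<longrightarrow>
     (\<integral>t. indicator {0..D} t * norm (phi t) ^ m \<partial>lborel) \<le> C * scale n \<and>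
     (\<integral>t. indicator {0..D} t * (norm (phi t) ^ m * h t) \<partial>lborel) \<le> C * scale n / real n"
    using C1(2) eventually_scale
  proof eventually_elim
    case (elim n)
    show ?case
    proof (intro allI impI)
      fix m :: nat assume m: "n \<le> 2 * m"
      define e where "e = (\<lambda>t. exp (- (c / 4) * real n * h t))"
      have pow: "norm (phi t) ^ m \<le> e t * e t" if t: "0 \<le> t" "t \<le> D" for t
      proof -
        have "norm (phi t) ^ m \<le> exp (- c * h t) ^ m" using c t by (intro power_mono) auto
        also have "\<dots> = exp (real m * (- c * h t))" by (simp only: exp_of_nat_mult)
        also have "\<dots> \<le> exp (- (c / 2) * real n * h t)"
        proof -
          have "real n \<le> 2 * real m" using m by linarith
          hence "(c * h t) * (real n / 2) \<le> (c * h t) * real m" using c(1) h_nonneg[of t] by (intro mult_left_mono) auto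
          thus ?thesis by (simp add: mult_ac)
        qed
        also have "\<dots> = e t * e t" unfolding e_def exp_add[symmetric] by simp
        finally show ?thesis .
      qed
      have e1: "0 < e t" "e t \<le> 1" for t unfolding e_def using c(1) h_nonneg[of t] by auto
      have he: "e t * h t \<le> 4 / (c * real n)" for t
      proof -
        have "(c / 4) * real n * h t \<le> exp ((c / 4) * real n * h t)"
          using exp_ge_add_one_self[of "(c / 4) * real n * h t"] by linarith
        hence "e t * ((c / 4) * real n * h t) \<le> 1" by (simp add: e_def exp_minus field_simps)
        thus ?thesis using c(1) elim by (simp add: field_simps)
      qed
      have int_e: "integrable lborel (\<lambda>t. indicator {0..D} t * e t)"
        by (rule integrable_on_period[where B = 1]) (use e1 in \<open>auto simp: e_def abs_le_iff intro: order_trans[of _ 0]\<close>)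
      have "(\<integral>t. indicator {0..D} t * norm (phi t) ^ m \<partial>lborel) \<le> (\<integral>t. indicator {0..D} t * e t \<partial>lborel)"
      proof (rule integral_mono)
        show "integrable lborel (\<lambda>t. indicator {0..D} t * norm (phi t) ^ m)"
          by (rule integrable_period_phi_h)
        fix t show "indicator {0..D} t * norm (phi t) ^ m \<le> indicator {0..D} t * e t"
        proof (cases "t \<in> {0..D}")
          case True
          have "e t * e t \<le> 1 * e t" using e1[of t] by (intro mult_right_mono) auto
          thus ?thesis using pow[of t] True by simp
        qed simp
      qed (rule int_e)
      also have "\<dots> \<le> C1 * scale n" using elim by (simp add: e_def)
      also have "\<dots> \<le> C * scale n" using elim by (intro mult_right_mono) (auto simp: C_def)
      finally have 1: "(\<integral>t. indicator {0..D} t * norm (phi t) ^ m \<partial>lborel) \<le> C * scale n" .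
      have "(\<integral>t. indicator {0..D} t * (norm (phi t) ^ m * h t) \<partial>lborel) \<le>
         (\<integral>t. 4 / (c * real n) * (indicator {0..D} t * e t) \<partial>lborel)"
      proof (rule integral_mono)
        show "integrable lborel (\<lambda>t. indicator {0..D} t * (norm (phi t) ^ m * h t))"
          by (rule integrable_period_phi_h)
        show "integrable lborel (\<lambda>t. 4 / (c * real n) * (indicator {0..D} t * e t))"
          by (intro integrable_mult_right int_e)
        fix t show "indicator {0..D} t * (norm (phi t) ^ m * h t) \<le> 4 / (c * real n) * (indicator {0..D} t * e t)"
        proof (cases "t \<in> {0..D}")
          case True
          have "norm (phi t) ^ m * h t \<le> e t * e t * h t" using pow True h_nonneg by (intro mult_right_mono) auto
          also have "\<dots> = e t * (e t * h t)" by simp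
          also have "\<dots> \<le> e t * (4 / (c * real n))" using e1[of t] by (intro mult_left_mono he) auto
          finally show ?thesis using True by (simp add: mult_ac)
        qed simp
      qed
      also have "\<dots> = 4 / (c * real n) * (\<integral>t. indicator {0..D} t * e t \<partial>lborel)" by simp
      also have "\<dots> \<le> 4 / (c * real n) * (C1 * scale n)"
        using elim c(1) by (intro mult_left_mono) (auto simp: e_def)
      also have "\<dots> = (4 / c * C1) * scale n / real n" by simp
      also have "\<dots> \<le> C * scale n / real n" using elim by (intro divide_right_mono mult_right_mono) (auto simp: C_def)
      finally show "(\<integral>t. indicator {0..D} t * norm (phi t) ^ m \<partial>lborel) \<le> C * scale n \<and>
        (\<integral>t. indicator {0..D} t * (norm (phi t) ^ m * h t) \<partial>lborel) \<le> C * scale n / real n" using 1 by blast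
    qed
  qed
  moreover have "C > 0" using C1(1) by (simp add: C_def less_max_iff_disj)
  ultimately show ?thesis by blast
qed

text \<open>Here \<open>n * psi (scale n * s)\<close> converges, and replacing \<open>1 - psi\<close> by \<open>exp (- psi)\<close> costs only
  \<open>n * (norm psi)\<^sup>2\<close>, which vanishes.\<close>

lemma phi_power_tendsto:
  assumes s: "s > 0"
  shows "(\<lambda>n. phi (scale n * s) ^ n) \<longlonglongrightarrow> exp (- \<kappa>2 * complex_of_real (s powr (2 - \<beta>)))"
proof -
  define w where "w = (\<lambda>n. psi (scale n * s))"
  define z where "z = (s powr (2 - \<beta>)) *\<^sub>R \<kappa>2"
  have "(\<lambda>n. psi (s / (1 / scale n)) /\<^sub>R h (1 / (1 / scale n))) \<longlonglongrightarrow> z"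
    unfolding z_def by (rule filterlim_compose[OF psi_scaling[OF s] filterlim_inverse_scale])
  moreover have "\<forall>\<^sub>F n in sequentially. psi (s / (1 / scale n)) /\<^sub>R h (1 / (1 / scale n)) = real n *\<^sub>R w n"
    using eventually_scale by eventually_elim (auto simp: w_def mult.commute)
  ultimately have nw: "(\<lambda>n. real n *\<^sub>R w n) \<longlonglongrightarrow> z" by (rule Lim_transform_eventually)
  have "(\<lambda>n. inverse (real n) *\<^sub>R (real n *\<^sub>R w n)) \<longlonglongrightarrow> 0 *\<^sub>R z"
    by (intro tendsto_scaleR nw lim_inverse_n)
  moreover have "\<forall>\<^sub>F n in sequentially. inverse (real n) *\<^sub>R (real n *\<^sub>R w n) = w n"
    using eventually_gt_at_top[of 0] by eventually_elim simp
  ultimately have w0: "w \<longlonglongrightarrow> 0" by (simp add: Lim_transform_eventually)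
  have "(\<lambda>n. phi (scale n * s) ^ n - exp (- w n) ^ n) \<longlonglongrightarrow> 0"
  proof (rule Lim_null_comparison)
    show "\<forall>\<^sub>F n in sequentially. norm (phi (scale n * s) ^ n - exp (- w n) ^ n) \<le>
        exp (norm (w n)) * norm (real n *\<^sub>R w n) * norm (w n)"
    proof (intro always_eventually allI)
      fix n
      have "norm (phi (scale n * s) ^ n - exp (- w n) ^ n) \<le> real n * norm (phi (scale n * s) - exp (- w n))"
        using h_nonneg[of "scale n * s"] by (intro norm_power_diff norm_phi_le_1) (auto simp: w_def h_def)
      moreover have "norm (phi (scale n * s) - exp (- w n)) \<le> exp (norm (w n)) * norm (w n) ^ 2"
      proof -
        have "phi (scale n * s) - exp (- w n) = - (exp (- w n) - (\<Sum>i\<le>1. (- w n) ^ i / fact i))"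
          by (simp add: w_def psi_def)
        also have "norm \<dots> \<le> exp (norm (- w n)) * (norm (- w n) ^ Suc 1) / fact 1"
          unfolding norm_minus_cancel by (rule Taylor_exp_field[of "- w n" 1, unfolded norm_minus_cancel])
        finally show ?thesis by (simp add: power2_eq_square)
      qed
      ultimately have "norm (phi (scale n * s) ^ n - exp (- w n) ^ n) \<le> real n * (exp (norm (w n)) * norm (w n) ^ 2)"
        by (meson mult_left_mono of_nat_0_le_iff order_trans)
      thus "norm (phi (scale n * s) ^ n - exp (- w n) ^ n) \<le>
        exp (norm (w n)) * norm (real n *\<^sub>R w n) * norm (w n)"
        by (simp add: mult_ac power2_eq_square)
    qed
    have "(\<lambda>n. exp (norm (w n)) * norm (real n *\<^sub>R w n) * norm (w n)) \<longlonglongrightarrow> exp (norm (0::complex)) * norm z * norm (0::complex)"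
      by (intro tendsto_intros nw w0)
    thus "(\<lambda>n. exp (norm (w n)) * norm (real n *\<^sub>R w n) * norm (w n)) \<longlonglongrightarrow> 0" by simp
  qed
  moreover have "(\<lambda>n. exp (- w n) ^ n) \<longlonglongrightarrow> exp (- z)"
  proof -
    have "(\<lambda>n. exp (- (real n *\<^sub>R w n))) \<longlonglongrightarrow> exp (- z)" by (intro tendsto_intros nw)
    thus ?thesis by (simp add: exp_of_nat_mult[symmetric] scaleR_conv_of_real)
  qed
  ultimately have "(\<lambda>n. (phi (scale n * s) ^ n - exp (- w n) ^ n) + exp (- w n) ^ n) \<longlonglongrightarrow> 0 + exp (- z)"
    by (rule tendsto_add)
  thus ?thesis by (simp add: z_def scaleR_conv_of_real mult.commute)
qed

text \<open>After rescaling by \<open>scale n\<close> the inversion integral converges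
  to the one in \<open>stable_density_pos\<close>. The matching upper bounds are those of \<open>integral_phi_power_le\<close>, so every error
  term below can be measured against \<open>walk_prob p n (n - 1)\<close>.\<close>

lemma walk_prob_lower_bound:
  "\<exists>c>0. \<forall>\<^sub>F n in sequentially. span dvd n - 1 \<longrightarrow> c * scale n \<le> walk_prob p n (n - 1)"
proof -
  define R where "R = Re (\<integral>s. indicator {0<..} s *\<^sub>R exp (- \<kappa>2 * complex_of_real (s powr (2 - \<beta>))) \<partial>lborel)"
  have \<alpha>: "2 - \<beta> > 1" using RV.\<beta>_less by simp
  have R: "R > 0" unfolding R_def by (rule stable_density_pos[OF \<alpha> Re_\<kappa>2])
  obtain c where c: "c > 0" "\<And>t. 0 \<le> t \<Longrightarrow> t \<le> D \<Longrightarrow> norm (phi t) \<le> exp (- c * h t)"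
    using norm_phi_le_exp by blast
  obtain w where w: "integrable lborel w" "\<And>s. w s \<ge> 0"
    "\<forall>\<^sub>F n in sequentially. \<forall>s. indicator {0..D} (scale n * s) * exp (- c * real n * h (scale n * s)) \<le> w s"
    using dominating_function[OF c(1)] by blast
  obtain n0 where n0: "\<And>n. n \<ge> n0 \<Longrightarrow> \<forall>s. indicator {0..D} (scale n * s) * exp (- c * real n * h (scale n * s)) \<le> w s"
    "\<And>n. n \<ge> n0 \<Longrightarrow> n > 0 \<and> 0 < scale n \<and> scale n \<le> D \<and> h (scale n) = 1 / real n"
    using eventually_conj[OF w(3) eventually_scale] by (auto simp: eventually_sequentially)
  \<comment> \<open>The substitution \<open>t = scale n * s\<close> pulls the factor \<open>scale n\<close> out
    of the inversion integral. The shift by \<open>n0\<close> makes the domination hold for every index.\<close>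
  define g where "g = (\<lambda>n s. indicator {0..D} (scale n * s) * Re (phi (scale n * s) ^ n * exp (\<i> * (scale n * s))))"
  define g0 where "g0 = (\<lambda>s. indicator {0<..} s * Re (exp (- \<kappa>2 * complex_of_real (s powr (2 - \<beta>)))))"
  have "(\<lambda>n. \<integral>s. g (n + n0) s \<partial>lborel) \<longlonglongrightarrow> (\<integral>s. g0 s \<partial>lborel)"
  proof (rule integral_dominated_convergence)
    show "integrable lborel w" by (rule w(1))
    show "AE s in lborel. (\<lambda>n. g (n + n0) s) \<longlonglongrightarrow> g0 s"
      using AE_lborel_singleton[of "0::real"]
    proof eventually_elim
      case (elim s)
      show ?case
      proof (cases "s > 0")
        case True
        have sc0: "scale \<longlonglongrightarrow> 0"
          using tendsto_inverse_0_at_top[OF filterlim_inverse_scale] by simp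
        have "(\<lambda>n. scale n * s) \<longlonglongrightarrow> 0 * s" by (intro tendsto_intros sc0)
        hence "\<forall>\<^sub>F n in sequentially. scale n * s < D" using D_pos by (intro order_tendstoD) auto
        hence "\<forall>\<^sub>F n in sequentially. Re (phi (scale n * s) ^ n * exp (\<i> * (scale n * s))) = g n s"
          using eventually_scale by eventually_elim (use True in \<open>auto simp: g_def indicator_def\<close>)
        moreover have "(\<lambda>n. Re (phi (scale n * s) ^ n * exp (\<i> * (scale n * s)))) \<longlonglongrightarrow>
            Re (exp (- \<kappa>2 * complex_of_real (s powr (2 - \<beta>))) * exp (\<i> * complex_of_real (0 * s)))"
          by (intro tendsto_intros phi_power_tendsto True sc0)
        ultimately have "(\<lambda>n. g n s) \<longlonglongrightarrow> g0 s" using True by (simp add: g0_def Lim_transform_eventually)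
        thus ?thesis by (rule LIMSEQ_ignore_initial_segment)
      next
        case False
        hence s: "s < 0" using elim by simp
        have "g (n + n0) s = 0" for n
          using s n0(2)[of "n + n0"] by (simp add: g_def indicator_def zero_le_mult_iff)
        thus ?thesis using s by (simp add: g0_def)
      qed
    qed
    show "AE s in lborel. norm (g (n + n0) s) \<le> w s" for n
    proof (intro AE_I2)
      fix s :: real
      define m where "m = n + n0"
      define t where "t = scale m * s"
      show "norm (g (n + n0) s) \<le> w s"
      proof (cases "t \<in> {0..D}")
        case True
        have "norm (g m s) \<le> norm (phi t ^ m * exp (\<i> * t))"
          using True abs_Re_le_cmod[of "phi t ^ m * exp (\<i> * t)"] by (simp add: g_def t_def)
        also have "\<dots> = norm (phi t) ^ m" by (simp add: norm_mult norm_power)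
        also have "\<dots> \<le> exp (- c * h t) ^ m" using c True by (intro power_mono) auto
        also have "\<dots> = exp (- c * real m * h t)" by (simp add: exp_of_nat_mult[symmetric] mult_ac)
        also have "\<dots> \<le> w s" using n0(1)[of m, rule_format, of s] True by (simp add: m_def t_def)
        finally show ?thesis by (simp add: m_def)
      next
        case False
        thus ?thesis using w(2)[of s] by (simp add: g_def t_def m_def)
      qed
    qed
  qed (auto simp: g_def g0_def)
  also have "(\<integral>s. g0 s \<partial>lborel) = R"
    unfolding R_def g0_def using integrable_exp_powr[OF \<alpha> Re_\<kappa>2]
    by (subst integral_Re[symmetric]) auto
  finally have "(\<lambda>n. \<integral>s. g n s \<partial>lborel) \<longlonglongrightarrow> R" by (rule LIMSEQ_offset)
  hence "\<forall>\<^sub>F n in sequentially. (\<integral>s. g n s \<partial>lborel) > R / 2" using R by (intro order_tendstoD) auto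
  hence "\<forall>\<^sub>F n in sequentially. span dvd n - 1 \<longrightarrow> (span / pi * (R / 2)) * scale n \<le> walk_prob p n (n - 1)"
    using eventually_scale
  proof eventually_elim
    case (elim n)
    show ?case
    proof
      assume dv: "span dvd n - 1"
      have n1: "real n - real (n - 1) = 1" using elim by (simp add: of_nat_diff)
      have "walk_prob p n (n - 1) = span / pi * (\<integral>t. indicator {0..D} t * Re (phi t ^ n * exp (\<i> * t)) \<partial>lborel)"
        unfolding walk_prob_eq_integral[OF dv] D_def n1 by simp
      also have "(\<integral>t. indicator {0..D} t * Re (phi t ^ n * exp (\<i> * t)) \<partial>lborel) = scale n * (\<integral>s. g n s \<partial>lborel)"
        using elim by (subst lborel_integral_real_affine[of "scale n" _ 0]) (auto simp: g_def)
      also have "span / pi * (scale n * (\<integral>s. g n s \<partial>lborel)) \<ge> span / pi * (scale n * (R / 2))"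
        using elim by (intro mult_left_mono) auto
      finally show "(span / pi * (R / 2)) * scale n \<le> walk_prob p n (n - 1)" by (simp add: mult_ac)
    qed
  qed
  moreover have "span / pi * (R / 2) > 0" using span_pos R by simp
  ultimately show ?thesis by blast
qed

end

section \<open>First and second differences of walk probabilities\<close>

context critical_regular begin

lemma norm_phi_power_diff_le:
  assumes t: "t \<ge> 0"
  shows "norm (exp (- (\<i> * complex_of_real (t * real q))) - phi t ^ m) \<le> real q * t + real m * norm (psi t)"
proof -
  have "norm (exp (- (\<i> * complex_of_real (t * real q))) - 1) \<le> real q * t"
    using iexp_approx1[of "- (t * real q)" 0] t by (simp add: mult.commute)
  moreover have "norm (1 ^ m - phi t ^ m) \<le> real m * norm (1 - phi t)"
    by (intro norm_power_diff norm_phi_le_1) auto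
  moreover have "exp (- (\<i> * complex_of_real (t * real q))) - phi t ^ m =
      (exp (- (\<i> * complex_of_real (t * real q))) - 1) + (1 ^ m - phi t ^ m)" by simp
  ultimately show ?thesis
    using norm_triangle_ineq[of "exp (- (\<i> * complex_of_real (t * real q))) - 1" "1 ^ m - phi t ^ m"]
    by (simp only: psi_def)
qed

text \<open>The probability in \<open>marked_factor\<close>, with \<open>q\<close> marked trees of size \<open>k\<close>.\<close>

abbreviation marked_walk :: "nat \<Rightarrow> nat \<Rightarrow> nat \<Rightarrow> real" where
  "marked_walk n k q \<equiv> walk_prob p (n - q * k) (n - q * k + q - 1)"

lemma walk_prob_marked_eq_integral:
  assumes "span dvd n - 1" "span dvd k - 1" "q * k \<le> n" "k > 0" "n > 0"
  shows "marked_walk n k q = span / pi *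
    (\<integral>t. indicator {0..D} t * Re (phi t ^ (n - q * k) * exp (\<i> * t) * exp (- (\<i> * complex_of_real (t * real q)))) \<partial>lborel)"
proof -
  have y1: "n - q * k + q \<ge> 1" using assms by (cases "q = 0") auto
  have "q * (k - 1) + q = q * k" using assms by (simp add: diff_mult_distrib2)
  hence eq: "n - q * k + q - 1 = (n - 1) - q * (k - 1)" using assms y1 by linarith
  have dv: "span dvd n - q * k + q - 1"
    unfolding eq by (rule dvd_diff_nat[OF assms(1) dvd_mult[OF assms(2)]])
  have "real (n - q * k) - real (n - q * k + q - 1) = 1 - real q" using y1 by (simp add: of_nat_diff)
  hence d: "real (n - q * k) - real (n - q * k + q - 1) = 1 - real q" .
  have e: "exp (\<i> * complex_of_real (t * (1 - real q))) =
      exp (\<i> * t) * exp (- (\<i> * complex_of_real (t * real q)))" for t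
    unfolding exp_add[symmetric] by (rule arg_cong[where f = exp]) (simp add: algebra_simps)
  show ?thesis unfolding walk_prob_eq_integral[OF dv] D_def d e by (simp only: mult.assoc)
qed

lemma integrable_period_Re:
  assumes [measurable]: "F \<in> borel_measurable borel" and "\<And>t. 0 \<le> t \<Longrightarrow> t \<le> D \<Longrightarrow> norm (F t :: complex) \<le> 1"
  shows "integrable lborel (\<lambda>t. indicator {0..D} t * Re (F t))"
proof (rule integrable_on_period[where B = 1])
  show "\<bar>Re (F t)\<bar> \<le> 1" if "0 \<le> t" "t \<le> D" for t
    by (rule order_trans[OF abs_Re_le_cmod assms(2)[OF that]])
qed measurable

text \<open>Removing \<open>q * k\<close> steps and shifting the end point by \<open>q\<close> multiplies the integrand by a factor within
  \<open>q * t + q * k * norm (psi t)\<close> of 1, up to the removed power of \<open>phi\<close>. The linear term is split as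
  \<open>t \<le> 1 / sqrt n + sqrt n * t\<^sup>2\<close>, and \<open>t\<^sup>2\<close> is bounded by a multiple of \<open>h t\<close>.\<close>

lemma walk_prob_marked_diff:
  "\<exists>C>0. \<forall>\<^sub>F n in sequentially. \<forall>q k. k > 0 \<longrightarrow> 2 * (q * k) \<le> n \<longrightarrow> span dvd n - 1 \<longrightarrow> span dvd k - 1 \<longrightarrow>
     \<bar>marked_walk n k q - walk_prob p n (n - 1)\<bar> \<le>
       C * real (q * k) / sqrt (real n) * walk_prob p n (n - 1)"
proof -
  obtain C1 where C1: "C1 > 0" "\<And>t. 0 < t \<Longrightarrow> t \<le> D \<Longrightarrow> norm (psi t) \<le> C1 * h t" using sector by blast
  obtain C2 where C2: "C2 > 0" "\<And>t. 0 < t \<Longrightarrow> t \<le> D \<Longrightarrow> t\<^sup>2 \<le> C2 * h t" using square_le_h by blast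
  obtain C3 where C3: "C3 > 0" "\<forall>\<^sub>F n in sequentially. \<forall>m. n \<le> 2 * m \<longrightarrow>
     (\<integral>t. indicator {0..D} t * norm (phi t) ^ m \<partial>lborel) \<le> C3 * scale n \<and>
     (\<integral>t. indicator {0..D} t * (norm (phi t) ^ m * h t) \<partial>lborel) \<le> C3 * scale n / real n"
    using integral_phi_power_le by blast
  obtain c where c: "c > 0" "\<forall>\<^sub>F n in sequentially. span dvd n - 1 \<longrightarrow> c * scale n \<le> walk_prob p n (n - 1)"
    using walk_prob_lower_bound by blast
  define C where "C = span / pi * (C3 * (1 + C2 + C1)) / c"
  have "\<forall>\<^sub>F n in sequentially. \<forall>q k. k > 0 \<longrightarrow> 2 * (q * k) \<le> n \<longrightarrow> span dvd n - 1 \<longrightarrow> span dvd k - 1 \<longrightarrow>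
     \<bar>marked_walk n k q - walk_prob p n (n - 1)\<bar> \<le>
       C * real (q * k) / sqrt (real n) * walk_prob p n (n - 1)"
    using C3(2) c(2) eventually_scale
  proof eventually_elim
    case (elim n)
    show ?case
    proof (intro allI impI)
      fix q k assume qk: "k > 0" "2 * (q * k) \<le> n" "span dvd n - 1" "span dvd k - 1"
      define m where "m = n - q * k"
      define A where "A = (\<lambda>t. phi t ^ m * exp (\<i> * t) * exp (- (\<i> * complex_of_real (t * real q))))"
      define B where "B = (\<lambda>t. phi t ^ n * exp (\<i> * complex_of_real t))"
      define bd where "bd = (\<lambda>t. (1 / sqrt n) * (indicator {0..D} t * norm (phi t) ^ m) +
         (sqrt n * C2 + C1) * (indicator {0..D} t * (norm (phi t) ^ m * h t)))"
      have [measurable]: "A \<in> borel_measurable borel" "B \<in> borel_measurable borel" 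
        unfolding A_def B_def by measurable
      have n: "n > 0" "n \<le> 2 * m" using elim qk by (auto simp: m_def)
      have "q \<le> q * k" using qk(1) by simp
      have nA: "norm (A t) \<le> 1" and nB: "norm (B t) \<le> 1" for t
        by (auto simp: A_def B_def norm_mult norm_power power_le_one norm_phi_le_1)
      have iA: "integrable lborel (\<lambda>t. indicator {0..D} t * Re (A t))" and iB: "integrable lborel (\<lambda>t. indicator {0..D} t * Re (B t))"
        by (rule integrable_period_Re; use nA nB in simp)+
      have GA: "marked_walk n k q = span / pi * (\<integral>t. indicator {0..D} t * Re (A t) \<partial>lborel)"
        unfolding A_def m_def using qk n by (intro walk_prob_marked_eq_integral) auto
      have GB: "walk_prob p n (n - 1) = span / pi * (\<integral>t. indicator {0..D} t * Re (B t) \<partial>lborel)"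
        unfolding B_def using walk_prob_marked_eq_integral[of n k 0] qk n by simp
      have pt: "\<bar>indicator {0..D} t * Re (A t) - indicator {0..D} t * Re (B t)\<bar> \<le> real (q * k) * bd t" for t
      proof (cases "t \<in> {0..D}")
        case True
        have "phi t ^ n = phi t ^ m * phi t ^ (q * k)" using qk by (simp add: m_def power_add[symmetric])
        hence AB: "A t - B t = phi t ^ m * exp (\<i> * t) * (exp (- (\<i> * complex_of_real (t * real q))) - phi t ^ (q * k))"
          by (simp add: A_def B_def algebra_simps)
        have "norm (A t - B t) = norm (phi t) ^ m * norm (exp (- (\<i> * complex_of_real (t * real q))) - phi t ^ (q * k))"
          unfolding AB by (simp add: norm_mult norm_power)
        also have "\<dots> \<le> norm (phi t) ^ m * (real q * t + real (q * k) * norm (psi t))"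
          using True by (intro mult_left_mono norm_phi_power_diff_le) auto
        also have "\<dots> \<le> norm (phi t) ^ m * (real (q * k) * (1 / sqrt n + sqrt n * C2 * h t + C1 * h t))"
        proof (rule mult_left_mono)
          have psi: "norm (psi t) \<le> C1 * h t" and sq: "t\<^sup>2 \<le> C2 * h t"
            using C1(2)[of t] C2(2)[of t] True norm_psi_le_linear[of 0] by (cases "t = 0"; auto simp: h_0)+
          \<comment> \<open>The drift term is linear in \<open>t\<close>, while only \<open>h t\<close> (hence
            \<open>t\<^sup>2\<close>) carries the gain \<open>1 / n\<close>. Splitting at \<open>t = 1 / sqrt
            n\<close> balances the two integrals.\<close>
          have "t \<le> 1 / sqrt n + sqrt n * t\<^sup>2"
          proof -
            have "0 \<le> (sqrt n * t - 1)\<^sup>2 + sqrt n * t" using True by simp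
            hence "sqrt n * t \<le> 1 + (sqrt n * t)\<^sup>2" by (simp add: power2_eq_square algebra_simps)
            hence "sqrt n * t / sqrt n \<le> (1 + (sqrt n * t)\<^sup>2) / sqrt n" by (intro divide_right_mono) auto
            thus ?thesis using n by (simp add: field_simps power2_eq_square)
          qed
          also have "\<dots> \<le> 1 / sqrt n + sqrt n * (C2 * h t)" using sq by (intro add_left_mono mult_left_mono) auto
          finally have "real q * t \<le> real (q * k) * (1 / sqrt n + sqrt n * (C2 * h t))"
            using True \<open>q \<le> q * k\<close> by (intro mult_mono of_nat_mono) auto
          moreover have "real (q * k) * norm (psi t) \<le> real (q * k) * (C1 * h t)" using psi by (intro mult_left_mono) auto
          ultimately show "real q * t + real (q * k) * norm (psi t) \<le> real (q * k) * (1 / sqrt n + sqrt n * C2 * h t + C1 * h t)"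
            by (simp add: algebra_simps)
        qed simp
        also have "\<dots> = real (q * k) * bd t" using True by (simp add: bd_def algebra_simps)
        finally show ?thesis
          using True abs_Re_le_cmod[of "A t - B t"] by simp
      qed (simp add: bd_def)
      have ibd: "integrable lborel bd" unfolding bd_def
        by (intro Bochner_Integration.integrable_add integrable_mult_right integrable_period_phi_h)
      have J: "\<bar>\<integral>t. indicator {0..D} t * Re (A t) - indicator {0..D} t * Re (B t) \<partial>lborel\<bar> \<le> real (q * k) * (\<integral>t. bd t \<partial>lborel)"
      proof -
        have "\<bar>\<integral>t. indicator {0..D} t * Re (A t) - indicator {0..D} t * Re (B t) \<partial>lborel\<bar> \<le>
           (\<integral>t. \<bar>indicator {0..D} t * Re (A t) - indicator {0..D} t * Re (B t)\<bar> \<partial>lborel)"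
          by (rule integral_abs_bound)
        also have "\<dots> \<le> (\<integral>t. real (q * k) * bd t \<partial>lborel)"
          by (intro integral_mono integrable_abs Bochner_Integration.integrable_diff iA iB integrable_mult_right ibd pt)
        finally show ?thesis by simp
      qed
      define X where "X = C3 * (1 + C2 + C1) / sqrt n"
      have X: "X \<ge> 0" using C1(1) C2(1) C3(1) by (simp add: X_def)
      have "(\<integral>t. bd t \<partial>lborel) = (1 / sqrt n) * (\<integral>t. indicator {0..D} t * norm (phi t) ^ m \<partial>lborel) +
         (sqrt n * C2 + C1) * (\<integral>t. indicator {0..D} t * (norm (phi t) ^ m * h t) \<partial>lborel)"
        unfolding bd_def
        by (subst Bochner_Integration.integral_add[OF integrable_mult_right[OF integrable_period_phi_h(1)]
              integrable_mult_right[OF integrable_period_phi_h(2)]]) simp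
      also have "\<dots> \<le> (1 / sqrt n) * (C3 * scale n) + (sqrt n * C2 + C1) * (C3 * scale n / real n)"
        using elim n C1(1) C2(1) by (intro add_mono mult_left_mono) auto
      also have "\<dots> \<le> X * scale n"
      proof -
        have s1: "sqrt n \<ge> 1" "sqrt n * sqrt n = n" using n by auto
        have "(sqrt n * C2 + C1) / n \<le> (sqrt n * C2 + sqrt n * C1) / (sqrt n * sqrt n)"
          unfolding s1(2) using s1(1) C1(1) by (intro divide_right_mono add_left_mono) auto
        also have "\<dots> = (C2 + C1) / sqrt n" using s1(1) by (simp add: field_simps del: real_sqrt_mult_self)
        finally have "(C3 * scale n) * ((sqrt n * C2 + C1) / n) \<le> (C3 * scale n) * ((C2 + C1) / sqrt n)"
          using C3(1) elim by (intro mult_left_mono) auto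
        moreover have "(1 / sqrt n) * (C3 * scale n) + (C3 * scale n) * ((C2 + C1) / sqrt n) = X * scale n"
          by (simp add: X_def add_divide_distrib algebra_simps)
        moreover have "(sqrt n * C2 + C1) * (C3 * scale n / real n) = (C3 * scale n) * ((sqrt n * C2 + C1) / n)" by simp
        ultimately show ?thesis by linarith
      qed
      also have "\<dots> \<le> X * (walk_prob p n (n - 1) / c)"
        using elim qk c(1) by (intro mult_left_mono X) (simp add: pos_le_divide_eq mult.commute)
      finally have J2: "(\<integral>t. bd t \<partial>lborel) \<le> X * (walk_prob p n (n - 1) / c)" .
      have "marked_walk n k q - walk_prob p n (n - 1) =
         span / pi * (\<integral>t. indicator {0..D} t * Re (A t) - indicator {0..D} t * Re (B t) \<partial>lborel)"
        by (simp only: GA GB Bochner_Integration.integral_diff[OF iA iB] right_diff_distrib)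
      moreover have "\<bar>span / pi\<bar> = span / pi" by simp
      ultimately have "\<bar>marked_walk n k q - walk_prob p n (n - 1)\<bar> =
         span / pi * \<bar>\<integral>t. indicator {0..D} t * Re (A t) - indicator {0..D} t * Re (B t) \<partial>lborel\<bar>"
        by (simp only: abs_mult)
      also have "\<dots> \<le> span / pi * (real (q * k) * (X * (walk_prob p n (n - 1) / c)))"
        by (intro mult_left_mono order_trans[OF J] J2) auto
      also have "\<dots> = C * real (q * k) / sqrt (real n) * walk_prob p n (n - 1)"
        by (simp add: C_def X_def mult_ac)
      finally show "\<bar>marked_walk n k q - walk_prob p n (n - 1)\<bar> \<le>
         C * real (q * k) / sqrt (real n) * walk_prob p n (n - 1)" .
    qed
  qed
  moreover have "C > 0" using span_pos C1(1) C2(1) C3(1) c(1) by (simp add: C_def)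
  ultimately show ?thesis by blast
qed

text \<open>In a second difference in \<open>q\<close> the integrand carries the square of \<open>exp (- i t) - phi t ^ k\<close>, of order
  \<open>k\<^sup>2 * h t\<close>. The error \<open>k\<^sup>2 / n\<close> improves on the \<open>k / sqrt n\<close> of first differences; a variance of order \<open>n\<close> for the
  number of fringe trees of size \<open>k\<close> depends on this gain.\<close>

lemma walk_prob_marked_second_diff:
  "\<exists>C>0. \<forall>\<^sub>F n in sequentially. \<forall>k. k > 0 \<longrightarrow> 4 * k \<le> n \<longrightarrow> span dvd n - 1 \<longrightarrow> span dvd k - 1 \<longrightarrow>
     marked_walk n k 2 - 2 * marked_walk n k 1 +
       walk_prob p n (n - 1) \<le> C * (real k)\<^sup>2 / real n * walk_prob p n (n - 1)"
proof -
  obtain C1 where C1: "C1 > 0" "\<And>t. 0 < t \<Longrightarrow> t \<le> D \<Longrightarrow> norm (psi t) \<le> C1 * h t" using sector by blast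
  obtain C2 where C2: "C2 > 0" "\<And>t. 0 < t \<Longrightarrow> t \<le> D \<Longrightarrow> t\<^sup>2 \<le> C2 * h t" using square_le_h by blast
  obtain C3 where C3: "C3 > 0" "\<forall>\<^sub>F n in sequentially. \<forall>m. n \<le> 2 * m \<longrightarrow>
     (\<integral>t. indicator {0..D} t * norm (phi t) ^ m \<partial>lborel) \<le> C3 * scale n \<and>
     (\<integral>t. indicator {0..D} t * (norm (phi t) ^ m * h t) \<partial>lborel) \<le> C3 * scale n / real n"
    using integral_phi_power_le by blast
  obtain c where c: "c > 0" "\<forall>\<^sub>F n in sequentially. span dvd n - 1 \<longrightarrow> c * scale n \<le> walk_prob p n (n - 1)"
    using walk_prob_lower_bound by blast
  define C0 where "C0 = 2 * C2 + 4 * C1"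
  define C where "C = span / pi * (C0 * C3) / c"
  have C0: "C0 > 0" using C1(1) C2(1) by (simp add: C0_def)
  have "\<forall>\<^sub>F n in sequentially. \<forall>k. k > 0 \<longrightarrow> 4 * k \<le> n \<longrightarrow> span dvd n - 1 \<longrightarrow> span dvd k - 1 \<longrightarrow>
     marked_walk n k 2 - 2 * marked_walk n k 1 +
       walk_prob p n (n - 1) \<le> C * (real k)\<^sup>2 / real n * walk_prob p n (n - 1)"
    using C3(2) c(2) eventually_scale
  proof eventually_elim
    case (elim n)
    show ?case
    proof (intro allI impI)
      fix k assume k: "k > 0" "4 * k \<le> n" "span dvd n - 1" "span dvd k - 1"
      define m where "m = n - 2 * k"
      define E where "E = (\<lambda>t. exp (- (\<i> * complex_of_real (t * real 1))))"
      define A where "A = (\<lambda>q t. phi t ^ (n - q * k) * exp (\<i> * t) * exp (- (\<i> * complex_of_real (t * real q))))"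
      have [measurable]: "A q \<in> borel_measurable borel" for q unfolding A_def by measurable
      have n: "n > 0" "n \<le> 2 * m" using elim k by (auto simp: m_def)
      have nA: "norm (A q t) \<le> 1" for q t
        by (auto simp: A_def norm_mult norm_power power_le_one norm_phi_le_1)
      have iA: "integrable lborel (\<lambda>t. indicator {0..D} t * Re (A q t))" for q
        by (rule integrable_period_Re) (use nA in auto)
      have GA: "marked_walk n k q = span / pi * (\<integral>t. indicator {0..D} t * Re (A q t) \<partial>lborel)"
        if "q \<le> 2" for q
      proof -
        have "q * k \<le> n" using mult_le_mono1[OF that, of k] k(2) by linarith
        thus ?thesis unfolding A_def using k n by (intro walk_prob_marked_eq_integral) auto
      qed
      have pt: "indicator {0..D} t * Re (A 2 t) - 2 * (indicator {0..D} t * Re (A 1 t)) + indicator {0..D} t * Re (A 0 t) \<le>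
          (real k)\<^sup>2 * C0 * (indicator {0..D} t * (norm (phi t) ^ m * h t))" for t
      proof (cases "t \<in> {0..D}")
        case True
        have e2: "exp (- (\<i> * complex_of_real (t * real 2))) = E t ^ 2"
          unfolding E_def exp_of_nat_mult[symmetric] by (rule arg_cong[where f = exp]) simp
        have p0: "phi t ^ n = phi t ^ m * (phi t ^ k) ^ 2" "phi t ^ (n - k) = phi t ^ m * phi t ^ k"
          using k by (simp_all add: m_def power_add[symmetric] power_mult[symmetric])
        have A2: "A 2 t = phi t ^ m * exp (\<i> * t) * E t ^ 2" by (simp only: A_def e2 m_def)
        have A1: "A 1 t = phi t ^ m * phi t ^ k * exp (\<i> * t) * E t" by (simp only: A_def E_def p0 mult_1)
        have A0: "A 0 t = phi t ^ m * (phi t ^ k) ^ 2 * exp (\<i> * t)" using p0(1) by (simp add: A_def)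
        have AA: "A 2 t - 2 * A 1 t + A 0 t = phi t ^ m * exp (\<i> * t) * (E t - phi t ^ k) ^ 2"
          unfolding A2 A1 A0 by (simp add: power2_eq_square algebra_simps)
        have "Re (A 2 t) - 2 * Re (A 1 t) + Re (A 0 t) = Re (A 2 t - 2 * A 1 t + A 0 t)" by simp
        also have "\<dots> \<le> norm (A 2 t - 2 * A 1 t + A 0 t)" by (rule complex_Re_le_cmod)
        also have "\<dots> = norm (phi t) ^ m * (norm (E t - phi t ^ k))\<^sup>2"
          unfolding AA by (simp add: norm_mult norm_power)
        also have "\<dots> \<le> norm (phi t) ^ m * ((real k)\<^sup>2 * (C0 * h t))"
        proof (rule mult_left_mono)
          have psi: "norm (psi t) \<le> C1 * h t" and sq: "t\<^sup>2 \<le> C2 * h t"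
            using C1(2)[of t] C2(2)[of t] True norm_psi_le_linear[of 0] by (cases "t = 0"; auto simp: h_0)+
          have k1: "real k \<ge> 1" using k by simp
          have "norm (E t - phi t ^ k) \<le> real 1 * t + real k * norm (psi t)"
            unfolding E_def using True by (intro norm_phi_power_diff_le) auto
          also have "\<dots> \<le> real k * t + real k * norm (psi t)" using k1 True by (intro add_right_mono mult_right_mono) auto
          finally have "norm (E t - phi t ^ k) \<le> real k * (t + norm (psi t))" by (simp add: algebra_simps)
          hence "(norm (E t - phi t ^ k))\<^sup>2 \<le> (real k * (t + norm (psi t)))\<^sup>2" by (intro power_mono) auto
          also have "\<dots> = (real k)\<^sup>2 * (t + norm (psi t))\<^sup>2" by (simp add: power_mult_distrib)
          also have "\<dots> \<le> (real k)\<^sup>2 * (C0 * h t)"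
          proof (rule mult_left_mono)
            have "(t + norm (psi t))\<^sup>2 \<le> 2 * t\<^sup>2 + 2 * (norm (psi t))\<^sup>2"
              using zero_le_power2[of "t - norm (psi t)"] by (simp add: power2_eq_square algebra_simps)
            also have "(norm (psi t))\<^sup>2 \<le> 2 * norm (psi t)"
              unfolding power2_eq_square using norm_psi_le_2[of t] by (intro mult_right_mono) auto
            finally have "(t + norm (psi t))\<^sup>2 \<le> 2 * t\<^sup>2 + 4 * norm (psi t)" by simp
            also have "\<dots> \<le> 2 * (C2 * h t) + 4 * (C1 * h t)" using psi sq by simp
            finally show "(t + norm (psi t))\<^sup>2 \<le> C0 * h t" by (simp add: C0_def algebra_simps)
          qed simp
          finally show "(norm (E t - phi t ^ k))\<^sup>2 \<le> (real k)\<^sup>2 * (C0 * h t)" .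
        qed simp
        finally show ?thesis using True by (simp add: mult_ac)
      qed simp
      have "marked_walk n k 2 - 2 * marked_walk n k 1 +
         walk_prob p n (n - 1) = span / pi * (\<integral>t. indicator {0..D} t * Re (A 2 t) -
           2 * (indicator {0..D} t * Re (A 1 t)) + indicator {0..D} t * Re (A 0 t) \<partial>lborel)"
      proof -
        have i1: "(\<integral>t. indicator {0..D} t * Re (A 2 t) -
           2 * (indicator {0..D} t * Re (A 1 t)) + indicator {0..D} t * Re (A 0 t) \<partial>lborel) =
          (\<integral>t. indicator {0..D} t * Re (A 2 t) \<partial>lborel) - 2 * (\<integral>t. indicator {0..D} t * Re (A 1 t) \<partial>lborel) +
          (\<integral>t. indicator {0..D} t * Re (A 0 t) \<partial>lborel)"
          by (simp only: Bochner_Integration.integral_add[OF Bochner_Integration.integrable_diff[OF iA integrable_mult_right[OF iA]] iA]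
            Bochner_Integration.integral_diff[OF iA integrable_mult_right[OF iA]] integral_mult_right_zero)
        have G0: "walk_prob p n (n - 1) = span / pi * (\<integral>t. indicator {0..D} t * Re (A 0 t) \<partial>lborel)"
          using GA[of 0] by simp
        show ?thesis unfolding i1 G0 GA[of 2, simplified] using GA[of 2] GA[of 1] by (simp add: algebra_simps)
      qed
      also have "\<dots> \<le> span / pi * ((real k)\<^sup>2 * C0 * (C3 * scale n / real n))"
      proof (rule mult_left_mono)
        have "(\<integral>t. indicator {0..D} t * Re (A 2 t) -
           2 * (indicator {0..D} t * Re (A 1 t)) + indicator {0..D} t * Re (A 0 t) \<partial>lborel) \<le>
           (\<integral>t. (real k)\<^sup>2 * C0 * (indicator {0..D} t * (norm (phi t) ^ m * h t)) \<partial>lborel)"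
          by (intro integral_mono Bochner_Integration.integrable_add Bochner_Integration.integrable_diff iA
              integrable_mult_right integrable_period_phi_h pt)
        also have "\<dots> = (real k)\<^sup>2 * C0 * (\<integral>t. indicator {0..D} t * (norm (phi t) ^ m * h t) \<partial>lborel)"
          by (rule integral_mult_right_zero)
        also have "\<dots> \<le> (real k)\<^sup>2 * C0 * (C3 * scale n / real n)"
          using elim n C0 by (intro mult_left_mono) auto
        finally show "(\<integral>t. indicator {0..D} t * Re (A 2 t) -
           2 * (indicator {0..D} t * Re (A 1 t)) + indicator {0..D} t * Re (A 0 t) \<partial>lborel) \<le>
           (real k)\<^sup>2 * C0 * (C3 * scale n / real n)" .
      qed simp
      also have "\<dots> \<le> span / pi * ((real k)\<^sup>2 * C0 * (C3 * (walk_prob p n (n - 1) / c) / real n))"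
      proof -
        have "scale n \<le> walk_prob p n (n - 1) / c" using elim k c(1) by (simp add: pos_le_divide_eq mult.commute)
        thus ?thesis using C0 C3(1) by (intro mult_left_mono divide_right_mono) auto
      qed
      also have "\<dots> = C * (real k)\<^sup>2 / real n * walk_prob p n (n - 1)"
        by (simp add: C_def mult_ac)
      finally show "marked_walk n k 2 - 2 * marked_walk n k 1 +
       walk_prob p n (n - 1) \<le> C * (real k)\<^sup>2 / real n * walk_prob p n (n - 1)" .
    qed
  qed
  moreover have "C > 0" using span_pos C0 C3(1) c(1) by (simp add: C_def)
  ultimately show ?thesis by blast
qed

lemma walk_prob_ge_inverse:
  "\<exists>c>0. \<forall>\<^sub>F n in sequentially. span dvd n - 1 \<longrightarrow> c / real n \<le> walk_prob p n (n - 1)"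
proof -
  obtain c where c: "c > 0" "\<forall>\<^sub>F n in sequentially. span dvd n - 1 \<longrightarrow> c * scale n \<le> walk_prob p n (n - 1)"
    using walk_prob_lower_bound by blast
  have "\<forall>\<^sub>F n in sequentially. span dvd n - 1 \<longrightarrow> (c / 2) / real n \<le> walk_prob p n (n - 1)"
    using c(2) scale_ge
  proof eventually_elim
    case (elim n)
    have "c * (1 / (2 * real n)) \<le> c * scale n" using elim c(1) by (intro mult_left_mono) auto
    thus ?case using elim by auto
  qed
  thus ?thesis using c(1) by (intro exI[of _ "c / 2"]) auto
qed

end

section \<open>Convergence in distribution from binomial moments\<close>

text \<open>Levy's theorem is about sequences; off \<open>S\<close> the laws may be replaced by the limit law.\<close>

lemma conv_in_distribution_char:
  fixes M :: "nat \<Rightarrow> real measure"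
  assumes M: "\<And>n. n \<in> S \<Longrightarrow> real_distribution (M n)" and M': "real_distribution M'"
    and char: "\<And>t. ((\<lambda>n. char (M n) t) \<longlongrightarrow> char M' t) (inf sequentially (principal S))"
  shows "conv_in_distribution M M' (inf sequentially (principal S))"
proof -
  define M2 where "M2 = (\<lambda>n. if n \<in> S then M n else M')"
  have "weak_conv_m M2 M'"
  proof (rule levy_continuity)
    show "real_distribution (M2 n)" for n using M M' by (simp add: M2_def)
    show "(\<lambda>n. char (M2 n) t) \<longlonglongrightarrow> char M' t" for t
    proof (rule tendstoI)
      fix e :: real assume "e > 0"
      hence "\<forall>\<^sub>F n in inf sequentially (principal S). dist (char (M n) t) (char M' t) < e"
        using char by (rule tendstoD[rotated])
      thus "\<forall>\<^sub>F n in sequentially. dist (char (M2 n) t) (char M' t) < e"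
        unfolding eventually_inf_principal by eventually_elim (use \<open>e > 0\<close> in \<open>auto simp: M2_def\<close>)
    qed
  qed fact
  hence conv: "(\<lambda>n. cdf (M2 n) x) \<longlonglongrightarrow> cdf M' x" if "isCont (cdf M') x" for x
    using that by (simp add: weak_conv_m_def weak_conv_def)
  show ?thesis unfolding conv_in_distribution_def
  proof (intro allI impI)
    fix x assume "isCont (cdf M') x"
    hence "((\<lambda>n. cdf (M2 n) x) \<longlongrightarrow> cdf M' x) (inf sequentially (principal S))"
      by (intro tendsto_mono[OF inf_le1] conv)
    moreover have "\<forall>\<^sub>F n in inf sequentially (principal S). cdf (M2 n) x = cdf (M n) x"
      by (simp add: eventually_inf_principal M2_def)
    ultimately show "((\<lambda>n. cdf (M n) x) \<longlongrightarrow> cdf M' x) (inf sequentially (principal S))"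
      by (rule Lim_transform_eventually)
  qed
qed

lemma real_distribution_distr_pmf: "real_distribution (distr (measure_pmf \<nu>) borel f)"
proof -
  have "prob_space (distr (measure_pmf \<nu>) borel f)"
    by (intro measure_pmf.prob_space_distr) simp
  thus ?thesis by (simp add: real_distribution_def real_distribution_axioms_def)
qed

lemma char_distr_pmf: "char (distr (measure_pmf \<nu>) borel f) t = measure_pmf.expectation \<nu> (\<lambda>x. exp (\<i> * (t * f x)))"
  unfolding char_def by (subst integral_distr) auto

text \<open>The coefficients are Stirling numbers times factorials; their values do not matter for passing from
  binomial to ordinary moments.\<close>

lemma binomial_coefficients_span_powers:
  "\<exists>c :: nat \<Rightarrow> real. \<forall>x :: nat. real x ^ r = (\<Sum>q\<le>r. c q * real (x choose q))"
proof (induction r)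
  case 0
  show ?case by (intro exI[of _ "\<lambda>_. 1"]) simp
next
  case (Suc r)
  then obtain c where c: "\<And>x :: nat. real x ^ r = (\<Sum>q\<le>r. c q * real (x choose q))" by blast
  \<comment> \<open>From \<open>x * (x choose q) = (q + 1) * (x choose (q + 1)) + q * (x choose q)\<close>.\<close>
  define c' where "c' = (\<lambda>q. (if q \<le> r then c q * real q else 0) + (if q = 0 then 0 else c (q - 1) * real q))"
  have step: "real x * real (x choose q) = real q * real (x choose q) + real (Suc q) * real (x choose Suc q)" for x q :: nat
  proof (cases "q \<le> x")
    case True
    have "Suc q * (x choose Suc q) = (x - q) * (x choose q)"
      using binomial_absorb_comp[of x q] Suc_times_binomial_add[of q "x - Suc q"] binomial_absorption[of q x]
      by (cases x) (auto simp: binomial_absorption mult.commute)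
    hence "real (Suc q) * real (x choose Suc q) = (real x - real q) * real (x choose q)"
      using True by (metis of_nat_diff of_nat_mult)
    thus ?thesis by (simp add: algebra_simps)
  qed (simp add: binomial_eq_0)
  show ?case
  proof (intro exI[of _ c'] allI)
    fix x :: nat
    have "real x ^ Suc r = (\<Sum>q\<le>r. c q * (real x * real (x choose q)))"
      by (simp add: c sum_distrib_left mult_ac)
    also have "\<dots> = (\<Sum>q\<le>r. c q * real q * real (x choose q)) + (\<Sum>q\<le>r. c q * real (Suc q) * real (x choose Suc q))"
      unfolding step by (simp add: sum.distrib algebra_simps)
    also have "(\<Sum>q\<le>r. c q * real q * real (x choose q)) = (\<Sum>q\<le>Suc r. (if q \<le> r then c q * real q else 0) * real (x choose q))"
      by simp
    also have "(\<Sum>q\<le>r. c q * real (Suc q) * real (x choose Suc q)) =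
       (\<Sum>q\<le>Suc r. (if q = 0 then 0 else c (q - 1) * real q) * real (x choose q))"
      by (subst sum.atMost_Suc_shift) simp
    finally show "real x ^ Suc r = (\<Sum>q\<le>Suc r. c' q * real (x choose q))"
      unfolding c'_def distrib_right sum.distrib .
  qed
qed

text \<open>An inequality of Bonferroni type. Pascal's rule reduces the remainder for \<open>N + 1\<close> to two remainders for \<open>N\<close>, and
  the factors \<open>1 + w\<close> do not enlarge it.\<close>

lemma binomial_expansion_remainder:
  fixes w :: complex
  assumes "norm (1 + w) \<le> 1"
  shows "norm ((1 + w) ^ N - (\<Sum>q<Q. of_nat (N choose q) * w ^ q)) \<le> real (N choose Q) * norm w ^ Q"
proof (induction N arbitrary: Q)
  case 0
  show ?case
  proof (cases Q)
    case (Suc Q')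
    have "(\<Sum>q<Suc Q'. of_nat (0 choose q) * w ^ q) = (1 :: complex)"
      unfolding lessThan_Suc_atMost by (subst sum.atMost_shift) simp
    thus ?thesis by (simp add: Suc del: sum.lessThan_Suc)
  qed simp
next
  case (Suc N)
  show ?case
  proof (cases Q)
    case 0
    show ?thesis using assms by (simp add: 0 norm_mult norm_power power_le_one mult_le_one)
  next
    case (Suc Q')
    have split: "(\<Sum>q<Suc Q'. of_nat (Suc N choose q) * w ^ q) =
       (\<Sum>q<Suc Q'. of_nat (N choose q) * w ^ q) + w * (\<Sum>q<Q'. of_nat (N choose q) * w ^ q)"
      unfolding sum.lessThan_Suc_shift by (simp add: sum.distrib sum_distrib_left algebra_simps)
    have "(1 + w) ^ Suc N - (\<Sum>q<Suc Q'. of_nat (Suc N choose q) * w ^ q) =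
       ((1 + w) ^ N - (\<Sum>q<Suc Q'. of_nat (N choose q) * w ^ q)) +
       w * ((1 + w) ^ N - (\<Sum>q<Q'. of_nat (N choose q) * w ^ q))"
      unfolding split by (simp add: algebra_simps)
    also have "norm \<dots> \<le> norm ((1 + w) ^ N - (\<Sum>q<Suc Q'. of_nat (N choose q) * w ^ q)) +
       norm (w * ((1 + w) ^ N - (\<Sum>q<Q'. of_nat (N choose q) * w ^ q)))"
      by (rule norm_triangle_ineq)
    also have "\<dots> \<le> real (N choose Suc Q') * norm w ^ Suc Q' + norm w * (real (N choose Q') * norm w ^ Q')"
      unfolding norm_mult[of w] by (intro add_mono mult_left_mono Suc.IH) auto
    also have "\<dots> = real (Suc N choose Suc Q') * norm w ^ Suc Q'" by (simp add: algebra_simps)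
    finally show ?thesis unfolding Suc .
  qed
qed

text \<open>Expand \<open>exp (i t x) = (1 + w) ^ x\<close> with \<open>w = exp (i t) - 1\<close>, where \<open>norm w \<le> 2\<close>, and stop at order \<open>Q\<close>.\<close>

lemma char_diff_le_binomial_moments:
  fixes \<nu> \<nu>' :: "nat pmf" and t :: real
  assumes int: "\<And>q. integrable \<nu> (\<lambda>x. real (x choose q))" "\<And>q. integrable \<nu>' (\<lambda>x. real (x choose q))"
  defines "B \<equiv> \<lambda>\<nu> q. measure_pmf.expectation \<nu> (\<lambda>x. real (x choose q))"
  shows "norm (measure_pmf.expectation \<nu> (\<lambda>x. exp (\<i> * (t * real x))) - measure_pmf.expectation \<nu>' (\<lambda>x. exp (\<i> * (t * real x)))) \<le>
     (\<Sum>q<Q. \<bar>B \<nu> q - B \<nu>' q\<bar> * 2 ^ q) + (B \<nu> Q + B \<nu>' Q) * 2 ^ Q"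
proof -
  define w where "w = exp (\<i> * t) - 1"
  have w1: "norm (1 + w) = 1" by (simp add: w_def)
  have w2: "norm w \<le> 2" using norm_triangle_ineq4[of "exp (\<i> * t)" 1] by (simp add: w_def)
  have e: "exp (\<i> * (t * real x)) = (1 + w) ^ x" for x :: nat
    by (simp add: w_def exp_of_nat_mult[symmetric] mult_ac)
  define S where "S = (\<lambda>x. \<Sum>q<Q. of_nat (x choose q) * w ^ q)"
  have intc: "integrable \<rho> (\<lambda>x. complex_of_nat (x choose q) * w ^ q)"
    if "\<And>q. integrable (measure_pmf \<rho>) (\<lambda>x. real (x choose q))" for \<rho> q
  proof -
    have "integrable \<rho> (\<lambda>x. complex_of_real (real (x choose q)) * w ^ q)"
      by (intro integrable_mult_left integrable_of_real that)
    thus ?thesis by simp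
  qed
  have one: "norm (measure_pmf.expectation \<rho> (\<lambda>x. exp (\<i> * (t * real x))) - (\<Sum>q<Q. of_real (B \<rho> q) * w ^ q)) \<le> B \<rho> Q * 2 ^ Q"
    if intr: "\<And>q. integrable (measure_pmf \<rho>) (\<lambda>x. real (x choose q))" for \<rho>
  proof -
    have intS: "integrable \<rho> S" unfolding S_def by (intro Bochner_Integration.integrable_sum intc intr)
    have intE: "integrable \<rho> (\<lambda>x. (1 + w) ^ x)"
      by (rule measure_pmf.integrable_const_bound[where B = 1]) (auto simp: norm_power w1)
    have "measure_pmf.expectation \<rho> S = (\<Sum>q<Q. measure_pmf.expectation \<rho> (\<lambda>x. complex_of_real (real (x choose q)) * w ^ q))"
      unfolding S_def by (subst Bochner_Integration.integral_sum) (auto intro!: intc intr)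
    also have "\<dots> = (\<Sum>q<Q. of_real (B \<rho> q) * w ^ q)"
      unfolding B_def by (intro sum.cong refl) (simp only: integral_mult_left_zero integral_complex_of_real)
    finally have "measure_pmf.expectation \<rho> (\<lambda>x. (1 + w) ^ x) - (\<Sum>q<Q. of_real (B \<rho> q) * w ^ q) =
       measure_pmf.expectation \<rho> (\<lambda>x. (1 + w) ^ x - S x)"
      using intE intS by simp
    also have "norm \<dots> \<le> measure_pmf.expectation \<rho> (\<lambda>x. norm ((1 + w) ^ x - S x))" by (rule integral_norm_bound)
    also have "\<dots> \<le> measure_pmf.expectation \<rho> (\<lambda>x. real (x choose Q) * 2 ^ Q)"
    proof (rule integral_mono)
      show "integrable \<rho> (\<lambda>x. norm ((1 + w) ^ x - S x))" using intE intS by simp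
      show "integrable \<rho> (\<lambda>x. real (x choose Q) * 2 ^ Q)" by (intro integrable_mult_left intr)
      fix x
      have "norm ((1 + w) ^ x - S x) \<le> real (x choose Q) * norm w ^ Q"
        unfolding S_def by (rule binomial_expansion_remainder) (simp add: w1)
      also have "\<dots> \<le> real (x choose Q) * 2 ^ Q" using w2 by (intro mult_left_mono power_mono) auto
      finally show "norm ((1 + w) ^ x - S x) \<le> real (x choose Q) * 2 ^ Q" .
    qed
    also have "\<dots> = B \<rho> Q * 2 ^ Q" by (simp add: B_def)
    finally show ?thesis by (simp only: e)
  qed
  let ?E = "\<lambda>\<rho>. measure_pmf.expectation \<rho> (\<lambda>x. exp (\<i> * (t * real x)))"
  let ?P = "\<lambda>\<rho>. \<Sum>q<Q. of_real (B \<rho> q) * w ^ q"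
  have "norm (?P \<nu> - ?P \<nu>') = norm (\<Sum>q<Q. of_real (B \<nu> q - B \<nu>' q) * w ^ q)"
    by (simp add: sum_subtractf algebra_simps)
  also have "\<dots> \<le> (\<Sum>q<Q. norm (of_real (B \<nu> q - B \<nu>' q) * w ^ q))" by (rule norm_sum)
  also have "\<dots> \<le> (\<Sum>q<Q. \<bar>B \<nu> q - B \<nu>' q\<bar> * 2 ^ q)"
    unfolding norm_mult norm_of_real norm_power using w2 by (intro sum_mono mult_left_mono power_mono) auto
  finally have "norm (?P \<nu> - ?P \<nu>') \<le> (\<Sum>q<Q. \<bar>B \<nu> q - B \<nu>' q\<bar> * 2 ^ q)" .
  moreover have "norm (?E \<nu> - ?E \<nu>') \<le> norm (?E \<nu> - ?P \<nu>) + norm (?P \<nu> - ?P \<nu>') + norm (?E \<nu>' - ?P \<nu>')"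
  proof -
    have "?E \<nu> - ?E \<nu>' = (?E \<nu> - ?P \<nu>) + (?P \<nu> - ?P \<nu>') - (?E \<nu>' - ?P \<nu>')" by simp
    thus ?thesis by (metis (no_types, lifting) add_right_mono norm_triangle_ineq norm_triangle_ineq4 order_trans)
  qed
  ultimately show ?thesis using one[OF int(1)] one[OF int(2)] by (simp add: algebra_simps)
qed

abbreviation Po :: "real \<Rightarrow> nat pmf" where
  "Po \<mu> \<equiv> (if \<mu> = 0 then return_pmf 0 else poisson_pmf \<mu>)"

lemma Poisson_binomial_moments:
  assumes "\<mu> \<ge> 0"
  shows "integrable (Po \<mu>) (\<lambda>x. real (x choose q))"
    and "measure_pmf.expectation (Po \<mu>) (\<lambda>x. real (x choose q)) = \<mu> ^ q / fact q"
proof -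
  have "has_bochner_integral (measure_pmf (Po \<mu>)) (\<lambda>x. real (x choose q)) (\<mu> ^ q / fact q)"
  proof (cases "\<mu> = 0")
    case True
    thus ?thesis by (cases q) (auto simp: has_bochner_integral_iff integrable_measure_pmf_finite)
  next
    case False
    hence \<mu>: "\<mu> > 0" using assms by simp
    have "(\<lambda>k. \<mu> ^ k / fact k) sums exp \<mu>"
      using exp_converges[of \<mu>] by (simp add: divide_inverse mult.commute)
    hence "(\<lambda>k. (\<mu> ^ q / fact q * exp (- \<mu>)) * (\<mu> ^ k / fact k)) sums ((\<mu> ^ q / fact q * exp (- \<mu>)) * exp \<mu>)"
      by (rule sums_mult)
    also have "(\<lambda>k. (\<mu> ^ q / fact q * exp (- \<mu>)) * (\<mu> ^ k / fact k)) =
        (\<lambda>k. pmf (poisson_pmf \<mu>) (k + q) * real (k + q choose q))"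
    proof
      fix k
      have "real (k + q choose q) = fact (k + q) / (fact q * fact k)"
        by (simp add: binomial_fact)
      thus "(\<mu> ^ q / fact q * exp (- \<mu>)) * (\<mu> ^ k / fact k) = pmf (poisson_pmf \<mu>) (k + q) * real (k + q choose q)"
        using \<mu> by (simp add: power_add mult_ac)
    qed
    also have "(\<mu> ^ q / fact q * exp (- \<mu>)) * exp \<mu> = \<mu> ^ q / fact q"
      by (simp add: exp_minus)
    finally have "(\<lambda>k. pmf (poisson_pmf \<mu>) (k + q) * real (k + q choose q)) sums (\<mu> ^ q / fact q)" .
    hence sums: "(\<lambda>k. pmf (poisson_pmf \<mu>) k * real (k choose q)) sums (\<mu> ^ q / fact q)"
      by (subst (asm) sums_zero_iff_shift) auto
    have "(\<integral>\<^sup>+x. ennreal (real (x choose q)) \<partial>measure_pmf (poisson_pmf \<mu>)) = (\<Sum>k. ennreal (pmf (poisson_pmf \<mu>) k * real (k choose q)))"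
      by (simp add: nn_integral_measure_pmf nn_integral_count_space_nat ennreal_mult)
    also have "\<dots> = ennreal (\<mu> ^ q / fact q)"
      using sums by (subst suminf_ennreal2) (auto simp: sums_iff)
    finally show ?thesis using False \<mu>
      by (intro has_bochner_integral_nn_integral) auto
  qed
  thus "integrable (Po \<mu>) (\<lambda>x. real (x choose q))"
    "measure_pmf.expectation (Po \<mu>) (\<lambda>x. real (x choose q)) = \<mu> ^ q / fact q"
    by (auto simp: has_bochner_integral_iff)
qed

text \<open>In the bound by binomial moments the remainder of order \<open>Q\<close> tends to \<open>2 * (2 * \<mu>) ^ Q / fact Q\<close>, which is small
  for large \<open>Q\<close>; the finitely many other terms vanish.\<close>

lemma Poisson_convergence:
  fixes \<nu> :: "nat \<Rightarrow> nat pmf"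
  assumes \<mu>: "\<mu> \<ge> 0" and fin: "\<And>n. n \<in> S \<Longrightarrow> finite (set_pmf (\<nu> n))"
    and lim: "\<And>q. ((\<lambda>n. measure_pmf.expectation (\<nu> n) (\<lambda>x. real (x choose q))) \<longlongrightarrow> \<mu> ^ q / fact q)
      (inf sequentially (principal S))"
  shows "conv_in_distribution (\<lambda>n. distr (\<nu> n) borel real) (poisson_law \<mu>) (inf sequentially (principal S))"
    and "conv_of_moments (\<lambda>n. distr (\<nu> n) borel real) (poisson_law \<mu>) (inf sequentially (principal S))"
proof -
  let ?F = "inf sequentially (principal S)"
  define B where "B = (\<lambda>\<nu> q. measure_pmf.expectation \<nu> (\<lambda>x :: nat. real (x choose q)))"
  have BP: "B (Po \<mu>) q = \<mu> ^ q / fact q" for q using Poisson_binomial_moments(2)[OF \<mu>] by (simp add: B_def)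
  have lim': "((\<lambda>n. B (\<nu> n) q) \<longlongrightarrow> B (Po \<mu>) q) ?F" for q unfolding BP using lim by (simp add: B_def)
  have int: "integrable (\<nu> n) (\<lambda>x. real (x choose q))" if "n \<in> S" for n q
    by (intro integrable_measure_pmf_finite fin that)
  show "conv_in_distribution (\<lambda>n. distr (\<nu> n) borel real) (poisson_law \<mu>) ?F"
    unfolding poisson_law_def
  proof (rule conv_in_distribution_char)
    fix t
    show "((\<lambda>n. char (distr (\<nu> n) borel real) t) \<longlongrightarrow> char (distr (Po \<mu>) borel real) t) ?F"
    proof (rule tendstoI)
      fix e :: real assume e: "e > 0"
      have "(\<lambda>Q. 2 * ((2 * \<mu>) ^ Q / fact Q)) \<longlonglongrightarrow> 2 * 0"
        using summable_LIMSEQ_zero[OF summable_exp[of "2 * \<mu>"]]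
        by (intro tendsto_mult tendsto_const) (simp add: divide_inverse mult.commute)
      hence "\<forall>\<^sub>F Q in sequentially. 2 * ((2 * \<mu>) ^ Q / fact Q) < e" using e by (intro order_tendstoD) auto
      then obtain Q where Q: "2 * ((2 * \<mu>) ^ Q / fact Q) < e" by (auto simp: eventually_sequentially)
      have "((\<lambda>n. (\<Sum>q<Q. \<bar>B (\<nu> n) q - B (Po \<mu>) q\<bar> * 2 ^ q) + (B (\<nu> n) Q + B (Po \<mu>) Q) * 2 ^ Q) \<longlongrightarrow>
         (\<Sum>q<Q. \<bar>B (Po \<mu>) q - B (Po \<mu>) q\<bar> * 2 ^ q) + (B (Po \<mu>) Q + B (Po \<mu>) Q) * 2 ^ Q) ?F"
        by (intro tendsto_intros lim')
      also have "(\<Sum>q<Q. \<bar>B (Po \<mu>) q - B (Po \<mu>) q\<bar> * 2 ^ q) + (B (Po \<mu>) Q + B (Po \<mu>) Q) * 2 ^ Q = 2 * ((2 * \<mu>) ^ Q / fact Q)"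
        unfolding BP by (simp add: power_mult_distrib)
      finally have "\<forall>\<^sub>F n in ?F. (\<Sum>q<Q. \<bar>B (\<nu> n) q - B (Po \<mu>) q\<bar> * 2 ^ q) + (B (\<nu> n) Q + B (Po \<mu>) Q) * 2 ^ Q < e"
        using Q by (rule order_tendstoD)
      moreover have "\<forall>\<^sub>F n in ?F. n \<in> S" by (simp add: eventually_inf_principal)
      ultimately show "\<forall>\<^sub>F n in ?F. dist (char (distr (\<nu> n) borel real) t) (char (distr (Po \<mu>) borel real) t) < e"
      proof eventually_elim
        case (elim n)
        show ?case unfolding char_distr_pmf dist_norm
          using char_diff_le_binomial_moments[of "\<nu> n" "Po \<mu>" t Q, OF int[OF elim(2)] Poisson_binomial_moments(1)[OF \<mu>]] elim(1)
          unfolding B_def by linarith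
      qed
    qed
  qed (auto intro: real_distribution_distr_pmf)
  show "conv_of_moments (\<lambda>n. distr (\<nu> n) borel real) (poisson_law \<mu>) ?F"
    unfolding conv_of_moments_def poisson_law_def
  proof
    fix r :: nat
    obtain c where c: "\<And>x :: nat. real x ^ r = (\<Sum>q\<le>r. c q * real (x choose q))"
      using binomial_coefficients_span_powers by blast
    have mom: "(\<integral>x. x ^ r \<partial>distr (measure_pmf \<rho>) borel real) = (\<Sum>q\<le>r. c q * B \<rho> q)"
      if "\<And>q. integrable (measure_pmf \<rho>) (\<lambda>x. real (x choose q))" for \<rho>
      by (subst integral_distr) (auto simp: c B_def that)
    have "((\<lambda>n. \<Sum>q\<le>r. c q * B (\<nu> n) q) \<longlongrightarrow> (\<Sum>q\<le>r. c q * B (Po \<mu>) q)) ?F"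
      by (intro tendsto_intros lim')
    moreover have "\<forall>\<^sub>F n in ?F. (\<Sum>q\<le>r. c q * B (\<nu> n) q) = (\<integral>x. x ^ r \<partial>distr (\<nu> n) borel real)"
      unfolding eventually_inf_principal by (intro always_eventually allI impI mom[symmetric] int)
    ultimately show "((\<lambda>n. \<integral>x. x ^ r \<partial>distr (\<nu> n) borel real) \<longlongrightarrow> (\<integral>x. x ^ r \<partial>distr (Po \<mu>) borel real)) ?F"
      unfolding mom[OF Poisson_binomial_moments(1)[OF \<mu>]] by (rule Lim_transform_eventually)
  qed
qed

section \<open>The Poisson limit\<close>

context critical_regular begin

lemma pmf_bound: "\<exists>\<rho>. 0 < \<rho> \<and> \<rho> < 1 \<and> (\<forall>i. pmf p i \<le> \<rho>)"
proof -
  have two: "pmf p 0 + pmf p i \<le> 1" if "i \<noteq> 0" for i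
  proof -
    have "(\<Sum>j\<in>{0, i}. pmf p j) \<le> (\<Sum>j. pmf p j)"
      using sums_summable[OF sums_pmf] by (intro sum_le_suminf) auto
    thus ?thesis using that sums_pmf by (simp add: sums_iff)
  qed
  obtain i where i: "i \<ge> 2" "pmf p i > 0" using p2 by blast
  have "pmf p 0 < 1" using two[of i] i by simp
  moreover have "pmf p j \<le> max (pmf p 0) (1 - pmf p 0)" for j
    using two[of j] by (cases "j = 0") auto
  ultimately show ?thesis using p0 by (intro exI[of _ "max (pmf p 0) (1 - pmf p 0)"]) auto
qed

lemma size_prob_pos_imp:
  assumes "size_prob p n > 0"
  shows "n > 0" "span dvd n - 1" "walk_prob p n (n - 1) > 0"
proof -
  have "trees_of_size 0 = {}"
    using tree_size_pos by (auto simp: trees_of_size_def intro: gr_implies_not0)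
  thus n: "n > 0" using assms by (cases n) (auto simp: size_prob_def)
  show w: "walk_prob p n (n - 1) > 0" using assms n by (simp add: size_prob_eq zero_less_divide_iff)
  show "span dvd n - 1" using w walk_prob_eq_0[of "n - 1" n] by auto
qed

lemma size_prob_ge:
  "\<exists>c>0. \<forall>\<^sub>F n in sequentially. span dvd n - 1 \<longrightarrow> c / (real n)\<^sup>2 \<le> size_prob p n"
proof -
  obtain c where c: "c > 0" "\<forall>\<^sub>F n in sequentially. span dvd n - 1 \<longrightarrow> c / real n \<le> walk_prob p n (n - 1)"
    using walk_prob_ge_inverse by blast
  have "\<forall>\<^sub>F n in sequentially. span dvd n - 1 \<longrightarrow> c / (real n)\<^sup>2 \<le> size_prob p n"
    using c(2) eventually_gt_at_top[of 0]
  proof eventually_elim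
    case (elim n)
    show ?case
    proof
      assume "span dvd n - 1"
      hence "c / real n / real n \<le> walk_prob p n (n - 1) / real n" using elim by (intro divide_right_mono) auto
      thus "c / (real n)\<^sup>2 \<le> size_prob p n" using elim by (simp add: size_prob_eq power2_eq_square)
    qed
  qed
  thus ?thesis using c(1) by blast
qed

lemma marked_factor_eq:
  assumes "size_prob p n > 0"
  shows "marked_factor p k n q = (if q * k \<le> n then real n * (real (n - q * k + q choose q) / real (n - q * k + q)) *
     (marked_walk n k q / walk_prob p n (n - 1)) else 0)"
  using size_prob_pos_imp[OF assms] by (simp add: marked_factor_def size_prob_eq)

text \<open>The quantity \<open>P\<close> is a product of \<open>q - 1\<close> factors, each between \<open>1 - q * k / n\<close> and 1, so Bernoulli's inequality
  applies.\<close>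

lemma falling_product_bounds:
  assumes "n > 0" "q > 0" "k > 0" "q * k \<le> n"
  defines "L \<equiv> n - q * k + q"
  defines "P \<equiv> real n * (real (L choose q) / real L) * fact q / real n ^ q"
  shows "0 \<le> P" "P \<le> 1" "1 - P \<le> (real q)\<^sup>2 * real k / real n"
proof -
  have "q \<le> q * k" using assms by simp
  hence L: "L \<le> n" "L \<ge> q" "L > 0" using assms(2,4) unfolding L_def by linarith+
  obtain q' where q': "q = Suc q'" using assms by (cases q) auto
  have "(L choose q) * fact q = L * (\<Prod>i=1..q'. L - i)"
  proof -
    have "real (L choose q) * fact q = (\<Prod>i=0..<q. real (L - i))"
      using L by (simp add: binomial_gbinomial gbinomial_prod_rev of_nat_diff)
    also have "\<dots> = real L * (\<Prod>i=1..q'. real (L - i))"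
      unfolding q' by (subst prod.atLeast0_lessThan_Suc_shift) (simp add: prod.atLeast1_atMost_eq atLeast0LessThan)
    finally have "real ((L choose q) * fact q) = real (L * (\<Prod>i=1..q'. L - i))" by simp
    thus ?thesis by (simp only: of_nat_eq_iff)
  qed
  hence "real (L choose q) * fact q = real L * (\<Prod>i=1..q'. real (L - i))"
    by (metis of_nat_fact of_nat_mult of_nat_prod)
  hence "P = real n * (\<Prod>i=1..q'. real (L - i)) / real n ^ q"
    using L unfolding P_def by (simp add: field_simps)
  also have "\<dots> = (\<Prod>i=1..q'. real (L - i)) / real n ^ q'" using assms by (simp add: q')
  also have "\<dots> = (\<Prod>i=1..q'. real (L - i) / real n)" by (simp add: prod_dividef)
  finally have P: "P = (\<Prod>i=1..q'. real (L - i) / real n)" .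
  show "0 \<le> P" unfolding P by (intro prod_nonneg) auto
  show "P \<le> 1" unfolding P using L assms by (intro prod_le_1) (auto simp: field_simps)
  have fac: "1 - real (q * k) / real n \<le> real (L - i) / real n" if "i \<in> {1..q'}" for i
  proof -
    have "real n - real (q * k) \<le> real (L - i)" using that L assms q' by (auto simp: L_def of_nat_diff)
    hence "(real n - real (q * k)) / real n \<le> real (L - i) / real n" by (intro divide_right_mono) auto
    thus ?thesis using assms by (simp add: diff_divide_distrib)
  qed
  have x: "0 \<le> 1 - real (q * k) / real n" using assms by (simp add: field_simps flip: of_nat_mult)
  have "1 + real q' * (- (real (q * k) / real n)) \<le> (1 + (- (real (q * k) / real n))) ^ q'"
    using x by (intro Bernoulli_inequality) auto
  also have "\<dots> = (\<Prod>i=1..q'. 1 - real (q * k) / real n)" by simp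
  also have "\<dots> \<le> P" unfolding P using x fac by (intro prod_mono) auto
  finally have "1 - P \<le> real q' * (real (q * k) / real n)" by simp
  also have "\<dots> \<le> real q * (real (q * k) / real n)" by (intro mult_right_mono) (auto simp: q')
  finally show "1 - P \<le> (real q)\<^sup>2 * real k / real n" by (simp add: power2_eq_square)
qed

text \<open>For trees that are small compared with \<open>n\<close>, the binomial moments are those of a Poisson law up to a relative
  error of order \<open>k / sqrt n\<close>.\<close>

lemma marked_factor_asymptotics:
  assumes q: "q > 0"
  shows "\<exists>C>0. \<forall>\<^sub>F n in sequentially. \<forall>k. k > 0 \<longrightarrow> k ^ 4 \<le> n \<longrightarrow> span dvd k - 1 \<longrightarrow> size_prob p n > 0 \<longrightarrow>
     \<bar>marked_factor p k n q * fact q / real n ^ q - 1\<bar> \<le> C * real k / sqrt (real n)"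
proof -
  obtain C where C: "C > 0" "\<forall>\<^sub>F n in sequentially. \<forall>q k. k > 0 \<longrightarrow> 2 * (q * k) \<le> n \<longrightarrow> span dvd n - 1 \<longrightarrow> span dvd k - 1 \<longrightarrow>
     \<bar>marked_walk n k q - walk_prob p n (n - 1)\<bar> \<le>
       C * real (q * k) / sqrt (real n) * walk_prob p n (n - 1)" using walk_prob_marked_diff by blast
  define C' where "C' = C * real q + (real q)\<^sup>2"
  have "\<forall>\<^sub>F n in sequentially. \<forall>k. k > 0 \<longrightarrow> k ^ 4 \<le> n \<longrightarrow> span dvd k - 1 \<longrightarrow> size_prob p n > 0 \<longrightarrow>
     \<bar>marked_factor p k n q * fact q / real n ^ q - 1\<bar> \<le> C' * real k / sqrt (real n)"
    using C(2) eventually_ge_at_top[of "4 * q\<^sup>2"]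
  proof eventually_elim
    case (elim n)
    show ?case
    proof (intro allI impI)
      fix k assume k: "k > 0" "k ^ 4 \<le> n" "span dvd k - 1" "size_prob p n > 0"
      note n = size_prob_pos_imp[OF k(4)]
      have small: "2 * (q * k) \<le> n"
      proof (cases "k \<ge> 2 * q")
        case True
        have "2 * (q * k) \<le> k * k" using True by (metis mult.assoc mult_le_mono1)
        also have "\<dots> = k ^ 2" by (simp add: power2_eq_square)
        also have "\<dots> \<le> k ^ 4" using k(1) by (intro power_increasing) auto
        finally show ?thesis using k(2) by simp
      next
        case False
        hence "2 * (q * k) \<le> 2 * (q * (2 * q))" by (intro mult_le_mono2) auto
        also have "\<dots> = 4 * q\<^sup>2" by (simp add: power2_eq_square)
        also have "\<dots> \<le> n" by (rule elim(2))
        finally show ?thesis .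
      qed
      hence qk: "q * k \<le> n" by simp
      define L where "L = n - q * k + q"
      define P where "P = real n * (real (L choose q) / real L) * fact q / real n ^ q"
      define R where "R = marked_walk n k q / walk_prob p n (n - 1)"
      have P: "0 \<le> P" "P \<le> 1" "1 - P \<le> (real q)\<^sup>2 * real k / real n"
        using falling_product_bounds[OF n(1) q k(1) qk] unfolding P_def L_def by auto
      have eq: "marked_factor p k n q * fact q / real n ^ q = P * R"
        unfolding marked_factor_eq[OF k(4)] P_def R_def L_def using qk by (simp add: mult_ac)
      have "\<bar>R - 1\<bar> = \<bar>marked_walk n k q - walk_prob p n (n - 1)\<bar> / walk_prob p n (n - 1)"
        using n(3) by (simp add: R_def diff_divide_distrib[symmetric] abs_divide field_simps)
      also have "\<dots> \<le> (C * real (q * k) / sqrt (real n) * walk_prob p n (n - 1)) / walk_prob p n (n - 1)"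
        using elim k small n by (intro divide_right_mono) auto
      also have "\<dots> = C * real q * real k / sqrt n" using n(3) by simp
      finally have R: "\<bar>R - 1\<bar> \<le> C * real q * real k / sqrt n" .
      have "sqrt (real n) * 1 \<le> sqrt (real n) * sqrt (real n)" using n(1) by (intro mult_left_mono) auto
      hence "sqrt n \<le> n" by simp
      hence "(real q)\<^sup>2 * real k / real n \<le> (real q)\<^sup>2 * real k / sqrt n" using n(1) by (intro divide_left_mono) auto
      hence P': "\<bar>P - 1\<bar> \<le> (real q)\<^sup>2 * real k / sqrt n" using P by simp
      have "\<bar>P * R - 1\<bar> = \<bar>P * (R - 1) + (P - 1)\<bar>" by (simp add: algebra_simps)
      also have "\<dots> \<le> P * \<bar>R - 1\<bar> + \<bar>P - 1\<bar>" using P(1) by (metis abs_mult abs_of_nonneg abs_triangle_ineq)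
      also have "\<dots> \<le> 1 * (C * real q * real k / sqrt n) + (real q)\<^sup>2 * real k / sqrt n"
        using P R P' by (intro add_mono mult_mono) auto
      also have "\<dots> = C' * real k / sqrt n" by (simp add: C'_def add_divide_distrib algebra_simps)
      finally show "\<bar>marked_factor p k n q * fact q / real n ^ q - 1\<bar> \<le> C' * real k / sqrt (real n)" by (simp add: eq)
    qed
  qed
  moreover have "C' > 0" using C(1) q by (simp add: C'_def add_pos_pos)
  ultimately show ?thesis by blast
qed

text \<open>For larger trees a polynomial bound is sufficient, since their weight decays exponentially in the size.\<close>

lemma marked_factor_crude:
  "\<exists>C>0. \<forall>\<^sub>F n in sequentially. \<forall>k. k > 0 \<longrightarrow> size_prob p n > 0 \<longrightarrow>
     \<bar>marked_factor p k n q\<bar> \<le> C * real n ^ (q + 2)"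
proof -
  obtain c where c: "c > 0" "\<forall>\<^sub>F n in sequentially. span dvd n - 1 \<longrightarrow> c / (real n)\<^sup>2 \<le> size_prob p n"
    using size_prob_ge by blast
  have "\<forall>\<^sub>F n in sequentially. \<forall>k. k > 0 \<longrightarrow> size_prob p n > 0 \<longrightarrow> \<bar>marked_factor p k n q\<bar> \<le> (1 / c) * real n ^ (q + 2)"
    using c(2)
  proof eventually_elim
    case (elim n)
    show ?case
    proof (intro allI impI)
      fix k :: nat assume k: "k > 0" "size_prob p n > 0"
      note n = size_prob_pos_imp[OF k(2)]
      show "\<bar>marked_factor p k n q\<bar> \<le> (1 / c) * real n ^ (q + 2)"
      proof (cases "q * k \<le> n")
        case True
        define L where "L = n - q * k + q"
        have "q \<le> q * k" using k by simp
        moreover have "n > 0 \<Longrightarrow> n - q * k + q > 0" using k True by (cases "q = 0") auto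
        ultimately have L: "L \<le> n" "L > 0" using True n(1) unfolding L_def by linarith+
        have "L choose q \<le> L ^ q" by (rule binomial_le_pow) (simp add: L_def)
        also have "\<dots> \<le> n ^ q" using L by (intro power_mono) auto
        finally have "real (L choose q) \<le> real n ^ q" by (simp flip: of_nat_power)
        hence "real (L choose q) / real L \<le> real n ^ q / 1" using L by (intro frac_le) auto
        hence b: "real (L choose q) / real L \<le> real n ^ q" by simp
        have s: "c / (real n)\<^sup>2 \<le> size_prob p n" using elim n by simp
        have mf: "marked_factor p k n q = real (L choose q) / real L * walk_prob p (n - q * k) (L - 1) / size_prob p n"
          using True unfolding marked_factor_def L_def by (simp only: if_True)
        have "marked_factor p k n q \<ge> 0" unfolding mf
          by (intro divide_nonneg_nonneg mult_nonneg_nonneg walk_prob_nonneg size_prob_nonneg) auto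
        hence "\<bar>marked_factor p k n q\<bar> = real (L choose q) / real L * walk_prob p (n - q * k) (L - 1) / size_prob p n"
          by (simp only: mf abs_of_nonneg)
        also have "\<dots> \<le> (real n ^ q * 1) / (c / (real n)\<^sup>2)"
          using c(1) n s by (intro frac_le mult_mono b walk_prob_le_1 walk_prob_nonneg) auto
        also have "\<dots> = (1 / c) * real n ^ (q + 2)" by (simp add: power_add power2_eq_square)
        finally show ?thesis .
      next
        case False
        thus ?thesis using c(1) by (simp add: marked_factor_def)
      qed
    qed
  qed
  thus ?thesis using c(1) by (intro exI[of _ "1 / c"]) auto
qed

lemma gw_sizes_eq: "gw_sizes p = inf sequentially (principal {n. size_prob p n > 0})"
  by (simp add: gw_sizes_def measure_gw_size_event)

lemma finite_set_conditioned_gw_pmf: "size_prob p n > 0 \<Longrightarrow> finite (set_pmf (conditioned_gw_pmf p n))"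
  using finite_subset[OF set_conditioned_gw_pmf] by blast

lemma expectation_fringe_count_choose:
  assumes "size_prob p n > 0"
  shows "measure_pmf.expectation (conditioned_gw_pmf p n) (\<lambda>t. real (fringe_count T t choose q)) =
    tree_weight p T ^ q * marked_factor p (tree_size T) n q"
proof -
  have "measure_pmf.expectation (conditioned_gw_pmf p n) (\<lambda>t. real (fringe_number {T} t choose q)) =
    (\<Sum>T\<in>{T}. tree_weight p T) ^ q * marked_factor p (tree_size T) n q"
    by (rule expectation_fringe_number_choose) (use assms tree_size_pos in auto)
  thus ?thesis by (simp add: fringe_count_eq)
qed

lemma quartic_root_bounds:
  fixes k n :: nat
  shows "k ^ 4 \<le> n \<Longrightarrow> real k \<le> real n powr (1 / 4)" "\<not> k ^ 4 \<le> n \<Longrightarrow> real n powr (1 / 4) \<le> real k"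
proof -
  have k4: "real k = real (k ^ 4) powr (1 / 4)"
  proof (cases "k = 0")
    case False
    hence "real (k ^ 4) = real k powr 4" by (simp add: powr_numeral)
    thus ?thesis using False by (simp only: powr_powr) simp
  qed simp
  show "real k \<le> real n powr (1 / 4)" if "k ^ 4 \<le> n"
    unfolding k4 using that by (intro powr_mono2 of_nat_mono) auto
  show "real n powr (1 / 4) \<le> real k" if "\<not> k ^ 4 \<le> n"
    unfolding k4 using that by (intro powr_mono2 of_nat_mono) auto
qed

text \<open>Sizes \<open>k\<close> with \<open>k ^ 4 \<le> n\<close> are covered by \<open>marked_factor_asymptotics\<close>. For the others the binomial moment and
  its candidate limit are both exponentially small in \<open>n powr (1 / 4)\<close>. The exponent 4 is an arbitrary choice with
  \<open>k / sqrt n\<close> still vanishing.\<close>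

lemma binomial_moment_limit:
  assumes lim: "((\<lambda>n. real n * tree_weight p (T n)) \<longlongrightarrow> \<mu>) (gw_sizes p)"
  shows "((\<lambda>n. measure_pmf.expectation (conditioned_gw_pmf p n) (\<lambda>t. real (fringe_count (T n) t choose q)))
     \<longlongrightarrow> \<mu> ^ q / fact q) (gw_sizes p)"
proof (cases "q = 0")
  case True
  thus ?thesis by simp
next
  case False
  hence q: "q > 0" by simp
  obtain \<rho> where \<rho>: "0 < \<rho>" "\<rho> < 1" "\<And>i. pmf p i \<le> \<rho>" using pmf_bound by blast
  define l where "l = ln \<rho>"
  have l: "l < 0" using \<rho> by (simp add: l_def)
  obtain C where C: "C > 0" "\<forall>\<^sub>F n in sequentially. \<forall>k. k > 0 \<longrightarrow> k ^ 4 \<le> n \<longrightarrow> span dvd k - 1 \<longrightarrow> size_prob p n > 0 \<longrightarrow>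
     \<bar>marked_factor p k n q * fact q / real n ^ q - 1\<bar> \<le> C * real k / sqrt (real n)"
    using marked_factor_asymptotics[OF q] by blast
  obtain C' where C': "C' > 0" "\<forall>\<^sub>F n in sequentially. \<forall>k. k > 0 \<longrightarrow> size_prob p n > 0 \<longrightarrow>
     \<bar>marked_factor p k n q\<bar> \<le> C' * real n ^ (q + 2)"
    using marked_factor_crude by blast
  let ?F = "gw_sizes p"
  define E where "E = (\<lambda>n. measure_pmf.expectation (conditioned_gw_pmf p n) (\<lambda>t. real (fringe_count (T n) t choose q)))"
  define x where "x = (\<lambda>n. real n * tree_weight p (T n))"
  define B where "B = (\<lambda>n. C * (real n powr (1 / 4) / sqrt (real n)) * x n ^ q +
      (C' * real n ^ (q + 2) + real n ^ q) * exp (l * real n powr (1 / 4)))"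
  have bound: "\<forall>\<^sub>F n in ?F. norm (E n - x n ^ q / fact q) \<le> B n"
    unfolding gw_sizes_eq eventually_inf_principal using C(2) C'(2) eventually_gt_at_top[of 0]
  proof eventually_elim
    case (elim n)
    show ?case
    proof
      assume "n \<in> {n. size_prob p n > 0}"
      hence s: "size_prob p n > 0" by simp
      define k where "k = tree_size (T n)"
      define \<pi> where "\<pi> = tree_weight p (T n)"
      have \<pi>0: "\<pi> \<ge> 0" by (simp add: \<pi>_def tree_weight_nonneg)
      have k0: "k > 0" by (simp add: k_def tree_size_pos)
      have En: "E n = \<pi> ^ q * marked_factor p k n q"
        unfolding E_def \<pi>_def k_def by (rule expectation_fringe_count_choose[OF s])
      have xn: "x n ^ q = real n ^ q * \<pi> ^ q" by (simp add: x_def \<pi>_def power_mult_distrib)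
      have B1: "0 \<le> C * (real n powr (1 / 4) / sqrt (real n)) * x n ^ q"
        using C(1) \<pi>0 by (auto simp: xn)
      have B2: "0 \<le> (C' * real n ^ (q + 2) + real n ^ q) * exp (l * real n powr (1 / 4))"
        using C'(1) by auto
      consider "\<pi> = 0" | "\<pi> > 0" "k ^ 4 \<le> n" | "\<not> k ^ 4 \<le> n" using \<pi>0 by fastforce
      thus "norm (E n - x n ^ q / fact q) \<le> B n"
      proof cases
        case 1
        have "\<pi> ^ q = 0" using 1 q by simp
        hence "E n - x n ^ q / fact q = 0"
          by (simp only: En xn mult_zero_left mult_zero_right div_0 diff_0_right)
        moreover have "B n \<ge> 0" unfolding B_def using B1 B2 by (rule add_nonneg_nonneg)
        ultimately show ?thesis by (simp only: norm_zero)
      next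
        case 2
        \<comment> \<open>A tree of positive weight has a size that the walk can attain, which is what the
          asymptotics require of \<open>k\<close>.\<close>
        have "span dvd k - 1"
          unfolding k_def using 2(1) span_dvd by (intro dvd_tree_size_minus_1[of p]) (auto simp: \<pi>_def)
        hence "\<bar>marked_factor p k n q * fact q / real n ^ q - 1\<bar> \<le> C * real k / sqrt (real n)"
          using elim s 2 k0 by blast
        also have "\<dots> \<le> C * real n powr (1 / 4) / sqrt (real n)"
          using quartic_root_bounds(1)[OF 2(2)] C(1) by (intro divide_right_mono mult_left_mono) auto
        finally have *: "\<bar>marked_factor p k n q * fact q / real n ^ q - 1\<bar> \<le> C * (real n powr (1 / 4) / sqrt (real n))" by simp
        have "E n - x n ^ q / fact q = (x n ^ q / fact q) * (marked_factor p k n q * fact q / real n ^ q - 1)"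
          using elim by (simp add: En xn field_simps)
        hence "norm (E n - x n ^ q / fact q) = (x n ^ q / fact q) * \<bar>marked_factor p k n q * fact q / real n ^ q - 1\<bar>"
          using \<pi>0 by (simp add: abs_mult xn)
        also have "\<dots> \<le> x n ^ q * (C * (real n powr (1 / 4) / sqrt (real n)))"
        proof (rule mult_mono[OF _ *])
          have "x n ^ q / fact q \<le> x n ^ q / 1" using \<pi>0 by (intro divide_left_mono) (auto simp: xn)
          thus "x n ^ q / fact q \<le> x n ^ q" by simp
        qed (use \<pi>0 in \<open>auto simp: xn\<close>)
        finally show ?thesis using B2 by (simp add: B_def mult_ac)
      next
        case 3
        have "\<pi> \<le> \<rho> ^ k" unfolding \<pi>_def k_def by (rule tree_weight_le_power[OF \<rho>(3)])
        also have "\<dots> = exp (l * real k)" using \<rho> by (simp add: l_def exp_of_nat2_mult)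
        also have "\<dots> \<le> exp (l * real n powr (1 / 4))"
          using quartic_root_bounds(2)[OF 3] l by simp
        finally have \<pi>e: "\<pi> \<le> exp (l * real n powr (1 / 4))" .
        have "exp (l * real n powr (1 / 4)) \<le> 1" using l by (simp add: mult_nonpos_nonneg)
        hence "\<pi> \<le> 1" using \<pi>e by linarith
        hence "\<pi> ^ q \<le> \<pi> ^ 1" using \<pi>0 q by (intro power_decreasing) auto
        hence \<pi>q: "\<pi> ^ q \<le> exp (l * real n powr (1 / 4))" using \<pi>e by simp
        have "norm (E n - x n ^ q / fact q) \<le> norm (E n) + norm (x n ^ q / fact q)" by (rule norm_triangle_ineq4)
        also have "norm (E n) = \<pi> ^ q * \<bar>marked_factor p k n q\<bar>" using \<pi>0 by (simp add: En abs_mult)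
        also have "\<dots> \<le> exp (l * real n powr (1 / 4)) * (C' * real n ^ (q + 2))"
          using elim s k0 \<pi>0 by (intro mult_mono \<pi>q) auto
        also have "norm (x n ^ q / fact q) \<le> real n ^ q * \<pi> ^ q"
        proof -
          have "x n ^ q / fact q \<le> x n ^ q / 1" using \<pi>0 by (intro divide_left_mono) (auto simp: xn)
          thus ?thesis using \<pi>0 by (simp add: xn)
        qed
        also have "\<dots> \<le> real n ^ q * exp (l * real n powr (1 / 4))" by (intro mult_left_mono \<pi>q) auto
        finally show ?thesis using B1 by (simp add: B_def algebra_simps)
      qed
    qed
  qed
  have B0: "(B \<longlongrightarrow> 0) ?F"
  proof -
    have le: "?F \<le> sequentially" by (simp add: gw_sizes_def)
    have 1: "(\<lambda>n. real n powr (1 / 4) / sqrt (real n)) \<longlonglongrightarrow> 0" by real_asymp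
    have 2: "(\<lambda>n. (C' * real n ^ (q + 2) + real n ^ q) * exp (l * real n powr (1 / 4))) \<longlonglongrightarrow> 0"
    proof -
      have "(\<lambda>n. (C' * real n powr (real q + 2) + real n powr real q) * exp (l * real n powr (1 / 4))) \<longlonglongrightarrow> 0"
        using l by real_asymp
      moreover have "\<forall>\<^sub>F n in sequentially. (C' * real n powr (real q + 2) + real n powr real q) * exp (l * real n powr (1 / 4)) =
         (C' * real n ^ (q + 2) + real n ^ q) * exp (l * real n powr (1 / 4))"
        using eventually_gt_at_top[of 0]
        by eventually_elim (simp add: powr_add powr_realpow powr_numeral power_add power2_eq_square)
      ultimately show ?thesis by (rule Lim_transform_eventually)
    qed
    have "(B \<longlongrightarrow> C * 0 * \<mu> ^ q + 0) ?F"
      unfolding B_def by (intro tendsto_add tendsto_mult tendsto_const tendsto_power tendsto_mono[OF le 1] tendsto_mono[OF le 2])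
        (use lim in \<open>simp add: x_def\<close>)
    thus ?thesis by simp
  qed
  have "((\<lambda>n. E n - x n ^ q / fact q) \<longlongrightarrow> 0) ?F"
    by (rule Lim_null_comparison[OF bound B0])
  moreover have "((\<lambda>n. x n ^ q / fact q) \<longlongrightarrow> \<mu> ^ q / fact q) ?F"
    using lim unfolding x_def by (intro tendsto_intros) auto
  ultimately have "((\<lambda>n. (E n - x n ^ q / fact q) + x n ^ q / fact q) \<longlongrightarrow> 0 + \<mu> ^ q / fact q) ?F"
    by (rule tendsto_add)
  thus ?thesis by (simp add: E_def)
qed

theorem Poisson_limit:
  assumes \<mu>: "\<mu> \<ge> 0" and lim: "((\<lambda>n. real n * tree_weight p (T n)) \<longlongrightarrow> \<mu>) (gw_sizes p)"
  shows "conv_in_distribution (\<lambda>n. distr (conditioned_gw p n) borel (\<lambda>t. real (fringe_count (T n) t)))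
          (poisson_law \<mu>) (gw_sizes p) \<and>
        conv_of_moments (\<lambda>n. distr (conditioned_gw p n) borel (\<lambda>t. real (fringe_count (T n) t)))
          (poisson_law \<mu>) (gw_sizes p)"
proof -
  define S where "S = {n. size_prob p n > 0}"
  have F: "gw_sizes p = inf sequentially (principal S)" by (simp add: gw_sizes_eq S_def)
  define \<nu> where "\<nu> = (\<lambda>n. map_pmf (fringe_count (T n)) (conditioned_gw_pmf p n))"
  define M where "M = (\<lambda>n. distr (conditioned_gw p n) borel (\<lambda>t. real (fringe_count (T n) t)))"
  have fin: "finite (set_pmf (\<nu> n))" if "n \<in> S" for n
    using finite_set_conditioned_gw_pmf that by (auto simp: \<nu>_def S_def)
  have M_eq: "M n = distr (measure_pmf (\<nu> n)) borel real" if "n \<in> S" for n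
    using that unfolding M_def \<nu>_def map_pmf_rep_eq
    by (subst distr_distr) (auto simp: S_def conditioned_gw_eq comp_def)
  have lim': "((\<lambda>n. measure_pmf.expectation (\<nu> n) (\<lambda>x. real (x choose q))) \<longlongrightarrow> \<mu> ^ q / fact q)
      (inf sequentially (principal S))" for q
    using binomial_moment_limit[OF lim, of q] by (simp add: \<nu>_def F)
  have ev: "\<forall>\<^sub>F n in inf sequentially (principal S). distr (measure_pmf (\<nu> n)) borel real = M n"
    by (auto simp: eventually_inf_principal M_eq)
  from Poisson_convergence[OF \<mu> fin lim']
  have c1: "conv_in_distribution (\<lambda>n. distr (\<nu> n) borel real) (poisson_law \<mu>) (inf sequentially (principal S))"
    and c2: "conv_of_moments (\<lambda>n. distr (\<nu> n) borel real) (poisson_law \<mu>) (inf sequentially (principal S))" by auto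
  have "conv_in_distribution M (poisson_law \<mu>) (inf sequentially (principal S))"
    unfolding conv_in_distribution_def
  proof (intro allI impI)
    fix x assume "isCont (cdf (poisson_law \<mu>)) x"
    hence "((\<lambda>n. cdf (distr (\<nu> n) borel real) x) \<longlongrightarrow> cdf (poisson_law \<mu>) x) (inf sequentially (principal S))"
      using c1 unfolding conv_in_distribution_def by blast
    thus "((\<lambda>n. cdf (M n) x) \<longlongrightarrow> cdf (poisson_law \<mu>) x) (inf sequentially (principal S))"
      by (rule Lim_transform_eventually) (use ev in eventually_elim, simp)
  qed
  moreover have "conv_of_moments M (poisson_law \<mu>) (inf sequentially (principal S))"
    unfolding conv_of_moments_def
  proof
    fix r
    have "((\<lambda>n. \<integral>x. x ^ r \<partial>distr (\<nu> n) borel real) \<longlongrightarrow> (\<integral>x. x ^ r \<partial>poisson_law \<mu>)) (inf sequentially (principal S))"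
      using c2 unfolding conv_of_moments_def by blast
    thus "((\<lambda>n. \<integral>x. x ^ r \<partial>M n) \<longlongrightarrow> (\<integral>x. x ^ r \<partial>poisson_law \<mu>)) (inf sequentially (principal S))"
      by (rule Lim_transform_eventually) (use ev in eventually_elim, simp)
  qed
  ultimately show ?thesis unfolding F M_def by blast
qed

end

section \<open>The normal limit\<close>

lemma norm_exp_diff_le:
  assumes "Re x \<le> 0" "Re y \<le> 0"
  shows "norm (exp x - exp y) \<le> norm (x - y)"
proof -
  have "norm (exp x - exp y) \<le> 1 * norm (x - y)"
  proof (rule field_differentiable_bound)
    show "convex {z. Re z \<le> 0}" by (rule convex_halfspace_Re_le)
    show "(exp has_field_derivative exp z) (at z within {z. Re z \<le> 0})" for z
      by (auto intro!: derivative_eq_intros)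
  qed (use assms in auto)
  thus ?thesis by simp
qed

lemma square_eq_choose_2: "(real x)\<^sup>2 = 2 * real (x choose 2) + real x"
proof (cases x)
  case (Suc m)
  have "2 * (x choose 2) = x * m" using Suc by (simp add: choose_two)
  hence "2 * real (x choose 2) = real x * real m" by (metis of_nat_mult of_nat_numeral)
  thus ?thesis using Suc by (simp add: power2_eq_square algebra_simps)
qed simp

context critical_regular begin

lemma expectation_fringe_number_same_size:
  assumes "size_prob p n > 0" "k > 0"
  shows "measure_pmf.expectation (conditioned_gw_pmf p n) (\<lambda>t. real (fringe_number (trees_of_size k) t choose q)) =
    size_prob p k ^ q * marked_factor p k n q"
  unfolding size_prob_def[of p k]
  by (rule expectation_fringe_number_choose) (use assms in \<open>auto simp: trees_of_size_def\<close>)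

lemma integrable_conditioned_gw_pmf:
  fixes g :: "plane_tree \<Rightarrow> 'b :: {banach, second_countable_topology}"
  assumes "size_prob p n > 0"
  shows "integrable (conditioned_gw_pmf p n) g"
  by (rule integrable_measure_pmf_finite[OF finite_set_conditioned_gw_pmf[OF assms]])

lemma expectation_power_fringe_number:
  fixes w :: complex
  assumes n: "size_prob p n > 0"
  shows "measure_pmf.expectation (conditioned_gw_pmf p n) (\<lambda>t. (1 + w) ^ fringe_number Q t) =
    (\<Sum>q\<le>n. of_real (measure_pmf.expectation (conditioned_gw_pmf p n) (\<lambda>t. real (fringe_number Q t choose q))) * w ^ q)"
proof -
  have "measure_pmf.expectation (conditioned_gw_pmf p n) (\<lambda>t. (1 + w) ^ fringe_number Q t) =
     measure_pmf.expectation (conditioned_gw_pmf p n) (\<lambda>t. \<Sum>q\<le>n. of_real (real (fringe_number Q t choose q)) * w ^ q)"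
  proof (intro integral_cong_AE)
    show "AE t in conditioned_gw_pmf p n. (1 + w) ^ fringe_number Q t =
        (\<Sum>q\<le>n. of_real (real (fringe_number Q t choose q)) * w ^ q)"
    proof (rule AE_pmfI)
      fix t assume "t \<in> set_pmf (conditioned_gw_pmf p n)"
      hence "tree_size t = n" using set_conditioned_gw_pmf[OF n] by (auto simp: trees_of_size_def)
      hence le: "fringe_number Q t \<le> n" using fringe_number_le_size[of Q t] by simp
      have "(1 + w) ^ fringe_number Q t = (\<Sum>q\<le>fringe_number Q t. of_nat (fringe_number Q t choose q) * w ^ q)"
        using binomial_ring[of w 1 "fringe_number Q t"] by (simp add: add.commute)
      also have "\<dots> = (\<Sum>q\<le>n. of_nat (fringe_number Q t choose q) * w ^ q)"
        using le by (intro sum.mono_neutral_left) (auto simp: binomial_eq_0)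
      finally show "(1 + w) ^ fringe_number Q t = (\<Sum>q\<le>n. of_real (real (fringe_number Q t choose q)) * w ^ q)"
        by simp
    qed
  qed auto
  also have "\<dots> = (\<Sum>q\<le>n. measure_pmf.expectation (conditioned_gw_pmf p n)
      (\<lambda>t. of_real (real (fringe_number Q t choose q)) * w ^ q))"
    by (rule Bochner_Integration.integral_sum) (rule integrable_conditioned_gw_pmf[OF n])
  also have "\<dots> = (\<Sum>q\<le>n. of_real (measure_pmf.expectation (conditioned_gw_pmf p n) (\<lambda>t. real (fringe_number Q t choose q))) * w ^ q)"
    by (intro sum.cong refl) (simp only: integral_mult_left_zero integral_complex_of_real)
  finally show ?thesis .
qed

text \<open>In terms of the number \<open>M\<close> of fringe trees of size \<open>k\<close>, the number of copies of \<open>T\<close> is binomial with parameters \<open>M\<close>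
  and the probability that a conditioned tree of size \<open>k\<close> is \<open>T\<close>. The identity of generating functions follows from the
  binomial moments, as \<open>marked_factor\<close> is the same on both sides.\<close>

lemma fringe_count_binomial_mixture:
  fixes w :: complex
  assumes n: "size_prob p n > 0" and k: "size_prob p (tree_size T) > 0"
  shows "measure_pmf.expectation (conditioned_gw_pmf p n) (\<lambda>t. (1 + w) ^ fringe_count T t) =
    measure_pmf.expectation (conditioned_gw_pmf p n)
      (\<lambda>t. (1 + of_real (tree_weight p T / size_prob p (tree_size T)) * w) ^ fringe_number (trees_of_size (tree_size T)) t)"
proof -
  have eq: "of_real (tree_weight p T ^ q * marked_factor p (tree_size T) n q) * w ^ q =
     of_real (size_prob p (tree_size T) ^ q * marked_factor p (tree_size T) n q) *
       (of_real (tree_weight p T / size_prob p (tree_size T)) * w) ^ q" for q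
    using k by (simp add: power_mult_distrib power_divide)
  show ?thesis
    unfolding fringe_count_eq expectation_power_fringe_number[OF n]
      expectation_fringe_number_same_size[OF n tree_size_pos]
      expectation_fringe_count_choose[OF n, of T, unfolded fringe_count_eq] eq ..
qed

lemma tree_weight_le_size_prob: "tree_weight p T \<le> size_prob p (tree_size T)"
  unfolding size_prob_def
  by (intro member_le_sum tree_weight_nonneg finite_trees_of_size') (auto simp: trees_of_size_def)

text \<open>Up to a term of Poisson type, the second moment of the relative deviation is the second difference of
  \<open>walk_prob_marked_second_diff\<close>.\<close>

lemma same_size_count_variance:
  "\<exists>C>0. \<forall>\<^sub>F n in sequentially. \<forall>k. k > 0 \<longrightarrow> k ^ 4 \<le> n \<longrightarrow> size_prob p n > 0 \<longrightarrow> size_prob p k > 0 \<longrightarrow>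
     measure_pmf.expectation (conditioned_gw_pmf p n) (\<lambda>t. real (fringe_number (trees_of_size k) t)) \<le> C * (real n * size_prob p k) \<and>
     measure_pmf.expectation (conditioned_gw_pmf p n) (\<lambda>t. (real (fringe_number (trees_of_size k) t) / (real n * size_prob p k) - 1)\<^sup>2)
       \<le> C * ((real k)\<^sup>2 / real n + 1 / (real n * size_prob p k))"
proof -
  obtain C1 where C1: "C1 > 0" "\<forall>\<^sub>F n in sequentially. \<forall>q k. k > 0 \<longrightarrow> 2 * (q * k) \<le> n \<longrightarrow> span dvd n - 1 \<longrightarrow> span dvd k - 1 \<longrightarrow>
     \<bar>marked_walk n k q - walk_prob p n (n - 1)\<bar> \<le>
       C1 * real (q * k) / sqrt (real n) * walk_prob p n (n - 1)" using walk_prob_marked_diff by blast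
  obtain C2 where C2: "C2 > 0" "\<forall>\<^sub>F n in sequentially. \<forall>k. k > 0 \<longrightarrow> 4 * k \<le> n \<longrightarrow> span dvd n - 1 \<longrightarrow> span dvd k - 1 \<longrightarrow>
     marked_walk n k 2 - 2 * marked_walk n k 1 +
       walk_prob p n (n - 1) \<le> C2 * (real k)\<^sup>2 / real n * walk_prob p n (n - 1)" using walk_prob_marked_second_diff by blast
  define C where "C = max (1 + C1) C2"
  have "\<forall>\<^sub>F n in sequentially. \<forall>k. k > 0 \<longrightarrow> k ^ 4 \<le> n \<longrightarrow> size_prob p n > 0 \<longrightarrow> size_prob p k > 0 \<longrightarrow>
     measure_pmf.expectation (conditioned_gw_pmf p n) (\<lambda>t. real (fringe_number (trees_of_size k) t)) \<le> C * (real n * size_prob p k) \<and>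
     measure_pmf.expectation (conditioned_gw_pmf p n) (\<lambda>t. (real (fringe_number (trees_of_size k) t) / (real n * size_prob p k) - 1)\<^sup>2)
       \<le> C * ((real k)\<^sup>2 / real n + 1 / (real n * size_prob p k))"
    using C1(2) C2(2) eventually_ge_at_top[of 16]
  proof eventually_elim
    case (elim n)
    show ?case
    proof (intro allI impI)
      fix k :: nat assume k: "k > 0" "k ^ 4 \<le> n" "size_prob p n > 0" "size_prob p k > 0"
      note n = size_prob_pos_imp[OF k(3)] and kk = size_prob_pos_imp[OF k(4)]
      have k4: "4 * k \<le> n"
      proof (cases "k \<ge> 4")
        case True
        have "4 * k \<le> k * k" using True by simp
        also have "\<dots> = k ^ 2" by (simp add: power2_eq_square)
        also have "\<dots> \<le> k ^ 4" using k(1) by (intro power_increasing) auto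
        finally show ?thesis using k(2) by simp
      next
        case False
        thus ?thesis using elim(3) by simp
      qed
      define f where "f = size_prob p k"
      define G0 where "G0 = walk_prob p n (n - 1)"
      define R1 where "R1 = marked_walk n k 1 / G0"
      define R2 where "R2 = marked_walk n k 2 / G0"
      have G0: "G0 > 0" using n by (simp add: G0_def)
      have f: "f > 0" using k by (simp add: f_def)
      have nf: "real n * f > 0" using f n by simp
      define M where "M = (\<lambda>t. real (fringe_number (trees_of_size k) t))"
      let ?E = "measure_pmf.expectation (conditioned_gw_pmf p n)"
      have EM: "?E M = real n * f * R1"
      proof -
        have "?E (\<lambda>t. real (fringe_number (trees_of_size k) t choose 1)) = f ^ 1 * marked_factor p k n 1"
          unfolding f_def by (rule expectation_fringe_number_same_size[OF k(3,1)])
        also have "marked_factor p k n 1 = real n * R1"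
          unfolding marked_factor_eq[OF k(3)] R1_def G0_def using k4 by simp
        finally show ?thesis by (simp add: M_def)
      qed
      have R2: "R2 \<ge> 0" unfolding R2_def using G0 by (intro divide_nonneg_pos walk_prob_nonneg)
      have EM2: "?E (\<lambda>t. real (fringe_number (trees_of_size k) t choose 2)) \<le> f\<^sup>2 * ((real n)\<^sup>2 / 2 * R2)"
      proof -
        define L where "L = n - 2 * k + 2"
        have L: "L > 0" "real L - 1 \<le> real n" using k4 k(1) by (auto simp: L_def of_nat_diff)
        have "2 * real (L choose 2) = real L * (real L - 1)"
          using square_eq_choose_2[of L] by (simp add: power2_eq_square algebra_simps)
        hence c2: "real (L choose 2) / real L = (real L - 1) / 2" using L(1) by (simp add: field_simps)
        have "?E (\<lambda>t. real (fringe_number (trees_of_size k) t choose 2)) = f ^ 2 * marked_factor p k n 2"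
          unfolding f_def by (rule expectation_fringe_number_same_size[OF k(3,1)])
        also have "marked_factor p k n 2 = real n * (real (L choose 2) / real L) * R2"
          unfolding marked_factor_eq[OF k(3)] R2_def G0_def L_def using k4 by simp
        also have "\<dots> = real n * ((real L - 1) / 2) * R2" by (simp only: c2)
        also have "f ^ 2 * \<dots> \<le> f\<^sup>2 * (real n * (real n / 2) * R2)"
          using L R2 by (intro mult_left_mono mult_right_mono) auto
        finally show ?thesis by (simp add: power2_eq_square)
      qed
      have "R2 - 2 * R1 + 1 = (marked_walk n k 2 -
          2 * marked_walk n k 1 + walk_prob p n (n - 1)) / G0"
        using G0 by (simp add: R1_def R2_def G0_def add_divide_distrib diff_divide_distrib)
      also have "\<dots> \<le> (C2 * (real k)\<^sup>2 / real n * G0) / G0"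
        using elim(2) k k4 n kk G0 unfolding G0_def by (intro divide_right_mono) auto
      also have "\<dots> = C2 * (real k)\<^sup>2 / real n" using G0 by simp
      finally have second: "R2 - 2 * R1 + 1 \<le> C2 * (real k)\<^sup>2 / real n" .
      have R1: "R1 \<le> 1 + C1"
      proof -
        have "\<bar>marked_walk n k 1 - G0\<bar> \<le> C1 * real (1 * k) / sqrt (real n) * G0"
          using elim(1) k k4 n kk unfolding G0_def by (intro elim(1)[rule_format]) auto
        also have "\<dots> \<le> C1 * 1 * G0"
        proof -
          have "k ^ 2 \<le> k ^ 4" using k(1) by (intro power_increasing) auto
          hence "real (k ^ 2) \<le> real n" using k(2) by (intro of_nat_mono) simp
          hence "real k \<le> sqrt (real n)" by (intro real_le_rsqrt) simp
          hence "real k / sqrt (real n) \<le> 1" using n by simp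
          hence "C1 * (real k / sqrt (real n)) * G0 \<le> C1 * 1 * G0"
            using C1(1) G0 by (intro mult_right_mono mult_left_mono) auto
          thus ?thesis by simp
        qed
        finally have "marked_walk n k 1 \<le> (1 + C1) * G0" by (simp add: algebra_simps)
        thus ?thesis unfolding R1_def using G0 by (simp add: pos_divide_le_eq)
      qed
      have int: "integrable (conditioned_gw_pmf p n) g" for g :: "plane_tree \<Rightarrow> real"
        by (rule integrable_conditioned_gw_pmf[OF k(3)])
      have "?E (\<lambda>t. (M t / (real n * f) - 1)\<^sup>2) =
          ?E (\<lambda>t. (2 / (real n * f)\<^sup>2) * real (fringe_number (trees_of_size k) t choose 2) +
             (1 / (real n * f)\<^sup>2 - 2 / (real n * f)) * M t + 1)"
      proof (intro Bochner_Integration.integral_cong refl)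
        fix t
        have "(M t / (real n * f) - 1)\<^sup>2 = (M t)\<^sup>2 / (real n * f)\<^sup>2 - 2 / (real n * f) * M t + 1"
          by (simp add: power2_diff power_divide)
        also have "(M t)\<^sup>2 = 2 * real (fringe_number (trees_of_size k) t choose 2) + M t"
          unfolding M_def by (rule square_eq_choose_2)
        finally show "(M t / (real n * f) - 1)\<^sup>2 =
          (2 / (real n * f)\<^sup>2) * real (fringe_number (trees_of_size k) t choose 2) +
             (1 / (real n * f)\<^sup>2 - 2 / (real n * f)) * M t + 1"
          by (simp add: add_divide_distrib algebra_simps)
      qed
      also have "\<dots> = (2 / (real n * f)\<^sup>2) * ?E (\<lambda>t. real (fringe_number (trees_of_size k) t choose 2)) +
             (1 / (real n * f)\<^sup>2 - 2 / (real n * f)) * ?E M + 1"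
        by (simp add: int)
      also have "\<dots> \<le> (2 / (real n * f)\<^sup>2) * (f\<^sup>2 * ((real n)\<^sup>2 / 2 * R2)) +
             (1 / (real n * f)\<^sup>2 - 2 / (real n * f)) * (real n * f * R1) + 1"
        unfolding EM by (intro add_right_mono mult_left_mono EM2) auto
      also have "\<dots> = (R2 - 2 * R1 + 1) + R1 / (real n * f)"
        using n f by (simp add: power2_eq_square field_simps)
      also have "\<dots> \<le> C2 * (real k)\<^sup>2 / real n + (1 + C1) / (real n * f)"
        using nf by (intro add_mono second divide_right_mono R1) auto
      also have "\<dots> \<le> C * ((real k)\<^sup>2 / real n + 1 / (real n * f))"
      proof -
        have "C2 * ((real k)\<^sup>2 / real n) \<le> C * ((real k)\<^sup>2 / real n)" by (intro mult_right_mono) (auto simp: C_def)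
        moreover have "(1 + C1) * (1 / (real n * f)) \<le> C * (1 / (real n * f))" using nf by (intro mult_right_mono) (auto simp: C_def)
        ultimately show ?thesis by (simp add: distrib_left)
      qed
      finally have var: "?E (\<lambda>t. (M t / (real n * f) - 1)\<^sup>2) \<le> C * ((real k)\<^sup>2 / real n + 1 / (real n * f))" .
      have "?E M \<le> real n * f * C" unfolding EM using nf R1 by (intro mult_left_mono) (auto simp: C_def)
      hence "?E M \<le> C * (real n * f)" by (simp add: mult_ac)
      thus "?E (\<lambda>t. real (fringe_number (trees_of_size k) t)) \<le> C * (real n * size_prob p k) \<and>
        ?E (\<lambda>t. (real (fringe_number (trees_of_size k) t) / (real n * size_prob p k) - 1)\<^sup>2)
         \<le> C * ((real k)\<^sup>2 / real n + 1 / (real n * size_prob p k))"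
        using var unfolding M_def f_def by blast
    qed
  qed
  moreover have "C > 0" using C1(1) by (simp add: C_def less_max_iff_disj)
  ultimately show ?thesis by blast
qed

text \<open>Conditionally on \<open>M\<close>, the count is binomial with a success probability \<open>r\<close> that tends to 0, because the weight of
  a tree is exponentially small in its size whereas the probability of a size decays polynomially. Hence it is nearly Poisson
  with mean \<open>M * r\<close>. The random mean deviates from \<open>\<mu> n\<close> by \<open>\<mu> n * \<Delta> n\<close>, and the variance estimate makes this negligible
  against \<open>sqrt (\<mu> n)\<close>; what remains is the normal approximation of a Poisson law with large mean.\<close>

theorem normal_limit:
  assumes T_size: "filterlim (\<lambda>n. tree_size (T n)) at_top (gw_sizes p)"
    and lim: "filterlim (\<lambda>n. real n * tree_weight p (T n)) at_top (gw_sizes p)"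
  shows "conv_in_distribution (\<lambda>n. distr (conditioned_gw p n) borel
            (\<lambda>t. (real (fringe_count (T n) t) - real n * tree_weight p (T n)) / sqrt (real n * tree_weight p (T n))))
          std_normal_distribution (gw_sizes p)"
proof -
  define S where "S = {n. size_prob p n > 0}"
  have F: "gw_sizes p = inf sequentially (principal S)" by (simp add: gw_sizes_eq S_def)
  let ?F = "inf sequentially (principal S)"
  have le: "?F \<le> sequentially" by simp
  define k where "k = (\<lambda>n. tree_size (T n))"
  define \<pi> where "\<pi> = (\<lambda>n. tree_weight p (T n))"
  define \<mu> where "\<mu> = (\<lambda>n. real n * \<pi> n)"
  define f where "f = (\<lambda>n. size_prob p (k n))"
  define r where "r = (\<lambda>n. \<pi> n / f n)"
  have k_top: "filterlim k at_top ?F" using T_size by (simp add: k_def F)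
  have \<mu>_top: "filterlim \<mu> at_top ?F" using lim by (simp add: \<mu>_def \<pi>_def F)
  have k0: "k n > 0" for n by (simp add: k_def tree_size_pos)
  have inS: "\<forall>\<^sub>F n in ?F. n \<in> S" by (simp add: eventually_inf_principal)
  obtain \<rho> where \<rho>: "0 < \<rho>" "\<rho> < 1" "\<And>i. pmf p i \<le> \<rho>" using pmf_bound by blast
  define l where "l = ln \<rho>"
  have l: "l < 0" using \<rho> by (simp add: l_def)
  have \<pi>_le: "\<pi> n \<le> exp (l * real (k n))" for n
  proof -
    have "\<pi> n \<le> \<rho> ^ k n" unfolding \<pi>_def k_def by (rule tree_weight_le_power[OF \<rho>(3)])
    also have "\<dots> = exp (l * real (k n))" using \<rho> by (simp add: l_def exp_of_nat2_mult)
    finally show ?thesis .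
  qed
  have \<mu>_pos: "\<forall>\<^sub>F n in ?F. \<mu> n > 1" using \<mu>_top by (auto simp: filterlim_at_top_dense)
  have small: "\<forall>\<^sub>F n in ?F. k n ^ 4 \<le> n"
  proof -
    have "(\<lambda>n. real n * exp (l * real n powr (1 / 4))) \<longlonglongrightarrow> 0" using l by real_asymp
    hence "\<forall>\<^sub>F n in sequentially. real n * exp (l * real n powr (1 / 4)) < 1" by (rule order_tendstoD) simp
    hence "\<forall>\<^sub>F n in ?F. real n * exp (l * real n powr (1 / 4)) < 1" by (rule filter_leD[OF le])
    thus ?thesis using \<mu>_pos
    proof eventually_elim
      case (elim n)
      show ?case
      proof (rule ccontr)
        assume "\<not> k n ^ 4 \<le> n"
        hence "exp (l * real (k n)) \<le> exp (l * real n powr (1 / 4))"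
          using quartic_root_bounds(2) l by (simp add: mult_left_mono_neg)
        hence "\<pi> n \<le> exp (l * real n powr (1 / 4))" using \<pi>_le[of n] by linarith
        hence "\<mu> n \<le> real n * exp (l * real n powr (1 / 4))" unfolding \<mu>_def by (intro mult_left_mono) auto
        thus False using elim by simp
      qed
    qed
  qed
  have \<pi>_pos: "\<forall>\<^sub>F n in ?F. \<pi> n > 0"
    using \<mu>_pos
  proof eventually_elim
    case (elim n)
    have "\<mu> n > 0" using elim by simp
    thus ?case by (simp add: \<mu>_def zero_less_mult_iff)
  qed
  have f_ge: "\<pi> n \<le> f n" for n unfolding \<pi>_def f_def k_def by (rule tree_weight_le_size_prob)
  have f_pos: "\<forall>\<^sub>F n in ?F. f n > 0"
    using \<pi>_pos by eventually_elim (use f_ge order_less_le_trans in blast)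
  obtain c where c: "c > 0" "\<forall>\<^sub>F n in sequentially. span dvd n - 1 \<longrightarrow> c / (real n)\<^sup>2 \<le> size_prob p n"
    using size_prob_ge by blast
  have r0: "(r \<longlongrightarrow> 0) ?F"
  proof (rule tendsto_sandwich[of "\<lambda>_. 0" _ _ "\<lambda>n. (real (k n))\<^sup>2 * exp (l * real (k n)) / c"])
    have "(\<lambda>k::nat. (real k)\<^sup>2 * exp (l * real k) / c) \<longlonglongrightarrow> 0" using l c(1) by real_asymp
    thus "((\<lambda>n. (real (k n))\<^sup>2 * exp (l * real (k n)) / c) \<longlongrightarrow> 0) ?F" by (rule filterlim_compose[OF _ k_top])
    have "\<forall>\<^sub>F n in ?F. span dvd k n - 1 \<longrightarrow> c / (real (k n))\<^sup>2 \<le> size_prob p (k n)"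
      using c(2) k_top by (rule eventually_compose_filterlim)
    thus "\<forall>\<^sub>F n in ?F. r n \<le> (real (k n))\<^sup>2 * exp (l * real (k n)) / c"
      using f_pos \<pi>_pos
    proof eventually_elim
      case (elim n)
      have fk: "c / (real (k n))\<^sup>2 \<le> f n"
        using elim(1,2) size_prob_pos_imp(2)[of "k n"] by (simp add: f_def)
      have "r n \<le> exp (l * real (k n)) / (c / (real (k n))\<^sup>2)"
        unfolding r_def using elim \<pi>_le c(1) k0[of n] fk by (intro frac_le) auto
      thus ?case by (simp add: mult.commute)
    qed
    show "\<forall>\<^sub>F n in ?F. 0 \<le> r n" using f_pos \<pi>_pos by eventually_elim (simp add: r_def)
  qed auto
  define P where "P = (\<lambda>n. conditioned_gw_pmf p n)"
  define M where "M = (\<lambda>n t. real (fringe_number (trees_of_size (k n)) t))"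
  define \<Delta> where "\<Delta> = (\<lambda>n t. M n t / (real n * f n) - 1)"
  define E where "E = (\<lambda>n (g :: plane_tree \<Rightarrow> real). measure_pmf.expectation (P n) g)"
  obtain C where C: "C > 0" "\<forall>\<^sub>F n in sequentially. \<forall>k. k > 0 \<longrightarrow> k ^ 4 \<le> n \<longrightarrow> size_prob p n > 0 \<longrightarrow> size_prob p k > 0 \<longrightarrow>
     measure_pmf.expectation (conditioned_gw_pmf p n) (\<lambda>t. real (fringe_number (trees_of_size k) t)) \<le> C * (real n * size_prob p k) \<and>
     measure_pmf.expectation (conditioned_gw_pmf p n) (\<lambda>t. (real (fringe_number (trees_of_size k) t) / (real n * size_prob p k) - 1)\<^sup>2)
       \<le> C * ((real k)\<^sup>2 / real n + 1 / (real n * size_prob p k))" using same_size_count_variance by blast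
  have var: "\<forall>\<^sub>F n in ?F. E n (M n) \<le> C * (real n * f n) \<and> E n (\<lambda>t. (\<Delta> n t)\<^sup>2) \<le> C * ((real (k n))\<^sup>2 / real n + 1 / (real n * f n))"
    using filter_leD[OF le C(2)] inS small f_pos
    by eventually_elim (use k0 in \<open>auto simp: E_def M_def \<Delta>_def f_def P_def S_def\<close>)
  have \<Delta>0: "((\<lambda>n. sqrt (\<mu> n * E n (\<lambda>t. (\<Delta> n t)\<^sup>2))) \<longlongrightarrow> 0) ?F"
  proof -
    have "((\<lambda>n. \<mu> n * E n (\<lambda>t. (\<Delta> n t)\<^sup>2)) \<longlongrightarrow> 0) ?F"
    proof (rule tendsto_sandwich[of "\<lambda>_. 0" _ _ "\<lambda>n. C * ((real (k n))\<^sup>2 * exp (l * real (k n)) + r n)"])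
      have "(\<lambda>k::nat. (real k)\<^sup>2 * exp (l * real k)) \<longlonglongrightarrow> 0" using l by real_asymp
      hence "((\<lambda>n. (real (k n))\<^sup>2 * exp (l * real (k n))) \<longlongrightarrow> 0) ?F" by (rule filterlim_compose[OF _ k_top])
      hence "((\<lambda>n. C * ((real (k n))\<^sup>2 * exp (l * real (k n)) + r n)) \<longlongrightarrow> C * (0 + 0)) ?F"
        by (intro tendsto_intros r0)
      thus "((\<lambda>n. C * ((real (k n))\<^sup>2 * exp (l * real (k n)) + r n)) \<longlongrightarrow> 0) ?F" by simp
      show "\<forall>\<^sub>F n in ?F. \<mu> n * E n (\<lambda>t. (\<Delta> n t)\<^sup>2) \<le> C * ((real (k n))\<^sup>2 * exp (l * real (k n)) + r n)"
        using var \<mu>_pos f_pos \<pi>_pos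
      proof eventually_elim
        case (elim n)
        have n0: "real n > 0" using elim(2) by (cases "n = 0") (auto simp: \<mu>_def)
        have "\<mu> n * E n (\<lambda>t. (\<Delta> n t)\<^sup>2) \<le> \<mu> n * (C * ((real (k n))\<^sup>2 / real n + 1 / (real n * f n)))"
          using elim by (intro mult_left_mono) auto
        also have "\<dots> = C * ((real (k n))\<^sup>2 * \<pi> n + r n)"
          using n0 elim by (simp add: \<mu>_def r_def field_simps)
        also have "\<dots> \<le> C * ((real (k n))\<^sup>2 * exp (l * real (k n)) + r n)"
          using C(1) \<pi>_le by (intro mult_left_mono add_right_mono) auto
        finally show ?case .
      qed
      show "\<forall>\<^sub>F n in ?F. 0 \<le> \<mu> n * E n (\<lambda>t. (\<Delta> n t)\<^sup>2)"
        using \<mu>_pos by eventually_elim (auto simp: E_def intro!: mult_nonneg_nonneg integral_nonneg_AE)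
    qed auto
    from tendsto_real_sqrt[OF this] show ?thesis by simp
  qed
  define X where "X = (\<lambda>n t. (real (fringe_count (T n) t) - \<mu> n) / sqrt (\<mu> n))"
  define law where "law = (\<lambda>n. distr (conditioned_gw p n) borel (X n))"
  have law_eq: "law n = distr (measure_pmf (P n)) borel (X n)" if "n \<in> S" for n
    using that by (simp add: law_def P_def conditioned_gw_eq S_def)
  have "conv_in_distribution law std_normal_distribution ?F"
  proof (rule conv_in_distribution_char)
    show "real_distribution (law n)" if "n \<in> S" for n
      unfolding law_eq[OF that] by (rule real_distribution_distr_pmf)
    show "real_distribution std_normal_distribution" by (rule real_dist_normal_dist)
    fix \<theta> :: real
    define s where "s = (\<lambda>n. \<theta> / sqrt (\<mu> n))"
    define w where "w = (\<lambda>n. exp (\<i> * complex_of_real (s n)) - 1)"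
    define b where "b = (\<lambda>n. exp (of_real (\<mu> n) * (w n - \<i> * complex_of_real (s n))))"
    have w_le: "norm (w n) \<le> \<bar>s n\<bar>" "norm (w n) \<le> 2" "Re (w n) \<le> 0" for n
    proof -
      show "norm (w n) \<le> \<bar>s n\<bar>" using iexp_approx1[of "s n" 0] by (simp add: w_def)
      show "norm (w n) \<le> 2" using norm_triangle_ineq4[of "exp (\<i> * complex_of_real (s n))" 1] by (simp add: w_def)
      show "Re (w n) \<le> 0" by (simp add: w_def Re_exp)
    qed
    have b_lim: "(b \<longlongrightarrow> exp (- (of_real (\<theta>\<^sup>2 / 2)))) ?F"
    proof -
      have "((\<lambda>n. of_real (\<mu> n) * (w n - \<i> * complex_of_real (s n)) + of_real (\<theta>\<^sup>2 / 2)) \<longlongrightarrow> 0) ?F"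
      proof (rule Lim_null_comparison)
        show "\<forall>\<^sub>F n in ?F. norm (of_real (\<mu> n) * (w n - \<i> * complex_of_real (s n)) + of_real (\<theta>\<^sup>2 / 2)) \<le> \<bar>\<theta>\<bar> ^ 3 / sqrt (\<mu> n)"
          using \<mu>_pos
        proof eventually_elim
          case (elim n)
          have b1: "norm (w n - \<i> * complex_of_real (s n) + of_real ((s n)\<^sup>2 / 2)) \<le> \<bar>s n\<bar> ^ 3 / 6"
            using norm_iexp_quadratic[of "s n"] by (simp add: w_def algebra_simps)
          have s2: "\<mu> n * (s n)\<^sup>2 = \<theta>\<^sup>2" using elim by (simp add: s_def power_divide)
          have "of_real (\<mu> n) * (w n - \<i> * complex_of_real (s n)) + of_real (\<theta>\<^sup>2 / 2) =
              of_real (\<mu> n) * (w n - \<i> * complex_of_real (s n) + of_real ((s n)\<^sup>2 / 2))"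
            unfolding s2[symmetric] by (simp add: algebra_simps)
          hence "norm (of_real (\<mu> n) * (w n - \<i> * complex_of_real (s n)) + of_real (\<theta>\<^sup>2 / 2)) =
              \<mu> n * norm (w n - \<i> * complex_of_real (s n) + of_real ((s n)\<^sup>2 / 2))"
            using elim by (simp add: norm_mult)
          also have "\<dots> \<le> \<mu> n * (\<bar>s n\<bar> ^ 3 / 6)" using elim by (intro mult_left_mono b1) auto
          also have "\<dots> \<le> \<mu> n * (\<bar>s n\<bar> ^ 3 / 1)" using elim by (intro mult_left_mono divide_left_mono) auto
          also have "\<dots> = \<mu> n * (s n)\<^sup>2 * \<bar>s n\<bar>" by (simp add: power3_eq_cube power2_eq_square abs_mult_self_eq)
          also have "\<dots> = \<bar>\<theta>\<bar> ^ 3 / sqrt (\<mu> n)"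
            unfolding s2 using elim by (simp add: s_def abs_divide power3_eq_cube power2_eq_square)
          finally show ?case .
        qed
        have "((\<lambda>x. \<bar>\<theta>\<bar> ^ 3 / sqrt x) \<longlongrightarrow> 0) at_top" by real_asymp
        thus "((\<lambda>n. \<bar>\<theta>\<bar> ^ 3 / sqrt (\<mu> n)) \<longlongrightarrow> 0) ?F" by (rule filterlim_compose[OF _ \<mu>_top])
      qed
      from tendsto_diff[OF this tendsto_const[of "of_real (\<theta>\<^sup>2 / 2)"]]
      have "((\<lambda>n. of_real (\<mu> n) * (w n - \<i> * complex_of_real (s n))) \<longlongrightarrow> - of_real (\<theta>\<^sup>2 / 2)) ?F" by simp
      thus ?thesis unfolding b_def by (intro tendsto_exp)
    qed
    have "((\<lambda>n. char (law n) \<theta> - b n) \<longlongrightarrow> 0) ?F"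
    proof (rule Lim_null_comparison)
      show "\<forall>\<^sub>F n in ?F. norm (char (law n) \<theta> - b n) \<le> exp 2 * \<theta>\<^sup>2 * C * r n + \<bar>\<theta>\<bar> * sqrt (\<mu> n * E n (\<lambda>t. (\<Delta> n t)\<^sup>2))"
        using inS \<mu>_pos f_pos \<pi>_pos var
      proof eventually_elim
        case (elim n)
        have n: "size_prob p n > 0" using elim by (simp add: S_def)
        have n0: "real n > 0" using size_prob_pos_imp(1)[OF n] by simp
        have int: "integrable (P n) g" for g :: "plane_tree \<Rightarrow> 'z :: {banach, second_countable_topology}"
          unfolding P_def by (rule integrable_conditioned_gw_pmf[OF n])
        define N where "N = fringe_number (trees_of_size (k n))"
        \<comment> \<open>\<open>z ^ N t\<close> is the characteristic function of the binomial law given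
          \<open>N t\<close> trees of the right size, and \<open>y ^ N t\<close> is that of the Poisson law with
          the same mean.\<close>
        define z where "z = 1 + of_real (r n) * w n"
        define y where "y = exp (of_real (r n) * w n)"
        have r01: "0 \<le> r n" "r n \<le> 1" using f_ge[of n] elim by (auto simp: r_def)
        have char_eq: "char (law n) \<theta> = exp (- (\<i> * of_real (s n * \<mu> n))) * measure_pmf.expectation (P n) (\<lambda>t. z ^ N t)"
        proof -
          have "exp (\<i> * complex_of_real (\<theta> * X n t)) = exp (- (\<i> * of_real (s n * \<mu> n))) * (1 + w n) ^ fringe_count (T n) t" for t
          proof -
            have "(1 + w n) ^ fringe_count (T n) t = exp (of_nat (fringe_count (T n) t) * (\<i> * complex_of_real (s n)))"
              by (simp add: w_def exp_of_nat_mult)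
            moreover have "\<i> * complex_of_real (\<theta> * X n t) = - (\<i> * of_real (s n * \<mu> n)) + of_nat (fringe_count (T n) t) * (\<i> * complex_of_real (s n))"
              by (simp add: X_def s_def field_simps diff_divide_distrib)
            ultimately show ?thesis by (simp only: exp_add)
          qed
          hence "char (law n) \<theta> = exp (- (\<i> * of_real (s n * \<mu> n))) * measure_pmf.expectation (P n) (\<lambda>t. (1 + w n) ^ fringe_count (T n) t)"
            unfolding law_eq[OF elim(1)] char_distr_pmf by simp
          also have "measure_pmf.expectation (P n) (\<lambda>t. (1 + w n) ^ fringe_count (T n) t) = measure_pmf.expectation (P n) (\<lambda>t. z ^ N t)"
            unfolding P_def z_def N_def r_def \<pi>_def f_def k_def
            by (rule fringe_count_binomial_mixture) (use n elim in \<open>auto simp: f_def k_def\<close>)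
          finally show ?thesis .
        qed
        have b_eq: "b n = exp (- (\<i> * of_real (s n * \<mu> n))) * exp (of_real (\<mu> n) * w n)"
          unfolding b_def exp_add[symmetric] by (rule arg_cong[where f = exp]) (simp add: algebra_simps)
        have nz: "norm z \<le> 1"
        proof -
          have "z = of_real (1 - r n) + of_real (r n) * exp (\<i> * complex_of_real (s n))"
            by (simp add: z_def w_def algebra_simps)
          also have "norm \<dots> \<le> norm (complex_of_real (1 - r n)) + norm (of_real (r n) * exp (\<i> * complex_of_real (s n)))"
            by (rule norm_triangle_ineq)
          also have "\<dots> = 1" using r01 by (simp add: norm_mult del: of_real_diff)
          finally show ?thesis .
        qed
        have ny: "norm y \<le> 1" unfolding y_def using r01 w_le(3)[of n] by (simp add: mult_nonneg_nonpos)
        have zy: "norm (z - y) \<le> exp 2 * ((r n)\<^sup>2 * (s n)\<^sup>2)"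
        proof -
          define v where "v = of_real (r n) * w n"
          have nv: "norm v = r n * norm (w n)" using r01 by (simp add: v_def norm_mult)
          have "norm v \<le> 1 * 2" unfolding nv using r01 w_le(2)[of n] by (intro mult_mono) auto
          hence e2: "exp (norm v) \<le> exp 2" by simp
          have "norm v \<le> r n * \<bar>s n\<bar>" unfolding nv using r01 w_le(1)[of n] by (intro mult_left_mono) auto
          hence v2: "(norm v)\<^sup>2 \<le> (r n * \<bar>s n\<bar>)\<^sup>2" by (intro power_mono) auto
          have "z - y = - (exp v - (\<Sum>i\<le>1. v ^ i / fact i))" by (simp add: z_def y_def v_def)
          hence "norm (z - y) \<le> exp (norm v) * (norm v ^ Suc 1) / fact 1"
            using Taylor_exp_field[of v 1] by (simp only: norm_minus_cancel)
          also have "\<dots> = exp (norm v) * (norm v)\<^sup>2" by (simp add: power2_eq_square)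
          also have "\<dots> \<le> exp 2 * (r n * \<bar>s n\<bar>)\<^sup>2" using e2 v2 by (intro mult_mono) auto
          finally show ?thesis by (simp add: power_mult_distrib)
        qed
        have pt: "norm (z ^ N t - exp (of_real (\<mu> n) * w n)) \<le> exp 2 * ((r n)\<^sup>2 * (s n)\<^sup>2) * M n t + \<bar>s n\<bar> * \<mu> n * \<bar>\<Delta> n t\<bar>" for t
        proof -
          have "norm (z ^ N t - y ^ N t) \<le> real (N t) * norm (z - y)" by (intro norm_power_diff nz ny)
          also have "\<dots> \<le> real (N t) * (exp 2 * ((r n)\<^sup>2 * (s n)\<^sup>2))" by (intro mult_left_mono zy) auto
          finally have 1: "norm (z ^ N t - y ^ N t) \<le> exp 2 * ((r n)\<^sup>2 * (s n)\<^sup>2) * M n t"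
            by (simp add: M_def N_def mult_ac)
          have Mr: "M n t * r n - \<mu> n = \<mu> n * \<Delta> n t"
            using n0 elim by (simp add: \<Delta>_def \<mu>_def r_def field_simps)
          have y_pow: "y ^ N t = exp (of_real (M n t * r n) * w n)"
            by (simp add: y_def exp_of_nat_mult[symmetric] M_def N_def mult_ac)
          have "norm (y ^ N t - exp (of_real (\<mu> n) * w n)) \<le> norm (of_real (M n t * r n) * w n - of_real (\<mu> n) * w n)"
            unfolding y_pow
          proof (rule norm_exp_diff_le)
            have "M n t * r n \<ge> 0" using r01 by (simp add: M_def)
            thus "Re (of_real (M n t * r n) * w n) \<le> 0"
              using w_le(3)[of n] mult_nonneg_nonpos[of "M n t * r n" "Re (w n)"] by (simp del: of_real_mult)
            show "Re (of_real (\<mu> n) * w n) \<le> 0" using elim w_le(3)[of n] by (simp add: mult_nonneg_nonpos)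
          qed
          also have "of_real (M n t * r n) * w n - of_real (\<mu> n) * w n = of_real (\<mu> n * \<Delta> n t) * w n"
            unfolding Mr[symmetric] by (simp add: algebra_simps)
          also have "norm \<dots> = \<mu> n * \<bar>\<Delta> n t\<bar> * norm (w n)" using elim by (simp add: norm_mult abs_mult)
          also have "\<dots> \<le> \<mu> n * \<bar>\<Delta> n t\<bar> * \<bar>s n\<bar>" using elim by (intro mult_left_mono w_le) auto
          finally have 2: "norm (y ^ N t - exp (of_real (\<mu> n) * w n)) \<le> \<bar>s n\<bar> * \<mu> n * \<bar>\<Delta> n t\<bar>" by (simp add: mult_ac)
          have "norm (z ^ N t - exp (of_real (\<mu> n) * w n)) \<le> norm (z ^ N t - y ^ N t) + norm (y ^ N t - exp (of_real (\<mu> n) * w n))"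
            using norm_triangle_ineq[of "z ^ N t - y ^ N t" "y ^ N t - exp (of_real (\<mu> n) * w n)"] by simp
          thus ?thesis using 1 2 by linarith
        qed
        have "char (law n) \<theta> - b n = exp (- (\<i> * of_real (s n * \<mu> n))) *
            measure_pmf.expectation (P n) (\<lambda>t. z ^ N t - exp (of_real (\<mu> n) * w n))"
          unfolding char_eq b_eq right_diff_distrib[symmetric]
          by (subst Bochner_Integration.integral_diff[OF int int]) simp
        hence "norm (char (law n) \<theta> - b n) = norm (measure_pmf.expectation (P n) (\<lambda>t. z ^ N t - exp (of_real (\<mu> n) * w n)))"
          by (simp add: norm_mult)
        also have "\<dots> \<le> E n (\<lambda>t. norm (z ^ N t - exp (of_real (\<mu> n) * w n)))"
          unfolding E_def by (rule integral_norm_bound)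
        also have "\<dots> \<le> E n (\<lambda>t. exp 2 * ((r n)\<^sup>2 * (s n)\<^sup>2) * M n t + \<bar>s n\<bar> * \<mu> n * \<bar>\<Delta> n t\<bar>)"
          unfolding E_def by (intro integral_mono int pt)
        also have "\<dots> = exp 2 * ((r n)\<^sup>2 * (s n)\<^sup>2) * E n (M n) + \<bar>s n\<bar> * \<mu> n * E n (\<lambda>t. \<bar>\<Delta> n t\<bar>)"
          unfolding E_def by (subst Bochner_Integration.integral_add[OF int int]) simp
        also have "\<dots> \<le> exp 2 * \<theta>\<^sup>2 * C * r n + \<bar>\<theta>\<bar> * sqrt (\<mu> n * E n (\<lambda>t. (\<Delta> n t)\<^sup>2))"
        proof (rule add_mono)
          have s2: "\<mu> n * (s n)\<^sup>2 = \<theta>\<^sup>2" using elim by (simp add: s_def power_divide)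
          have rnf: "r n * (real n * f n) = \<mu> n" using elim by (simp add: r_def \<mu>_def)
          have "exp 2 * ((r n)\<^sup>2 * (s n)\<^sup>2) * E n (M n) \<le> exp 2 * ((r n)\<^sup>2 * (s n)\<^sup>2) * (C * (real n * f n))"
            using elim by (intro mult_left_mono) auto
          also have "\<dots> = exp 2 * C * r n * ((r n * (real n * f n)) * (s n)\<^sup>2)" by (simp add: power2_eq_square mult_ac)
          also have "\<dots> = exp 2 * \<theta>\<^sup>2 * C * r n" unfolding rnf s2 by (simp add: mult_ac)
          finally show "exp 2 * ((r n)\<^sup>2 * (s n)\<^sup>2) * E n (M n) \<le> exp 2 * \<theta>\<^sup>2 * C * r n" .
          \<comment> \<open>The factor \<open>sqrt (\<mu> n)\<close> in front of the first absolute moment is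
            absorbed by passing to the second moment.\<close>
          have "(E n (\<lambda>t. \<bar>\<Delta> n t\<bar>))\<^sup>2 \<le> E n (\<lambda>t. \<bar>\<Delta> n t\<bar>\<^sup>2)"
          proof -
            have "0 \<le> measure_pmf.variance (P n) (\<lambda>t. \<bar>\<Delta> n t\<bar>)" by (rule measure_pmf.variance_positive)
            also have "\<dots> = E n (\<lambda>t. \<bar>\<Delta> n t\<bar>\<^sup>2) - (E n (\<lambda>t. \<bar>\<Delta> n t\<bar>))\<^sup>2"
              unfolding E_def by (rule measure_pmf.variance_eq[OF int int])
            finally show ?thesis by simp
          qed
          hence abs_le: "E n (\<lambda>t. \<bar>\<Delta> n t\<bar>) \<le> sqrt (E n (\<lambda>t. (\<Delta> n t)\<^sup>2))" by (intro real_le_rsqrt) simp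
          have sm: "\<bar>s n\<bar> * \<mu> n = \<bar>\<theta>\<bar> * sqrt (\<mu> n)"
            using elim real_sqrt_mult_self[of "\<mu> n"] by (simp add: s_def abs_divide field_simps)
          have "\<bar>s n\<bar> * \<mu> n * E n (\<lambda>t. \<bar>\<Delta> n t\<bar>) \<le> \<bar>\<theta>\<bar> * sqrt (\<mu> n) * sqrt (E n (\<lambda>t. (\<Delta> n t)\<^sup>2))"
            unfolding sm using elim by (intro mult_left_mono abs_le) auto
          thus "\<bar>s n\<bar> * \<mu> n * E n (\<lambda>t. \<bar>\<Delta> n t\<bar>) \<le> \<bar>\<theta>\<bar> * sqrt (\<mu> n * E n (\<lambda>t. (\<Delta> n t)\<^sup>2))"
            by (simp add: real_sqrt_mult mult.assoc)
        qed
        finally show ?case .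
      qed
      have "((\<lambda>n. exp 2 * \<theta>\<^sup>2 * C * r n + \<bar>\<theta>\<bar> * sqrt (\<mu> n * E n (\<lambda>t. (\<Delta> n t)\<^sup>2))) \<longlongrightarrow> exp 2 * \<theta>\<^sup>2 * C * 0 + \<bar>\<theta>\<bar> * 0) ?F"
        by (intro tendsto_add tendsto_mult tendsto_const r0 \<Delta>0)
      thus "((\<lambda>n. exp 2 * \<theta>\<^sup>2 * C * r n + \<bar>\<theta>\<bar> * sqrt (\<mu> n * E n (\<lambda>t. (\<Delta> n t)\<^sup>2))) \<longlongrightarrow> 0) ?F" by simp
    qed
    from tendsto_add[OF this b_lim]
    have "((\<lambda>n. char (law n) \<theta>) \<longlongrightarrow> exp (- (of_real (\<theta>\<^sup>2 / 2)))) ?F" by simp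
    also have "exp (- (of_real (\<theta>\<^sup>2 / 2))) = char std_normal_distribution \<theta>"
      by (simp add: char_std_normal_distribution exp_of_real[symmetric])
    finally show "((\<lambda>n. char (law n) \<theta>) \<longlongrightarrow> char std_normal_distribution \<theta>) ?F" .
  qed
  thus ?thesis unfolding F law_def X_def \<mu>_def \<pi>_def .
qed

end

theorem theorem6p2:
  fixes p :: "nat pmf" and T :: "nat \<Rightarrow> plane_tree"
  assumes p0: "pmf p 0 > 0"
    and p2: "\<exists>i\<ge>2. pmf p i > 0"
    and mean: "(\<lambda>i. real i * pmf p i) sums 1"
    and cond: "(0 < offspring_variance p \<and> offspring_variance p < \<infinity>) \<or>
      (offspring_variance p = \<infinity> \<and> (\<exists>\<alpha>. 1 < \<alpha> \<and> \<alpha> \<le> 2 \<and> truncated_moments_regular p \<alpha>))"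
    and T_size: "filterlim (\<lambda>n. tree_size (T n)) at_top (gw_sizes p)"
  shows "(\<forall>\<mu>\<ge>0. ((\<lambda>n. real n * tree_weight p (T n)) \<longlongrightarrow> \<mu>) (gw_sizes p) \<longrightarrow>
        conv_in_distribution
          (\<lambda>n. distr (conditioned_gw p n) borel (\<lambda>t. real (fringe_count (T n) t)))
          (poisson_law \<mu>) (gw_sizes p) \<and>
        conv_of_moments
          (\<lambda>n. distr (conditioned_gw p n) borel (\<lambda>t. real (fringe_count (T n) t)))
          (poisson_law \<mu>) (gw_sizes p)) \<and>
    (filterlim (\<lambda>n. real n * tree_weight p (T n)) at_top (gw_sizes p) \<longrightarrow>
        conv_in_distribution
          (\<lambda>n. distr (conditioned_gw p n) borel
            (\<lambda>t. (real (fringe_count (T n) t) - real n * tree_weight p (T n)) /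
                  sqrt (real n * tree_weight p (T n))))
          std_normal_distribution (gw_sizes p))"
proof -
  interpret critical_offspring p by unfold_locales (use p0 p2 mean in auto)
  obtain \<beta> where "regularly_varying_sum W \<beta> a" using exists_regularly_varying_sum[OF cond] by blast
  then interpret critical_regular p \<beta>
    by (intro critical_regular.intro critical_offspring_axioms)
  show ?thesis using Poisson_limit normal_limit[OF T_size] by blast
qed

end
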